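(* Let $K$ be a commutative ring, $n\ge4$, and $s=1,\dots,\left[\frac{n-1}2\right]$. Let $\{j_i=j_{i,s}\}_{1\le i\le n-1}$ be avoidance functions (for this $s$). Then: 1. $\Phi^{2s+1}=\Phi'^{2s+1}\Sigma'^{2s+1}=\Sigma'^{2s+1}\Phi'^{2s+1}$. 2. $\Phi^{2s+1}/\Phi^{2s+3}\simeq\Sigma'^{2s+1}/\Sigma'^{2s+3}\times\Phi'^{2s+1}/\Phi^{2s+3}$, the direct product of abelian groups. 3. Each automorphism $\sigma\in\Phi^{2s+1}$, $x_i\mapsto x_i(1+b_i+\cdots)$, $b_i\in\Lambda_{n,2s}(i)$, $i=1,\dots,n$ (the dots denote terms of higher degree), is the unique product modulo $\Phi^{2s+3}$ $$\sigma\equiv\phi'\prod_{i=1}^{n-1}\prod_{\alpha\in S_i'}\rho_{i,j_i(\alpha);\lambda_{i,\alpha}x^\alpha}\mod\Phi^{2s+3},$$ where $\phi'(x_k)=x_k$ for $1\le k\le n-2s-1$, $\phi'(x_i)=x_i(1+a_i)$ for $n-2s\le i\le n$, and $$(b_1,\dots,b_n)=\sum_{i=1}^{n-1}\sum_{\alpha\in S_i'}\lambda_{i,\alpha}x^\alpha(e_i-e_{j_i(\alpha)})+\sum_{i=n-2s}^na_ie_i$$ in $V=\bigoplus_{i=1}^n\Lambda_{n,2s}(i)e_i$ for unique $\lambda_{i,\alpha}\in K$ and unique elements $a_i\in A_i$, $n-2s\le i\le n$.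
   Context: $\Lambda_n=\Lambda_n(K)$ is the Grassmann $K$-algebra generated freely over $K$ by $x_1,\dots,x_n$ subject to $x_i^2=0$, $x_ix_j=-x_jx_i$ ($i\ne j$); it is free over $K$ with basis $x^\alpha=x_{i_1}\cdots x_{i_k}$, $\alpha=\{i_1<\dots<i_k\}\subseteq\{1,\dots,n\}$, graded by $|\alpha|$, with components $\Lambda_{n,d}$; $\mathfrak m=\bigoplus_{d\ge1}\Lambda_{n,d}$; $\Lambda_n^{od}$ is the sum of the odd degree components. $\Lambda_{n,2s}(i)=K\lfloor x_1,\dots,\widehat{x_i},\dots,x_n\rfloor_{2s}$ is the span of the monomials $x^\alpha$ with $|\alpha|=2s$, $i\notin\alpha$. $e_1,\dots,e_n$ are the standard unit vectors. $[\cdot]$ is the integer part. $\Gamma$ is the group of $K$-algebra automorphisms $\sigma$ of $\Lambda_n$ with $\sigma(x_i)-x_i\in\Lambda_n^{od}\cap\mathfrak m^3$ for all $i$. $\Phi$ is the subgroup of all $\sigma\in\Gamma$ with $\sigma(x_i)\in(x_i)$ for all $i$, i.e. $\sigma(x_i)=x_i(1+c_i)$ with $c_i$ a combination of monomials of even degree $\ge2$ not involving $x_i$. $\Phi^{m}=\{\sigma\in\Phi\mid(\sigma-1)(\mathfrak m)\subseteq\mathfrak m^m\}$. The left skew derivation $\partial/\partial x_j$ is the $K$-linear map with $\frac{\partial x_k}{\partial x_j}=\delta_{jk}$ and $\frac{\partial (ab)}{\partial x_j}=\frac{\partial a}{\partial x_j}b+(-1)^i a\frac{\partial b}{\partial x_j}$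 for $a\in\Lambda_{n,i}$; $\mathcal J(\sigma)=\det(\partial\sigma(x_i)/\partial x_j)$. $\Sigma'=\{\sigma\in\Phi\mid\mathcal J(\sigma)=1\}$ and $\Sigma'^m=\Sigma'\cap\Phi^m$. For the fixed $s$: $A_i$ is the $K$-span of all monomials $x^\alpha$ with $|\alpha|=2s$, $i\notin\alpha$, $\{i+1,\dots,n\}\subseteq\alpha$ (zero if $i<n-2s$). $\Phi'^{2s+1}$ is the subgroup of those $\sigma\in\Phi^{2s+1}$, $\sigma(x_i)=x_i(1+c_i)$, such that the degree $2s$ component of $c_i$ lies in $A_i$ for every $i$; it contains $\Phi^{2s+3}$. For $1\le i\le n-1$, $S_i'=S'_{i,s}$ is the set of all $\alpha\subseteq\{1,\dots,n\}\setminus\{i\}$ with $|\alpha|=2s$ and $\{i+1,\dots,n\}\not\subseteq\alpha$. Avoidance functions are any functions $j_i:S_i'\to\{i+1,\dots,n\}$ with $j_i(\alpha)\in\{i+1,\dots,n\}\setminus\alpha$. For $j=j_i(\alpha)$, $\lambda\in K$, $\rho_{i,j;\lambda x^\alpha}\in\Sigma'$ is the automorphism $x_i\mapsto x_i(1+\lambda x^\alpha)$, $x_j\mapsto x_j(1-\lambda x^\alpha)$, $x_k\mapsto x_k$ ($k\ne i,j$). *)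

theory Defs
  imports
    "HOL-Algebra.Ring"
    "HOL-Algebra.Module"
    "HOL-Algebra.Coset"
    "HOL-Algebra.Bij"
    "HOL-Algebra.Ideal_Product"
    "HOL-Combinatorics.Permutations"
begin

section \<open>The Grassmann algebra\<close>

text \<open>
  An element of the Grassmann algebra in \<open>x\<^sub>1, \<dots>, x\<^sub>n\<close> is represented by its coefficient function:
  \<open>a \<alpha>\<close> is the coefficient of the monomial \<open>x\<^sup>\<alpha>\<close>, where \<open>\<alpha> \<subseteq> {1..n}\<close>. For disjoint \<open>\<alpha>\<close>, \<open>\<beta>\<close> one has
  \<open>x\<^sup>\<alpha> x\<^sup>\<beta> = (- 1)\<^sup>k x\<^sup>\<alpha>\<^sup>\<union>\<^sup>\<beta>\<close> with \<open>k\<close> the number of pairs \<open>i \<in> \<alpha>\<close>, \<open>j \<in> \<beta>\<close> that are out of order.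
\<close>

definition inversions :: "nat set \<Rightarrow> nat set \<Rightarrow> nat" where
  "inversions \<alpha> \<beta> = card {(i, j). i \<in> \<alpha> \<and> j \<in> \<beta> \<and> j < i}"

definition Grassmann :: "nat \<Rightarrow> ('k::comm_ring_1, nat set \<Rightarrow> 'k) module" where
  "Grassmann n =
    \<lparr>carrier = {a. \<forall>\<alpha>. a \<alpha> \<noteq> 0 \<longrightarrow> \<alpha> \<subseteq> {1..n}},
     monoid.mult = (\<lambda>a b \<gamma>. \<Sum>\<alpha>\<in>Pow \<gamma>. (- 1) ^ inversions \<alpha> (\<gamma> - \<alpha>) * a \<alpha> * b (\<gamma> - \<alpha>)),
     one = (\<lambda>\<gamma>. if \<gamma> = {} then 1 else 0),
     zero = (\<lambda>\<gamma>. 0),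
     add = (\<lambda>a b \<gamma>. a \<gamma> + b \<gamma>),
     smult = (\<lambda>c a \<gamma>. c * a \<gamma>)\<rparr>"

definition xmon :: "nat set \<Rightarrow> nat set \<Rightarrow> 'k::comm_ring_1" where
  "xmon \<alpha> = (\<lambda>\<gamma>. if \<gamma> = \<alpha> then 1 else 0)"

definition xgen :: "nat \<Rightarrow> nat set \<Rightarrow> 'k::comm_ring_1" where
  "xgen i = xmon {i}"

text \<open>The \<open>K\<close>-span of the monomials \<open>x\<^sup>\<alpha>\<close> with \<open>\<alpha> \<subseteq> {1..n}\<close> and \<open>P \<alpha>\<close>.\<close>

definition mono_span :: "nat \<Rightarrow> (nat set \<Rightarrow> bool) \<Rightarrow> (nat set \<Rightarrow> 'k::comm_ring_1) set" where
  "mono_span n P = {a \<in> carrier (Grassmann n). \<forall>\<alpha>. a \<alpha> \<noteq> 0 \<longrightarrow> P \<alpha>}"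

definition hom_component :: "nat \<Rightarrow> (nat set \<Rightarrow> 'k::comm_ring_1) \<Rightarrow> nat set \<Rightarrow> 'k" where
  "hom_component d a = (\<lambda>\<alpha>. if card \<alpha> = d then a \<alpha> else 0)"

definition odd_part :: "nat \<Rightarrow> (nat set \<Rightarrow> 'k::comm_ring_1) set" where
  "odd_part n = mono_span n (\<lambda>\<alpha>. odd (card \<alpha>))"

definition max_ideal :: "nat \<Rightarrow> (nat set \<Rightarrow> 'k::comm_ring_1) set" where
  "max_ideal n = mono_span n (\<lambda>\<alpha>. card \<alpha> \<ge> 1)"

primrec max_ideal_pow :: "nat \<Rightarrow> nat \<Rightarrow> (nat set \<Rightarrow> 'k::comm_ring_1) set" where
  "max_ideal_pow n 0 = carrier (Grassmann n)"
| "max_ideal_pow n (Suc m) = ideal_prod (Grassmann n) (max_ideal n) (max_ideal_pow n m)"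

text \<open>\<open>\<Lambda>\<^sub>n\<^sub>,\<^sub>d(i)\<close>; only \<open>d = 2s\<close> is used.\<close>

definition hom_avoiding :: "nat \<Rightarrow> nat \<Rightarrow> nat \<Rightarrow> (nat set \<Rightarrow> 'k::comm_ring_1) set" where
  "hom_avoiding n d i = mono_span n (\<lambda>\<alpha>. card \<alpha> = d \<and> i \<notin> \<alpha>)"


subsection \<open>Adequacy of the model\<close>

lemma Grassmann_simps:
  "carrier (Grassmann n) = {a. \<forall>\<alpha>. a \<alpha> \<noteq> 0 \<longrightarrow> \<alpha> \<subseteq> {1..n}}"
  "a \<otimes>\<^bsub>Grassmann n\<^esub> b = (\<lambda>\<gamma>. \<Sum>\<alpha>\<in>Pow \<gamma>. (- 1) ^ inversions \<alpha> (\<gamma> - \<alpha>) * a \<alpha> * b (\<gamma> - \<alpha>))"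
  "\<one>\<^bsub>Grassmann n\<^esub> = (\<lambda>\<gamma>. if \<gamma> = {} then 1 else 0)"
  "\<zero>\<^bsub>Grassmann n\<^esub> = (\<lambda>\<gamma>. 0)"
  "a \<oplus>\<^bsub>Grassmann n\<^esub> b = (\<lambda>\<gamma>. a \<gamma> + b \<gamma>)"
  "c \<odot>\<^bsub>Grassmann n\<^esub> a = (\<lambda>\<gamma>. c * a \<gamma>)"
  by (simp_all add: Grassmann_def)

lemma inversions_Un_left:
  assumes "finite \<alpha>" "finite \<beta>" "finite \<gamma>" "\<alpha> \<inter> \<beta> = {}"
  shows "inversions (\<alpha> \<union> \<beta>) \<gamma> = inversions \<alpha> \<gamma> + inversions \<beta> \<gamma>"
proof -
  have "{(i, j). i \<in> \<alpha> \<union> \<beta> \<and> j \<in> \<gamma> \<and> j < i} =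
      {(i, j). i \<in> \<alpha> \<and> j \<in> \<gamma> \<and> j < i} \<union> {(i, j). i \<in> \<beta> \<and> j \<in> \<gamma> \<and> j < i}" by auto
  moreover have "finite {(i, j). i \<in> \<alpha> \<and> j \<in> \<gamma> \<and> j < i}"
    by (rule finite_subset[of _ "\<alpha> \<times> \<gamma>"]) (use assms in auto)
  moreover have "finite {(i, j). i \<in> \<beta> \<and> j \<in> \<gamma> \<and> j < i}"
    by (rule finite_subset[of _ "\<beta> \<times> \<gamma>"]) (use assms in auto)
  ultimately show ?thesis
    unfolding inversions_def using assms(4) by (subst card_Un_disjoint[symmetric]) auto
qed

lemma inversions_Un_right:
  assumes "finite \<alpha>" "finite \<beta>" "finite \<gamma>" "\<beta> \<inter> \<gamma> = {}"
  shows "inversions \<alpha> (\<beta> \<union> \<gamma>) = inversions \<alpha> \<beta> + inversions \<alpha> \<gamma>"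
proof -
  have "{(i, j). i \<in> \<alpha> \<and> j \<in> \<beta> \<union> \<gamma> \<and> j < i} =
      {(i, j). i \<in> \<alpha> \<and> j \<in> \<beta> \<and> j < i} \<union> {(i, j). i \<in> \<alpha> \<and> j \<in> \<gamma> \<and> j < i}" by auto
  moreover have "finite {(i, j). i \<in> \<alpha> \<and> j \<in> \<beta> \<and> j < i}"
    by (rule finite_subset[of _ "\<alpha> \<times> \<beta>"]) (use assms in auto)
  moreover have "finite {(i, j). i \<in> \<alpha> \<and> j \<in> \<gamma> \<and> j < i}"
    by (rule finite_subset[of _ "\<alpha> \<times> \<gamma>"]) (use assms in auto)
  ultimately show ?thesis
    unfolding inversions_def using assms(4) by (subst card_Un_disjoint[symmetric]) auto
qed

lemma inversions_empty [simp]: "inversions {} \<beta> = 0" "inversions \<alpha> {} = 0"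
  by (simp_all add: inversions_def)

lemma inversions_singleton_left: "inversions {i} \<beta> = card {k \<in> \<beta>. k < i}"
proof -
  have "{(i', j). i' \<in> {i} \<and> j \<in> \<beta> \<and> j < i'} = Pair i ` {k \<in> \<beta>. k < i}" by auto
  then show ?thesis unfolding inversions_def by (simp add: card_image inj_on_def)
qed

lemma inversions_singleton_right: "inversions \<alpha> {j} = card {k \<in> \<alpha>. j < k}"
proof -
  have "{(i, j'). i \<in> \<alpha> \<and> j' \<in> {j} \<and> j' < i} = (\<lambda>i. (i, j)) ` {k \<in> \<alpha>. j < k}" by auto
  then show ?thesis unfolding inversions_def by (simp add: card_image inj_on_def)
qed

lemma Grassmann_mult_closed:
  assumes "a \<in> carrier (Grassmann n)" "b \<in> carrier (Grassmann n)"
  shows "a \<otimes>\<^bsub>Grassmann n\<^esub> b \<in> carrier (Grassmann n)"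
proof -
  have "\<gamma> \<subseteq> {1..n}"
    if nz_sum: "(\<Sum>\<alpha>\<in>Pow \<gamma>. (- 1) ^ inversions \<alpha> (\<gamma> - \<alpha>) * a \<alpha> * b (\<gamma> - \<alpha>)) \<noteq> 0" for \<gamma>
  proof -
    obtain \<alpha> where "\<alpha> \<in> Pow \<gamma>" and nz: "(- 1) ^ inversions \<alpha> (\<gamma> - \<alpha>) * a \<alpha> * b (\<gamma> - \<alpha>) \<noteq> 0"
      by (rule sum.not_neutral_contains_not_neutral[OF nz_sum])
    from nz have "a \<alpha> \<noteq> 0" "b (\<gamma> - \<alpha>) \<noteq> 0" by auto
    then have "\<alpha> \<subseteq> {1..n}" "\<gamma> - \<alpha> \<subseteq> {1..n}"
      using assms by (auto simp: Grassmann_simps)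
    with \<open>\<alpha> \<in> Pow \<gamma>\<close> show ?thesis by auto
  qed
  then show ?thesis by (simp add: Grassmann_simps)
qed

lemma Grassmann_mult_assoc:
  fixes a b c :: "nat set \<Rightarrow> 'k::comm_ring_1"
  shows "(a \<otimes>\<^bsub>Grassmann n\<^esub> b) \<otimes>\<^bsub>Grassmann n\<^esub> c = a \<otimes>\<^bsub>Grassmann n\<^esub> (b \<otimes>\<^bsub>Grassmann n\<^esub> c)"
proof
  fix \<gamma> :: "nat set"
  let ?s = "\<lambda>\<alpha> \<beta>. (- 1 :: 'k) ^ inversions \<alpha> \<beta>"
  show "((a \<otimes>\<^bsub>Grassmann n\<^esub> b) \<otimes>\<^bsub>Grassmann n\<^esub> c) \<gamma> = (a \<otimes>\<^bsub>Grassmann n\<^esub> (b \<otimes>\<^bsub>Grassmann n\<^esub> c)) \<gamma>"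
  proof (cases "finite \<gamma>")
    case False
    then show ?thesis by (simp add: Grassmann_simps)
  next
    case True
    note fin = finite_subset[OF _ True]
    have "((a \<otimes>\<^bsub>Grassmann n\<^esub> b) \<otimes>\<^bsub>Grassmann n\<^esub> c) \<gamma> =
        (\<Sum>\<delta>\<in>Pow \<gamma>. \<Sum>\<alpha>\<in>Pow \<delta>. ?s \<delta> (\<gamma> - \<delta>) * (?s \<alpha> (\<delta> - \<alpha>) * a \<alpha> * b (\<delta> - \<alpha>)) * c (\<gamma> - \<delta>))"
      by (simp add: Grassmann_simps sum_distrib_left sum_distrib_right)
    also have "\<dots> = (\<Sum>(\<delta>, \<alpha>)\<in>(SIGMA \<delta>:Pow \<gamma>. Pow \<delta>).
        ?s \<delta> (\<gamma> - \<delta>) * (?s \<alpha> (\<delta> - \<alpha>) * a \<alpha> * b (\<delta> - \<alpha>)) * c (\<gamma> - \<delta>))"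
      by (rule sum.Sigma) (use True fin in auto)
    also have "\<dots> = (\<Sum>(\<alpha>, \<beta>)\<in>(SIGMA \<alpha>:Pow \<gamma>. Pow (\<gamma> - \<alpha>)).
        ?s \<alpha> (\<gamma> - \<alpha>) * a \<alpha> * (?s \<beta> (\<gamma> - \<alpha> - \<beta>) * b \<beta> * c (\<gamma> - \<alpha> - \<beta>)))"
    proof (rule sum.reindex_bij_witness[of _ "\<lambda>(\<alpha>, \<beta>). (\<alpha> \<union> \<beta>, \<alpha>)" "\<lambda>(\<delta>, \<alpha>). (\<alpha>, \<delta> - \<alpha>)"],
        goal_cases)
      case (5 p)
      obtain \<delta> \<alpha> where p: "p = (\<delta>, \<alpha>)" by (cases p)
      with 5 have sub: "\<delta> \<subseteq> \<gamma>" "\<alpha> \<subseteq> \<delta>" by auto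
      define \<beta> \<epsilon> where "\<beta> = \<delta> - \<alpha>" and "\<epsilon> = \<gamma> - \<delta>"
      have eq: "\<delta> = \<alpha> \<union> \<beta>" "\<gamma> - \<alpha> = \<beta> \<union> \<epsilon>" "\<gamma> - \<alpha> - \<beta> = \<epsilon>" "\<gamma> - \<delta> = \<epsilon>"
        using sub by (auto simp: \<beta>_def \<epsilon>_def)
      have f: "finite \<alpha>" "finite \<beta>" "finite \<epsilon>"
        using fin sub by (auto simp: \<beta>_def \<epsilon>_def)
      have "inversions \<delta> \<epsilon> = inversions \<alpha> \<epsilon> + inversions \<beta> \<epsilon>"
        unfolding eq(1) by (rule inversions_Un_left) (use f in \<open>auto simp: \<beta>_def\<close>)
      moreover have "inversions \<alpha> (\<gamma> - \<alpha>) = inversions \<alpha> \<beta> + inversions \<alpha> \<epsilon>"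
        unfolding eq(2) by (rule inversions_Un_right) (use f in \<open>auto simp: \<beta>_def \<epsilon>_def\<close>)
      ultimately show ?case
        using p by (simp add: eq(3,4) \<beta>_def[symmetric] power_add algebra_simps)
    qed auto
    also have "\<dots> = (a \<otimes>\<^bsub>Grassmann n\<^esub> (b \<otimes>\<^bsub>Grassmann n\<^esub> c)) \<gamma>"
      unfolding Grassmann_simps sum_distrib_left
      by (rule sum.Sigma[symmetric]) (use True in auto)
    finally show ?thesis .
  qed
qed

lemma Grassmann_one_mult:
  assumes "a \<in> carrier (Grassmann n)"
  shows "\<one>\<^bsub>Grassmann n\<^esub> \<otimes>\<^bsub>Grassmann n\<^esub> a = a" "a \<otimes>\<^bsub>Grassmann n\<^esub> \<one>\<^bsub>Grassmann n\<^esub> = a"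
proof -
  have fin: "a \<gamma> = 0" if "infinite \<gamma>" for \<gamma>
    using assms that finite_subset[of \<gamma> "{1..n}"] by (auto simp: Grassmann_simps)
  show "\<one>\<^bsub>Grassmann n\<^esub> \<otimes>\<^bsub>Grassmann n\<^esub> a = a"
  proof
    fix \<gamma>
    show "(\<one>\<^bsub>Grassmann n\<^esub> \<otimes>\<^bsub>Grassmann n\<^esub> a) \<gamma> = a \<gamma>"
    proof (cases "finite \<gamma>")
      case True
      have "(\<one>\<^bsub>Grassmann n\<^esub> \<otimes>\<^bsub>Grassmann n\<^esub> a) \<gamma> = (\<Sum>\<alpha>\<in>Pow \<gamma>. if \<alpha> = {} then a \<gamma> else 0)"
        unfolding Grassmann_simps by (rule sum.cong) auto
      then show ?thesis using True by simp
    qed (simp add: Grassmann_simps fin)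
  qed
  show "a \<otimes>\<^bsub>Grassmann n\<^esub> \<one>\<^bsub>Grassmann n\<^esub> = a"
  proof
    fix \<gamma>
    show "(a \<otimes>\<^bsub>Grassmann n\<^esub> \<one>\<^bsub>Grassmann n\<^esub>) \<gamma> = a \<gamma>"
    proof (cases "finite \<gamma>")
      case True
      have "(a \<otimes>\<^bsub>Grassmann n\<^esub> \<one>\<^bsub>Grassmann n\<^esub>) \<gamma> = (\<Sum>\<alpha>\<in>Pow \<gamma>. if \<alpha> = \<gamma> then a \<gamma> else 0)"
        unfolding Grassmann_simps by (rule sum.cong) auto
      then show ?thesis using True by simp
    qed (simp add: Grassmann_simps fin)
  qed
qed

theorem ring_Grassmann: "ring (Grassmann n :: ('k::comm_ring_1, nat set \<Rightarrow> 'k) module)"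
proof (rule ringI)
  show "abelian_group (Grassmann n :: ('k, nat set \<Rightarrow> 'k) module)"
  proof (rule abelian_groupI)
    fix x :: "nat set \<Rightarrow> 'k"
    assume "x \<in> carrier (Grassmann n)"
    then show "\<exists>y\<in>carrier (Grassmann n). y \<oplus>\<^bsub>Grassmann n\<^esub> x = \<zero>\<^bsub>Grassmann n\<^esub>"
      by (intro bexI[of _ "\<lambda>\<gamma>. - x \<gamma>"]) (auto simp: Grassmann_simps)
  next
    fix x y :: "nat set \<Rightarrow> 'k"
    assume "x \<in> carrier (Grassmann n)" "y \<in> carrier (Grassmann n)"
    then show "x \<oplus>\<^bsub>Grassmann n\<^esub> y \<in> carrier (Grassmann n)"
      by (simp add: Grassmann_simps) (metis add.left_neutral)
  qed (auto simp: Grassmann_simps add_ac)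
  show "monoid (Grassmann n :: ('k, nat set \<Rightarrow> 'k) module)"
    by (rule monoidI)
      (simp_all add: Grassmann_mult_closed Grassmann_mult_assoc Grassmann_one_mult,
       simp add: Grassmann_simps)
qed (auto simp: Grassmann_simps algebra_simps sum.distrib)

lemma Grassmann_mult_xmon:
  "finite \<alpha> \<Longrightarrow> finite \<beta> \<Longrightarrow> xmon \<alpha> \<otimes>\<^bsub>Grassmann n\<^esub> xmon \<beta> =
     (\<lambda>\<gamma>. if \<gamma> = \<alpha> \<union> \<beta> \<and> \<alpha> \<inter> \<beta> = {} then (- 1) ^ inversions \<alpha> \<beta> else 0)"
proof
  fix \<gamma> assume f: "finite \<alpha>" "finite \<beta>"
  let ?r = "if \<gamma> = \<alpha> \<union> \<beta> \<and> \<alpha> \<inter> \<beta> = {} then (- 1) ^ inversions \<alpha> \<beta> else (0 :: 'a)"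
  show "(xmon \<alpha> \<otimes>\<^bsub>Grassmann n\<^esub> xmon \<beta>) \<gamma> = ?r"
  proof (cases "finite \<gamma>")
    case True
    have iff: "\<alpha> \<subseteq> \<gamma> \<and> \<gamma> - \<alpha> = \<beta> \<longleftrightarrow> \<gamma> = \<alpha> \<union> \<beta> \<and> \<alpha> \<inter> \<beta> = {}" by auto
    have "(xmon \<alpha> \<otimes>\<^bsub>Grassmann n\<^esub> xmon \<beta>) \<gamma> = (\<Sum>\<alpha>'\<in>Pow \<gamma>. if \<alpha>' = \<alpha> then ?r else 0)"
      unfolding Grassmann_simps by (rule sum.cong) (use iff in \<open>auto simp: xmon_def\<close>)
    also have "\<dots> = ?r" using True iff by auto
    finally show ?thesis .
  next
    case False
    then have "\<gamma> \<noteq> \<alpha> \<union> \<beta>" using f by auto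
    with False show ?thesis by (simp add: Grassmann_simps)
  qed
qed

lemma xgen_square: "xgen i \<otimes>\<^bsub>Grassmann n\<^esub> xgen i = \<zero>\<^bsub>Grassmann n\<^esub>"
  by (simp add: xgen_def Grassmann_mult_xmon) (simp add: Grassmann_simps)

lemma xgen_anticommute:
  "i \<noteq> j \<Longrightarrow> xgen i \<otimes>\<^bsub>Grassmann n\<^esub> xgen j = (\<lambda>\<gamma>. - (xgen j \<otimes>\<^bsub>Grassmann n\<^esub> xgen i) \<gamma>)"
proof -
  assume "i \<noteq> j"
  have "{k. k = b \<and> k < a} = (if b < a then {b} else {})" for a b :: nat by auto
  with \<open>i \<noteq> j\<close> show ?thesis
    by (cases i j rule: linorder_cases)
      (auto simp: xgen_def Grassmann_mult_xmon inversions_singleton_left fun_eq_iff)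
qed

lemma xmon_insert:
  assumes "finite \<alpha>" "\<And>k. k \<in> \<alpha> \<Longrightarrow> i < k"
  shows "xmon (insert i \<alpha>) = xgen i \<otimes>\<^bsub>Grassmann n\<^esub> xmon \<alpha>"
proof -
  have "{k \<in> \<alpha>. k < i} = {}" "i \<notin> \<alpha>" using assms(2) by fastforce+
  then have "inversions {i} \<alpha> = 0" "{i} \<inter> \<alpha> = {}"
    by (simp_all add: inversions_singleton_left)
  then show ?thesis
    using assms(1) by (simp add: xgen_def Grassmann_mult_xmon) (simp add: xmon_def fun_eq_iff)
qed


section \<open>The left skew derivations and the Jacobian\<close>

text \<open>
  The derivative of \<open>x\<^sup>\<alpha>\<close> by \<open>x\<^sub>j\<close> is \<open>0\<close> if \<open>j \<notin> \<alpha>\<close>, and otherwise \<open>(- 1)\<^sup>k\<close> times the monomial of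
  \<open>\<alpha> - {j}\<close>, with \<open>k\<close> the number of elements of \<open>\<alpha>\<close> below \<open>j\<close>. The lemmas below show that this is
  the linear map of the usual definition, given by its values on the generators
  and the skew Leibniz rule.
\<close>

definition skew_deriv :: "nat \<Rightarrow> (nat set \<Rightarrow> 'k::comm_ring_1) \<Rightarrow> nat set \<Rightarrow> 'k" where
  "skew_deriv j a = (\<lambda>\<beta>. if j \<in> \<beta> then 0 else (- 1) ^ card {k \<in> \<beta>. k < j} * a (insert j \<beta>))"

lemma skew_deriv_closed:
  "a \<in> carrier (Grassmann n) \<Longrightarrow> skew_deriv j a \<in> carrier (Grassmann n)"
proof -
  assume a: "a \<in> carrier (Grassmann n)"
  have "\<beta> \<subseteq> {1..n}" if "skew_deriv j a \<beta> \<noteq> 0" for \<beta>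
  proof -
    from that have "a (insert j \<beta>) \<noteq> 0" by (auto simp: skew_deriv_def split: if_splits)
    then show ?thesis using a by (auto simp: Grassmann_simps)
  qed
  then show ?thesis by (simp add: Grassmann_simps)
qed

lemma skew_deriv_linear:
  "skew_deriv j (a \<oplus>\<^bsub>Grassmann n\<^esub> b) = skew_deriv j a \<oplus>\<^bsub>Grassmann n\<^esub> skew_deriv j b"
  "skew_deriv j (c \<odot>\<^bsub>Grassmann n\<^esub> a) = c \<odot>\<^bsub>Grassmann n\<^esub> skew_deriv j a"
  by (auto simp: skew_deriv_def Grassmann_simps algebra_simps)

lemma skew_deriv_xgen:
  "skew_deriv j (xgen k) = (if j = k then \<one>\<^bsub>Grassmann n\<^esub> else \<zero>\<^bsub>Grassmann n\<^esub>)"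
  by (auto simp: skew_deriv_def xgen_def xmon_def Grassmann_simps fun_eq_iff)

lemma card_split:
  fixes \<alpha> :: "nat set"
  assumes "finite \<alpha>" "j \<notin> \<alpha>"
  shows "card \<alpha> = card {k \<in> \<alpha>. j < k} + card {k \<in> \<alpha>. k < j}"
proof -
  have "\<alpha> = {k \<in> \<alpha>. j < k} \<union> {k \<in> \<alpha>. k < j}"
    using assms(2) by (auto; metis nat_neq_iff)
  then have "card \<alpha> = card ({k \<in> \<alpha>. j < k} \<union> {k \<in> \<alpha>. k < j})" by simp
  also have "\<dots> = card {k \<in> \<alpha>. j < k} + card {k \<in> \<alpha>. k < j}"
    by (rule card_Un_disjoint) (use assms(1) in auto)
  finally show ?thesis .
qed

lemma skew_deriv_mult:
  fixes a b :: "nat set \<Rightarrow> 'k::comm_ring_1"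
  assumes "a \<in> mono_span n (\<lambda>\<alpha>. card \<alpha> = d)"
  shows "skew_deriv j (a \<otimes>\<^bsub>Grassmann n\<^esub> b) =
    (skew_deriv j a \<otimes>\<^bsub>Grassmann n\<^esub> b) \<oplus>\<^bsub>Grassmann n\<^esub>
    ((- 1) ^ d \<odot>\<^bsub>Grassmann n\<^esub> (a \<otimes>\<^bsub>Grassmann n\<^esub> skew_deriv j b))"
proof
  fix \<gamma> :: "nat set"
  let ?c = "\<lambda>\<beta>. card {k \<in> \<beta>. k < j}"
  have deg: "card \<alpha> = d" if "a \<alpha> \<noteq> 0" for \<alpha>
    using assms that by (auto simp: mono_span_def)
  have c_Un: "?c (\<alpha> \<union> \<beta>) = ?c \<alpha> + ?c \<beta>" if "finite \<alpha>" "finite \<beta>" "\<alpha> \<inter> \<beta> = {}" for \<alpha> \<beta>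
    using that by (subst card_Un_disjoint[symmetric]) (auto intro!: arg_cong[where f = card])
  show "skew_deriv j (a \<otimes>\<^bsub>Grassmann n\<^esub> b) \<gamma> =
    ((skew_deriv j a \<otimes>\<^bsub>Grassmann n\<^esub> b) \<oplus>\<^bsub>Grassmann n\<^esub>
    ((- 1) ^ d \<odot>\<^bsub>Grassmann n\<^esub> (a \<otimes>\<^bsub>Grassmann n\<^esub> skew_deriv j b))) \<gamma>"
  proof (cases "finite \<gamma>")
    case False
    then show ?thesis by (simp add: Grassmann_simps skew_deriv_def)
  next
    case fin: True
    note fs = finite_subset[OF _ fin]
    show ?thesis
    proof (cases "j \<in> \<gamma>")
      case True
      show ?thesis
      proof -
        let ?t = "\<lambda>\<alpha>. (- 1) ^ inversions \<alpha> (\<gamma> - \<alpha>) * skew_deriv j a \<alpha> * b (\<gamma> - \<alpha>)"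
        let ?u = "\<lambda>\<alpha>. (- 1) ^ d * ((- 1) ^ inversions \<alpha> (\<gamma> - \<alpha>) * a \<alpha> * skew_deriv j b (\<gamma> - \<alpha>))"
        let ?A = "{\<alpha>\<in>Pow \<gamma>. j \<notin> \<alpha>}" and ?B = "{\<alpha>\<in>Pow \<gamma>. j \<in> \<alpha>}"
        have "sum ?t (Pow \<gamma>) = sum ?t ?A"
          by (rule sum.mono_neutral_right) (use fin in \<open>auto simp: skew_deriv_def\<close>)
        also have "\<dots> = (\<Sum>\<alpha>\<in>?B. - ?u \<alpha>)"
        proof (rule sum.reindex_bij_witness[of _ "\<lambda>\<alpha>. \<alpha> - {j}" "insert j"], goal_cases)
          case (5 \<alpha>)
          define \<beta> where "\<beta> = \<gamma> - insert j \<alpha>"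
          have eq: "\<gamma> - \<alpha> = {j} \<union> \<beta>" "insert j \<alpha> = \<alpha> \<union> {j}" "\<gamma> - insert j \<alpha> = \<beta>"
            using 5 True by (auto simp: \<beta>_def)
          have f: "finite \<alpha>" "finite \<beta>" using 5 fin by (auto simp: \<beta>_def intro: fs)
          have nin: "j \<notin> \<alpha>" "j \<notin> \<beta>" "\<alpha> \<inter> \<beta> = {}" using 5 by (auto simp: \<beta>_def)
          have "inversions \<alpha> (\<gamma> - \<alpha>) = card {k \<in> \<alpha>. j < k} + inversions \<alpha> \<beta>"
            unfolding eq(1) using f nin
            by (subst inversions_Un_right) (auto simp: inversions_singleton_right)
          moreover have "inversions (insert j \<alpha>) \<beta> = inversions \<alpha> \<beta> + ?c \<beta>"
            unfolding eq(2) using f nin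
            by (subst inversions_Un_left) (auto simp: inversions_singleton_left)
          moreover have "card \<alpha> = card {k \<in> \<alpha>. j < k} + ?c \<alpha>"
            using f(1) nin(1) by (rule card_split)
          moreover have "d = Suc (card \<alpha>)" if "a (insert j \<alpha>) \<noteq> 0"
            using deg[OF that] f nin by simp
          ultimately show ?case
            using nin eq(3)
            by (cases "a (insert j \<alpha>) = 0")
              (auto simp: skew_deriv_def eq(1) power_add algebra_simps simp flip: power_mult_distrib)
        qed (use True in auto)
        also have "\<dots> = - sum ?u ?B" by (simp add: sum_negf)
        also have "sum ?u ?B = sum ?u (Pow \<gamma>)"
          by (rule sum.mono_neutral_left) (use fin True in \<open>auto simp: skew_deriv_def\<close>)
        finally have "sum ?t (Pow \<gamma>) + sum ?u (Pow \<gamma>) = 0" by simp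
        with True show ?thesis by (simp add: Grassmann_simps skew_deriv_def sum_distrib_left)
      qed
    next
      case False
      let ?t = "\<lambda>\<alpha>. (- 1) ^ inversions \<alpha> (insert j \<gamma> - \<alpha>) * a \<alpha> * b (insert j \<gamma> - \<alpha>)"
      have split: "Pow (insert j \<gamma>) = insert j ` Pow \<gamma> \<union> Pow \<gamma>"
        by (simp add: Pow_insert Un_commute)
      have inj: "inj_on (insert j) (Pow \<gamma>)" using False by (auto simp: inj_on_def)
      have "skew_deriv j (a \<otimes>\<^bsub>Grassmann n\<^esub> b) \<gamma> = (- 1) ^ ?c \<gamma> * sum ?t (Pow (insert j \<gamma>))"
        using False by (simp add: skew_deriv_def Grassmann_simps)
      also have "sum ?t (Pow (insert j \<gamma>)) = sum ?t (insert j ` Pow \<gamma>) + sum ?t (Pow \<gamma>)"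
        unfolding split by (rule sum.union_disjoint) (use fin False in auto)
      also have "sum ?t (insert j ` Pow \<gamma>) = (\<Sum>\<alpha>\<in>Pow \<gamma>. ?t (insert j \<alpha>))"
        using inj by (simp add: sum.reindex)
      also have "(- 1) ^ ?c \<gamma> * ((\<Sum>\<alpha>\<in>Pow \<gamma>. ?t (insert j \<alpha>)) + sum ?t (Pow \<gamma>)) =
          (\<Sum>\<alpha>\<in>Pow \<gamma>. (- 1) ^ ?c \<gamma> * ?t (insert j \<alpha>)) + (\<Sum>\<alpha>\<in>Pow \<gamma>. (- 1) ^ ?c \<gamma> * ?t \<alpha>)"
        by (simp add: distrib_left sum_distrib_left)
      also have "(\<Sum>\<alpha>\<in>Pow \<gamma>. (- 1) ^ ?c \<gamma> * ?t (insert j \<alpha>)) =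
          (skew_deriv j a \<otimes>\<^bsub>Grassmann n\<^esub> b) \<gamma>"
        unfolding Grassmann_simps
      proof (rule sum.cong[OF refl], goal_cases)
        case (1 \<alpha>)
        define \<beta> where "\<beta> = \<gamma> - \<alpha>"
        have g: "\<gamma> = \<alpha> \<union> \<beta>" "insert j \<gamma> - insert j \<alpha> = \<beta>" "insert j \<alpha> = \<alpha> \<union> {j}"
          using 1 False by (auto simp: \<beta>_def)
        have f: "finite \<alpha>" "finite \<beta>" using 1 fin by (auto simp: \<beta>_def intro: fs)
        have nin: "j \<notin> \<alpha>" "j \<notin> \<beta>" "\<alpha> \<inter> \<beta> = {}" using 1 False by (auto simp: \<beta>_def)
        have "?c \<gamma> = ?c \<alpha> + ?c \<beta>" unfolding g(1) by (rule c_Un) (use f nin in auto)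
        moreover have "inversions (insert j \<alpha>) \<beta> = inversions \<alpha> \<beta> + ?c \<beta>"
          unfolding g(3) using f nin
          by (subst inversions_Un_left) (auto simp: inversions_singleton_left)
        ultimately show ?case
          using nin g(2) by (simp add: skew_deriv_def power_add \<beta>_def[symmetric] algebra_simps
              flip: power_mult_distrib)
      qed
      also have "(\<Sum>\<alpha>\<in>Pow \<gamma>. (- 1) ^ ?c \<gamma> * ?t \<alpha>) =
          ((- 1) ^ d \<odot>\<^bsub>Grassmann n\<^esub> (a \<otimes>\<^bsub>Grassmann n\<^esub> skew_deriv j b)) \<gamma>"
        unfolding Grassmann_simps sum_distrib_left
      proof (rule sum.cong[OF refl], goal_cases)
        case (1 \<alpha>)
        define \<beta> where "\<beta> = \<gamma> - \<alpha>"
        have nin: "j \<notin> \<alpha>" "j \<notin> \<beta>" "\<alpha> \<inter> \<beta> = {}" using 1 False by (auto simp: \<beta>_def)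
        have g: "\<gamma> = \<alpha> \<union> \<beta>" "insert j \<gamma> - \<alpha> = {j} \<union> \<beta>"
          using 1 nin by (auto simp: \<beta>_def)
        have f: "finite \<alpha>" "finite \<beta>" using 1 fin by (auto simp: \<beta>_def intro: fs)
        have "?c \<gamma> = ?c \<alpha> + ?c \<beta>" unfolding g(1) by (rule c_Un) (use f nin in auto)
        moreover have "inversions \<alpha> (insert j \<gamma> - \<alpha>) = card {k \<in> \<alpha>. j < k} + inversions \<alpha> \<beta>"
          unfolding g(2) using f nin
          by (subst inversions_Un_right) (auto simp: inversions_singleton_right)
        moreover have "card \<alpha> = card {k \<in> \<alpha>. j < k} + ?c \<alpha>"
          using f(1) nin(1) by (rule card_split)
        moreover have "d = card \<alpha>" if "a \<alpha> \<noteq> 0" using deg[OF that] by simp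
        ultimately show ?case
          using nin g(2) by (cases "a \<alpha> = 0")
            (auto simp: skew_deriv_def power_add \<beta>_def[symmetric] algebra_simps)
      qed
      finally show ?thesis by (simp add: Grassmann_simps)
    qed
  qed
qed

text \<open>
  The Leibniz formula. The products are taken in the order of the rows; for \<open>\<sigma> \<in> Gamma n\<close> the
  entries of the Jacobian matrix are even, hence central, so this order is immaterial.
\<close>

definition Grassmann_det ::
    "nat \<Rightarrow> (nat \<Rightarrow> nat \<Rightarrow> nat set \<Rightarrow> 'k::comm_ring_1) \<Rightarrow> nat set \<Rightarrow> 'k" where
  "Grassmann_det n M =
    (\<Oplus>\<^bsub>Grassmann n\<^esub>p\<in>{p. p permutes {1..n}}. of_int (sign p) \<odot>\<^bsub>Grassmann n\<^esub>
      foldr (\<lambda>i a. M i (p i) \<otimes>\<^bsub>Grassmann n\<^esub> a) [1..<Suc n] \<one>\<^bsub>Grassmann n\<^esub>)"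

definition Jac ::
    "nat \<Rightarrow> ((nat set \<Rightarrow> 'k::comm_ring_1) \<Rightarrow> nat set \<Rightarrow> 'k) \<Rightarrow> nat set \<Rightarrow> 'k" where
  "Jac n \<sigma> = Grassmann_det n (\<lambda>i j. skew_deriv j (\<sigma> (xgen i)))"


section \<open>Groups of automorphisms\<close>

text \<open>
  All groups below are subsets of (the carrier of) \<open>BijGroup (carrier (Grassmann n))\<close>, whose
  multiplication is composition; automorphisms are extensional, so they are equal as functions
  as soon as they agree on \<open>carrier (Grassmann n)\<close>.
\<close>

definition Grassmann_aut ::
    "nat \<Rightarrow> ((nat set \<Rightarrow> 'k::comm_ring_1) \<Rightarrow> nat set \<Rightarrow> 'k) set" where
  "Grassmann_aut n = {\<sigma> \<in> Bij (carrier (Grassmann n)).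
     \<sigma> \<in> ring_hom (Grassmann n) (Grassmann n) \<and>
     (\<forall>c. \<forall>a\<in>carrier (Grassmann n). \<sigma> (c \<odot>\<^bsub>Grassmann n\<^esub> a) = c \<odot>\<^bsub>Grassmann n\<^esub> \<sigma> a)}"

definition Gamma :: "nat \<Rightarrow> ((nat set \<Rightarrow> 'k::comm_ring_1) \<Rightarrow> nat set \<Rightarrow> 'k) set" where
  "Gamma n = {\<sigma> \<in> Grassmann_aut n.
     \<forall>i\<in>{1..n}. \<sigma> (xgen i) \<ominus>\<^bsub>Grassmann n\<^esub> xgen i \<in> odd_part n \<inter> max_ideal_pow n 3}"

definition Phi :: "nat \<Rightarrow> ((nat set \<Rightarrow> 'k::comm_ring_1) \<Rightarrow> nat set \<Rightarrow> 'k) set" where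
  "Phi n = {\<sigma> \<in> Gamma n. \<forall>i\<in>{1..n}. \<sigma> (xgen i) \<in> genideal (Grassmann n) {xgen i}}"

definition Phi_pow :: "nat \<Rightarrow> nat \<Rightarrow> ((nat set \<Rightarrow> 'k::comm_ring_1) \<Rightarrow> nat set \<Rightarrow> 'k) set" where
  "Phi_pow n m = {\<sigma> \<in> Phi n.
     \<forall>a\<in>max_ideal n. \<sigma> a \<ominus>\<^bsub>Grassmann n\<^esub> a \<in> max_ideal_pow n m}"

definition Sigma' :: "nat \<Rightarrow> ((nat set \<Rightarrow> 'k::comm_ring_1) \<Rightarrow> nat set \<Rightarrow> 'k) set" where
  "Sigma' n = {\<sigma> \<in> Phi n. Jac n \<sigma> = \<one>\<^bsub>Grassmann n\<^esub>}"

definition Sigma'_pow :: "nat \<Rightarrow> nat \<Rightarrow> ((nat set \<Rightarrow> 'k::comm_ring_1) \<Rightarrow> nat set \<Rightarrow> 'k) set" where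
  "Sigma'_pow n m = Sigma' n \<inter> Phi_pow n m"

definition A_space :: "nat \<Rightarrow> nat \<Rightarrow> nat \<Rightarrow> (nat set \<Rightarrow> 'k::comm_ring_1) set" where
  "A_space n s i = mono_span n (\<lambda>\<alpha>. card \<alpha> = 2 * s \<and> i \<notin> \<alpha> \<and> {i+1..n} \<subseteq> \<alpha>)"

text \<open>The group \<open>\<Phi>'\<^sup>2\<^sup>s\<^sup>+\<^sup>1\<close>. The element \<open>c\<close> below is uniquely determined by \<open>\<sigma>\<close> and \<open>i\<close>.\<close>

definition Phi' :: "nat \<Rightarrow> nat \<Rightarrow> ((nat set \<Rightarrow> 'k::comm_ring_1) \<Rightarrow> nat set \<Rightarrow> 'k) set" where
  "Phi' n s = {\<sigma> \<in> Phi_pow n (2 * s + 1).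
     \<forall>i\<in>{1..n}. \<exists>c\<in>mono_span n (\<lambda>\<alpha>. even (card \<alpha>) \<and> card \<alpha> \<ge> 2 \<and> i \<notin> \<alpha>).
       \<sigma> (xgen i) = xgen i \<otimes>\<^bsub>Grassmann n\<^esub> (\<one>\<^bsub>Grassmann n\<^esub> \<oplus>\<^bsub>Grassmann n\<^esub> c) \<and>
       hom_component (2 * s) c \<in> A_space n s i}"


section \<open>Avoidance functions and the leading terms\<close>

definition S' :: "nat \<Rightarrow> nat \<Rightarrow> nat \<Rightarrow> nat set set" where
  "S' n s i = {\<alpha>. \<alpha> \<subseteq> {1..n} - {i} \<and> card \<alpha> = 2 * s \<and> \<not> {i+1..n} \<subseteq> \<alpha>}"

definition avoidance_functions :: "nat \<Rightarrow> nat \<Rightarrow> (nat \<Rightarrow> nat set \<Rightarrow> nat) \<Rightarrow> bool" where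
  "avoidance_functions n s j \<longleftrightarrow> (\<forall>i\<in>{1..n-1}. \<forall>\<alpha>\<in>S' n s i. j i \<alpha> \<in> {i+1..n} - \<alpha>)"

text \<open>\<open>rho n i j \<lambda> \<alpha>\<close> is the automorphism written \<open>\<rho>\<close> with index \<open>i, j; \<lambda>x\<^sup>\<alpha>\<close>.\<close>

definition rho ::
    "nat \<Rightarrow> nat \<Rightarrow> nat \<Rightarrow> 'k \<Rightarrow> nat set \<Rightarrow> (nat set \<Rightarrow> 'k::comm_ring_1) \<Rightarrow> nat set \<Rightarrow> 'k" where
  "rho n i j l \<alpha> = (THE \<sigma>. \<sigma> \<in> Sigma' n \<and>
     \<sigma> (xgen i) = xgen i \<otimes>\<^bsub>Grassmann n\<^esub>
       (\<one>\<^bsub>Grassmann n\<^esub> \<oplus>\<^bsub>Grassmann n\<^esub> l \<odot>\<^bsub>Grassmann n\<^esub> xmon \<alpha>) \<and>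
     \<sigma> (xgen j) = xgen j \<otimes>\<^bsub>Grassmann n\<^esub>
       (\<one>\<^bsub>Grassmann n\<^esub> \<ominus>\<^bsub>Grassmann n\<^esub> l \<odot>\<^bsub>Grassmann n\<^esub> xmon \<alpha>) \<and>
     (\<forall>k\<in>{1..n} - {i, j}. \<sigma> (xgen k) = xgen k))"

text \<open>\<open>\<sigma>(x\<^sub>i) = x\<^sub>i(1 + b\<^sub>i + \<dots>)\<close> with \<open>(b\<^sub>1, \<dots>, b\<^sub>n) \<in> V\<close>, the dots being terms of degree \<open>> 2s\<close>.\<close>

definition leading_terms ::
    "nat \<Rightarrow> nat \<Rightarrow> ((nat set \<Rightarrow> 'k::comm_ring_1) \<Rightarrow> nat set \<Rightarrow> 'k) \<Rightarrow> (nat \<Rightarrow> nat set \<Rightarrow> 'k) \<Rightarrow> bool"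
  where
  "leading_terms n s \<sigma> b \<longleftrightarrow> b \<in> (\<Pi>\<^sub>E i\<in>{1..n}. hom_avoiding n (2 * s) i) \<and>
     (\<forall>i\<in>{1..n}. \<exists>h\<in>mono_span n (\<lambda>\<alpha>. card \<alpha> > 2 * s).
       \<sigma> (xgen i) = xgen i \<otimes>\<^bsub>Grassmann n\<^esub>
         (\<one>\<^bsub>Grassmann n\<^esub> \<oplus>\<^bsub>Grassmann n\<^esub> b i \<oplus>\<^bsub>Grassmann n\<^esub> h))"

definition unit_vec :: "nat \<Rightarrow> nat \<Rightarrow> 'k::comm_ring_1" where
  "unit_vec i = (\<lambda>k. if k = i then 1 else 0)"

text \<open>The parameters \<open>(\<lambda>\<^sub>i\<^sub>,\<^sub>\<alpha>)\<close> and \<open>(a\<^sub>i)\<close>; extensional, so that uniqueness makes sense.\<close>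

definition lambda_params :: "nat \<Rightarrow> nat \<Rightarrow> (nat \<Rightarrow> nat set \<Rightarrow> 'k::comm_ring_1) set" where
  "lambda_params n s = (\<Pi>\<^sub>E i\<in>{1..n-1}. S' n s i \<rightarrow>\<^sub>E UNIV)"

definition a_params :: "nat \<Rightarrow> nat \<Rightarrow> (nat \<Rightarrow> nat set \<Rightarrow> 'k::comm_ring_1) set" where
  "a_params n s = (\<Pi>\<^sub>E i\<in>{n - 2 * s..n}. A_space n s i)"

text \<open>The equation for \<open>(b\<^sub>1, \<dots>, b\<^sub>n)\<close> in \<open>V\<close>, in each component \<open>k\<close>.\<close>

definition V_decomposition ::
    "nat \<Rightarrow> nat \<Rightarrow> (nat \<Rightarrow> nat set \<Rightarrow> nat) \<Rightarrow> (nat \<Rightarrow> nat set \<Rightarrow> 'k::comm_ring_1) \<Rightarrow>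
      (nat \<Rightarrow> nat set \<Rightarrow> 'k) \<Rightarrow> (nat \<Rightarrow> nat set \<Rightarrow> 'k) \<Rightarrow> bool" where
  "V_decomposition n s j b lam a \<longleftrightarrow>
     lam \<in> lambda_params n s \<and> a \<in> a_params n s \<and>
     (\<forall>k\<in>{1..n}. b k =
       (\<Oplus>\<^bsub>Grassmann n\<^esub>i\<in>{1..n-1}. \<Oplus>\<^bsub>Grassmann n\<^esub>\<alpha>\<in>S' n s i.
          (lam i \<alpha> * (unit_vec i k - unit_vec (j i \<alpha>) k)) \<odot>\<^bsub>Grassmann n\<^esub> xmon \<alpha>)
       \<oplus>\<^bsub>Grassmann n\<^esub>
       (\<Oplus>\<^bsub>Grassmann n\<^esub>i\<in>{n - 2 * s..n}. unit_vec i k \<odot>\<^bsub>Grassmann n\<^esub> a i))"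

text \<open>
  The congruence modulo \<open>\<Phi>\<^sup>2\<^sup>s\<^sup>+\<^sup>3\<close> is an equation in the quotient \<open>Q = \<Phi>\<^sup>2\<^sup>s\<^sup>+\<^sup>1 / \<Phi>\<^sup>2\<^sup>s\<^sup>+\<^sup>3\<close>. As the
  quotient is commutative, the unordered product over the \<open>\<alpha>\<close> is meaningful there.
\<close>

definition factorization ::
    "nat \<Rightarrow> nat \<Rightarrow> (nat \<Rightarrow> nat set \<Rightarrow> nat) \<Rightarrow> ((nat set \<Rightarrow> 'k::comm_ring_1) \<Rightarrow> nat set \<Rightarrow> 'k) \<Rightarrow>
      ((nat set \<Rightarrow> 'k) \<Rightarrow> nat set \<Rightarrow> 'k) \<Rightarrow> (nat \<Rightarrow> nat set \<Rightarrow> 'k) \<Rightarrow> (nat \<Rightarrow> nat set \<Rightarrow> 'k) \<Rightarrow> bool"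
  where
  "factorization n s j \<sigma> \<phi>' lam a \<longleftrightarrow>
     (let G = BijGroup (carrier (Grassmann n));
          N = Phi_pow n (2 * s + 3);
          Q = (G\<lparr>carrier := Phi_pow n (2 * s + 1)\<rparr>) Mod N
      in \<phi>' \<in> Phi' n s \<and> lam \<in> lambda_params n s \<and> a \<in> a_params n s \<and>
         (\<forall>k\<in>{1..<n - 2 * s}. \<phi>' (xgen k) = xgen k) \<and>
         (\<forall>i\<in>{n - 2 * s..n}.
            \<phi>' (xgen i) = xgen i \<otimes>\<^bsub>Grassmann n\<^esub> (\<one>\<^bsub>Grassmann n\<^esub> \<oplus>\<^bsub>Grassmann n\<^esub> a i)) \<and>
         N #>\<^bsub>G\<^esub> \<sigma> = (N #>\<^bsub>G\<^esub> \<phi>') \<otimes>\<^bsub>Q\<^esub>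
           (\<Otimes>\<^bsub>Q\<^esub>i\<in>{1..n-1}. \<Otimes>\<^bsub>Q\<^esub>\<alpha>\<in>S' n s i. N #>\<^bsub>G\<^esub> rho n i (j i \<alpha>) (lam i \<alpha>) \<alpha>))"

end

(*
  For sigma in Phi^{2s+1} with sigma(x_i) = x_i(1 + b_i + ...), the leading terms (b_1, ..., b_n)
  add up under composition, because sigma - 1 raises degrees by at least 2s. They therefore give
  a surjective homomorphism from Phi^{2s+1} to the additive group V with kernel Phi^{2s+3}, and
  every assertion becomes one about V. On Sigma'^{2s+1} the Jacobian is 1, and modulo degree 4s
  it is 1 + b_1 + ... + b_n, so b_1 + ... + b_n = 0. On Phi'^{2s+1} each monomial x^alpha can
  occur in b_i only for i = max of the complement of alpha. Comparing the coefficients of x^alpha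
  shows that the two images meet trivially. For fixed alpha the vectors e_i - e_{j_i(alpha)} form
  the edges of a tree on the complement of alpha, rooted at its maximum m; together with e_m they
  are a basis, and the coordinates are found recursively since j_i(alpha) > i.
  That Sigma' is a group follows from the chain rule J(sigma tau) = sigma(J(tau)) J(sigma).
*)
theory Submission
  imports Defs "HOL-Library.Function_Algebras" "Jordan_Normal_Form.Determinant"
begin

text \<open>The main obstacle is that the Jacobian is a determinant over a noncommutative ring. For
  the automorphisms considered its entries are even, hence central; the even part is therefore made
  a commutative ring type of its own, where the product formula for determinants is available. The
  second difficulty is to follow degree, parity and divisibility by x_i at once. All of them are put
  as conditions on supports: \<open>mono_span n P\<close> consists of the elements whose monomials
  satisfy \<open>P\<close>, and the conditions defining the groups amount to this: the monomials of
  \<sigma>(x_i) - x_i arise from {i} by adjoining an even number, at least e, of indices. The group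
  \<Phi>^{2s+1} is the case e = 2s. Every estimate is then a statement about index sets.
  Surjectivity onto V has no construction of its own: both summands of the tree decomposition are
  leading terms of automorphisms given on the generators.\<close>

hide_const (open) Matrix.unit_vec
hide_fact (open) Matrix.unit_vec_def

section \<open>The Grassmann algebra on coefficient functions\<close>

text \<open>The operations of \<open>Grassmann n\<close> do not depend on \<open>n\<close>, only its
  carrier does. Product and scalar multiple thus get names free of \<open>n\<close>, and the
  additive structure is the pointwise one on functions.\<close>

definition gmul :: "(nat set \<Rightarrow> 'k::comm_ring_1) \<Rightarrow> (nat set \<Rightarrow> 'k) \<Rightarrow> nat set \<Rightarrow> 'k"
    (infixl "\<star>" 70) where
  "a \<star> b = (\<lambda>\<gamma>. \<Sum>\<alpha>\<in>Pow \<gamma>. (- 1) ^ inversions \<alpha> (\<gamma> - \<alpha>) * a \<alpha> * b (\<gamma> - \<alpha>))"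

definition scal :: "'k::comm_ring_1 \<Rightarrow> (nat set \<Rightarrow> 'k) \<Rightarrow> nat set \<Rightarrow> 'k" where
  "scal c a = (\<lambda>\<gamma>. c * a \<gamma>)"

lemma scal_apply [simp]: "scal c a \<gamma> = c * a \<gamma>"
  by (simp add: scal_def)

lemma sum_fun_apply: "(\<Sum>i\<in>A. f i) x = (\<Sum>i\<in>A. f i x)"
  by (induction A rule: infinite_finite_induct) auto

text \<open>The bridge from the record operations of the definitions to \<open>gmul\<close>,
  \<open>scal\<close> and pointwise addition, in which all computations are done.\<close>

lemma Grassmann_ops:
  "a \<otimes>\<^bsub>Grassmann n\<^esub> b = a \<star> b"
  "\<one>\<^bsub>Grassmann n\<^esub> = xmon {}"
  "\<zero>\<^bsub>Grassmann n\<^esub> = 0"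
  "a \<oplus>\<^bsub>Grassmann n\<^esub> b = a + b"
  "c \<odot>\<^bsub>Grassmann n\<^esub> a = scal c a"
  by (simp_all add: Grassmann_simps gmul_def xmon_def scal_def fun_eq_iff)

lemma gmul_assoc: "(a \<star> b) \<star> c = a \<star> (b \<star> c)"
  using Grassmann_mult_assoc[of n a b c for n] by (simp add: Grassmann_ops)

lemma gmul_add_left: "(a + b) \<star> c = a \<star> c + b \<star> c"
  and gmul_add_right: "a \<star> (b + c) = a \<star> b + a \<star> c"
  and gmul_diff_left: "(a - b) \<star> c = a \<star> c - b \<star> c"
  and gmul_diff_right: "a \<star> (b - c) = a \<star> b - a \<star> c"
  by (simp_all add: gmul_def fun_eq_iff algebra_simps sum.distrib sum_subtractf)

lemma gmul_zero [simp]: "0 \<star> a = 0" "a \<star> 0 = 0"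
  by (simp_all add: gmul_def fun_eq_iff)

lemma gmul_scal_left: "scal c a \<star> b = scal c (a \<star> b)"
  and gmul_scal_right: "a \<star> scal c b = scal c (a \<star> b)"
  by (auto simp: gmul_def fun_eq_iff sum_distrib_left mult_ac intro!: sum.cong)

lemma gmul_sum_left: "sum f A \<star> b = (\<Sum>i\<in>A. f i \<star> b)"
  using sum_comp_morphism[of "\<lambda>x. x \<star> b" f A] by (simp add: gmul_add_left o_def)

lemma gmul_sum_right: "b \<star> sum f A = (\<Sum>i\<in>A. b \<star> f i)"
  using sum_comp_morphism[of "\<lambda>x. b \<star> x" f A] by (simp add: gmul_add_right o_def)

lemma scal_simps:
  "scal c (a + b) = scal c a + scal c b" "scal c (a - b) = scal c a - scal c b"
  "scal c 0 = 0" "scal c (scal d a) = scal (c * d) a" "scal 1 a = a" "scal 0 a = 0"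
  "scal (- 1) a = - a" "scal c (- a) = - scal c a"
  by (auto simp: fun_eq_iff algebra_simps)

lemma scal_sum: "scal c (sum f A) = (\<Sum>i\<in>A. scal c (f i))"
  using sum_comp_morphism[of "scal c" f A] by (simp add: scal_simps o_def)

abbreviation gcar :: "nat \<Rightarrow> (nat set \<Rightarrow> 'k::comm_ring_1) set" where
  "gcar n \<equiv> carrier (Grassmann n)"

lemma gcar_iff: "a \<in> gcar n \<longleftrightarrow> (\<forall>\<alpha>. a \<alpha> \<noteq> 0 \<longrightarrow> \<alpha> \<subseteq> {1..n})"
  by (simp add: Grassmann_simps)

lemma mono_span_iff: "a \<in> mono_span n P \<longleftrightarrow> (\<forall>\<alpha>. a \<alpha> \<noteq> 0 \<longrightarrow> \<alpha> \<subseteq> {1..n} \<and> P \<alpha>)"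
  by (auto simp: mono_span_def gcar_iff)

lemma mono_span_carrier: "a \<in> mono_span n P \<Longrightarrow> a \<in> gcar n"
  by (simp add: mono_span_def)

lemma mono_span_mono:
  "a \<in> mono_span n P \<Longrightarrow> (\<And>\<alpha>. \<alpha> \<subseteq> {1..n} \<Longrightarrow> P \<alpha> \<Longrightarrow> Q \<alpha>) \<Longrightarrow> a \<in> mono_span n Q"
  by (auto simp: mono_span_iff)

lemma gcar_eq_mono_span: "gcar n = mono_span n (\<lambda>_. True)"
  by (auto simp: mono_span_iff gcar_iff)

lemma mono_span_closed:
  "0 \<in> mono_span n P"
  "a \<in> mono_span n P \<Longrightarrow> b \<in> mono_span n P \<Longrightarrow> a + b \<in> mono_span n P"
  "a \<in> mono_span n P \<Longrightarrow> b \<in> mono_span n P \<Longrightarrow> a - b \<in> mono_span n P"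
  "a \<in> mono_span n P \<Longrightarrow> - a \<in> mono_span n P"
  "a \<in> mono_span n P \<Longrightarrow> scal c a \<in> mono_span n P"
proof -
  show "a + b \<in> mono_span n P" if "a \<in> mono_span n P" "b \<in> mono_span n P"
    unfolding mono_span_iff
  proof (intro allI impI)
    fix \<alpha> assume "(a + b) \<alpha> \<noteq> 0"
    then have "a \<alpha> \<noteq> 0 \<or> b \<alpha> \<noteq> 0" by auto
    with that show "\<alpha> \<subseteq> {1..n} \<and> P \<alpha>" unfolding mono_span_iff by blast
  qed
  show "a - b \<in> mono_span n P" if "a \<in> mono_span n P" "b \<in> mono_span n P"
    unfolding mono_span_iff
  proof (intro allI impI)
    fix \<alpha> assume "(a - b) \<alpha> \<noteq> 0"
    then have "a \<alpha> \<noteq> 0 \<or> b \<alpha> \<noteq> 0" by auto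
    with that show "\<alpha> \<subseteq> {1..n} \<and> P \<alpha>" unfolding mono_span_iff by blast
  qed
  show "scal c a \<in> mono_span n P" if "a \<in> mono_span n P"
    using that unfolding mono_span_iff by (metis scal_apply mult_zero_right)
qed (auto simp: mono_span_iff)

lemma mono_span_sum: "(\<And>i. i \<in> A \<Longrightarrow> f i \<in> mono_span n P) \<Longrightarrow> sum f A \<in> mono_span n P"
  by (induction A rule: infinite_finite_induct) (auto simp: mono_span_closed)

lemmas gcar_closed = mono_span_closed[where P = "\<lambda>_. True", folded gcar_eq_mono_span]
lemmas gcar_sum = mono_span_sum[where P = "\<lambda>_. True", folded gcar_eq_mono_span]

text \<open>A nonzero coefficient of a product at \<gamma> needs a splitting of \<gamma> into
  disjoint sets at which both factors are nonzero. Most estimates for products below are instances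
  with suitable \<open>P\<close>, \<open>Q\<close>, \<open>R\<close>.\<close>

lemma gmul_mono_span:
  assumes "a \<in> mono_span n P" "b \<in> mono_span n Q"
    and "\<And>\<alpha> \<beta>. \<alpha> \<subseteq> {1..n} \<Longrightarrow> \<beta> \<subseteq> {1..n} \<Longrightarrow> \<alpha> \<inter> \<beta> = {} \<Longrightarrow> P \<alpha> \<Longrightarrow> Q \<beta> \<Longrightarrow> R (\<alpha> \<union> \<beta>)"
  shows "a \<star> b \<in> mono_span n R"
  unfolding mono_span_iff
proof (intro allI impI)
  fix \<gamma> assume nz_sum: "(a \<star> b) \<gamma> \<noteq> 0"
  obtain \<alpha> where \<alpha>: "\<alpha> \<in> Pow \<gamma>" and nz: "(- 1) ^ inversions \<alpha> (\<gamma> - \<alpha>) * a \<alpha> * b (\<gamma> - \<alpha>) \<noteq> 0"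
    by (rule sum.not_neutral_contains_not_neutral[OF nz_sum[unfolded gmul_def]])
  from nz have "a \<alpha> \<noteq> 0" "b (\<gamma> - \<alpha>) \<noteq> 0" by auto
  then have h: "\<alpha> \<subseteq> {1..n}" "P \<alpha>" "\<gamma> - \<alpha> \<subseteq> {1..n}" "Q (\<gamma> - \<alpha>)"
    using assms(1,2) by (auto simp: mono_span_iff)
  have "R (\<alpha> \<union> (\<gamma> - \<alpha>))" by (rule assms(3)) (use h in auto)
  moreover have "\<alpha> \<union> (\<gamma> - \<alpha>) = \<gamma>" using \<alpha> by auto
  ultimately show "\<gamma> \<subseteq> {1..n} \<and> R \<gamma>" using h by auto
qed

lemma gcar_gmul: "a \<in> gcar n \<Longrightarrow> b \<in> gcar n \<Longrightarrow> a \<star> b \<in> gcar n"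
  unfolding gcar_eq_mono_span by (rule gmul_mono_span)

lemma xmon_in_mono_span: "\<alpha> \<subseteq> {1..n} \<Longrightarrow> P \<alpha> \<Longrightarrow> xmon \<alpha> \<in> mono_span n P"
  by (auto simp: mono_span_iff xmon_def)

lemma xmon_carrier: "\<alpha> \<subseteq> {1..n} \<Longrightarrow> xmon \<alpha> \<in> gcar n"
  by (auto simp: gcar_iff xmon_def)

lemma xgen_carrier: "i \<in> {1..n} \<Longrightarrow> xgen i \<in> gcar n"
  by (simp add: xgen_def xmon_carrier)

lemma gmul_one: "a \<in> gcar n \<Longrightarrow> xmon {} \<star> a = a" "a \<in> gcar n \<Longrightarrow> a \<star> xmon {} = a"
  using Grassmann_one_mult[of a n] by (simp_all add: Grassmann_ops)

lemma xmon_mult: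
  "finite \<alpha> \<Longrightarrow> finite \<beta> \<Longrightarrow> xmon \<alpha> \<star> xmon \<beta> =
     (if \<alpha> \<inter> \<beta> = {} then scal ((- 1) ^ inversions \<alpha> \<beta>) (xmon (\<alpha> \<union> \<beta>)) else 0)"
  unfolding Grassmann_mult_xmon[of \<alpha> \<beta> n for n, unfolded Grassmann_ops]
  by (simp add: fun_eq_iff) (simp add: xmon_def)

lemma xmon_insert': "finite \<alpha> \<Longrightarrow> (\<And>k. k \<in> \<alpha> \<Longrightarrow> i < k) \<Longrightarrow> xmon (insert i \<alpha>) = xgen i \<star> xmon \<alpha>"
  using xmon_insert[of \<alpha> i] by (simp add: Grassmann_ops)

lemma monomial_expansion:
  assumes "a \<in> gcar n"
  shows "a = (\<Sum>\<alpha>\<in>Pow {1..n}. scal (a \<alpha>) (xmon \<alpha>))"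
proof
  fix \<gamma>
  have "(\<Sum>\<alpha>\<in>Pow {1..n}. scal (a \<alpha>) (xmon \<alpha>)) \<gamma> =
      (\<Sum>\<alpha>\<in>Pow {1..n}. if \<alpha> = \<gamma> then a \<gamma> else 0)"
    unfolding sum_fun_apply by (rule sum.cong) (auto simp: xmon_def)
  also have "\<dots> = a \<gamma>" using assms by (auto simp: gcar_iff)
  finally show "a \<gamma> = (\<Sum>\<alpha>\<in>Pow {1..n}. scal (a \<alpha>) (xmon \<alpha>)) \<gamma>" by simp
qed

section \<open>Signs, parity and division by a generator\<close>

lemma inversions_swap:
  assumes "finite \<alpha>" "finite \<beta>" "\<alpha> \<inter> \<beta> = {}"
  shows "inversions \<alpha> \<beta> + inversions \<beta> \<alpha> = card \<alpha> * card \<beta>"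
proof -
  let ?A = "{(i, j). i \<in> \<alpha> \<and> j \<in> \<beta> \<and> j < i}" and ?B = "{(i, j). i \<in> \<beta> \<and> j \<in> \<alpha> \<and> j < i}"
  have "?B = prod.swap ` {(i, j). i \<in> \<alpha> \<and> j \<in> \<beta> \<and> i < j}" by auto
  then have B: "card ?B = card {(i, j). i \<in> \<alpha> \<and> j \<in> \<beta> \<and> i < j}"
    by (simp add: card_image)
  \<comment> \<open>Each pair of disjoint \<alpha> and \<beta> is out of order in exactly one of the
    two arrangements.\<close>
  have "\<alpha> \<times> \<beta> = ?A \<union> {(i, j). i \<in> \<alpha> \<and> j \<in> \<beta> \<and> i < j}"
    using assms(3) by (auto; metis disjoint_iff nat_neq_iff)
  then have "card (\<alpha> \<times> \<beta>) = card (?A \<union> {(i, j). i \<in> \<alpha> \<and> j \<in> \<beta> \<and> i < j})" by simp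
  also have "\<dots> = card ?A + card {(i, j). i \<in> \<alpha> \<and> j \<in> \<beta> \<and> i < j}"
    by (rule card_Un_disjoint)
      (use assms in \<open>auto intro: finite_subset[of _ "\<alpha> \<times> \<beta>"]\<close>)
  finally show ?thesis using B by (simp add: inversions_def card_cartesian_product)
qed

text \<open>By \<open>inversions_swap\<close> exchanging x^\<alpha> and x^\<beta> costs the sign
  with exponent card \<alpha> * card \<beta>, which is even wherever \<open>a\<close> has a nonzero
  coefficient.\<close>

lemma even_central:
  assumes "\<And>\<alpha>. a \<alpha> \<noteq> 0 \<Longrightarrow> even (card \<alpha>)"
  shows "a \<star> b = b \<star> a"
proof
  fix \<gamma>
  show "(a \<star> b) \<gamma> = (b \<star> a) \<gamma>"
  proof (cases "finite \<gamma>")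
    case True
    have "(- 1 :: 'a) ^ inversions \<alpha> (\<gamma> - \<alpha>) * a \<alpha> * b (\<gamma> - \<alpha>) =
        (- 1) ^ inversions (\<gamma> - \<alpha>) \<alpha> * b (\<gamma> - \<alpha>) * a \<alpha>" if "\<alpha> \<subseteq> \<gamma>" for \<alpha>
    proof (cases "a \<alpha> = 0")
      case False
      have "inversions \<alpha> (\<gamma> - \<alpha>) + inversions (\<gamma> - \<alpha>) \<alpha> = card \<alpha> * card (\<gamma> - \<alpha>)"
        by (rule inversions_swap) (use that True in \<open>auto intro: finite_subset\<close>)
      then have "even (inversions \<alpha> (\<gamma> - \<alpha>) + inversions (\<gamma> - \<alpha>) \<alpha>)"
        using assms[OF False] by simp
      then have "(- 1 :: 'a) ^ inversions \<alpha> (\<gamma> - \<alpha>) = (- 1) ^ inversions (\<gamma> - \<alpha>) \<alpha>"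
        by (simp add: minus_one_power_iff)
      then show ?thesis by (simp add: mult_ac)
    qed simp
    then show ?thesis unfolding gmul_def
      by (intro sum.reindex_bij_witness[of _ "\<lambda>\<alpha>. \<gamma> - \<alpha>" "\<lambda>\<alpha>. \<gamma> - \<alpha>"])
        (auto simp: double_diff)
  qed (simp add: gmul_def)
qed

lemma xgen_mult_apply:
  "(xgen i \<star> b) \<gamma> = (if i \<in> \<gamma> \<and> finite \<gamma> then (- 1) ^ card {k \<in> \<gamma>. k < i} * b (\<gamma> - {i}) else 0)"
proof (cases "finite \<gamma>")
  case True
  have "(xgen i \<star> b) \<gamma> = (\<Sum>\<alpha>\<in>Pow \<gamma>. if \<alpha> = {i} then (- 1) ^ inversions {i} (\<gamma> - {i}) * b (\<gamma> - {i}) else 0)"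
    unfolding gmul_def by (rule sum.cong) (auto simp: xgen_def xmon_def)
  also have "\<dots> = (if i \<in> \<gamma> then (- 1) ^ inversions {i} (\<gamma> - {i}) * b (\<gamma> - {i}) else 0)"
    using True by simp
  moreover have "{k \<in> \<gamma> - {i}. k < i} = {k \<in> \<gamma>. k < i}" by auto
  ultimately show ?thesis using True by (simp add: inversions_singleton_left)
qed (simp add: gmul_def)

text \<open>The same sign occurs in the product by x_i and in the derivation, and its square is 1.
  With \<open>xgen_mult_skew_deriv\<close> this makes the skew derivation the division by x_i on the
  left, which recovers 1 + c_i from x_i (1 + c_i).\<close>

lemma skew_deriv_xgen_mult:
  assumes "b \<in> mono_span n (\<lambda>\<alpha>. i \<notin> \<alpha>)"
  shows "skew_deriv i (xgen i \<star> b) = b"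
proof
  fix \<beta>
  have *: "{k. (k = i \<or> k \<in> \<beta>) \<and> k < i} = {k \<in> \<beta>. k < i}" by auto
  have "b \<beta> = 0" if "i \<in> \<beta> \<or> infinite \<beta>"
    using assms that finite_subset[of \<beta> "{1..n}"] by (auto simp: mono_span_iff)
  then show "skew_deriv i (xgen i \<star> b) \<beta> = b \<beta>"
    by (auto simp: skew_deriv_def xgen_mult_apply * simp flip: power_add mult.assoc mult_2)
qed

lemma xgen_mult_skew_deriv:
  assumes "a \<in> mono_span n (\<lambda>\<alpha>. i \<in> \<alpha>)"
  shows "xgen i \<star> skew_deriv i a = a"
proof
  fix \<gamma>
  have "{k \<in> \<gamma> - {i}. k < i} = {k \<in> \<gamma>. k < i}" by auto
  moreover have "insert i (\<gamma> - {i}) = \<gamma>" if "i \<in> \<gamma>" using that by auto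
  moreover have "a \<gamma> = 0" if "i \<notin> \<gamma> \<or> infinite \<gamma>"
    using assms that finite_subset[of \<gamma> "{1..n}"] by (auto simp: mono_span_iff)
  ultimately show "(xgen i \<star> skew_deriv i a) \<gamma> = a \<gamma>"
    by (auto simp: skew_deriv_def xgen_mult_apply simp flip: power_add mult.assoc mult_2)
qed

lemma Grassmann_minus:
  fixes a b :: "nat set \<Rightarrow> 'k::comm_ring_1"
  assumes "a \<in> gcar n" "b \<in> gcar n"
  shows "a \<ominus>\<^bsub>Grassmann n\<^esub> b = a - b"
proof -
  interpret ring "Grassmann n :: ('k, nat set \<Rightarrow> 'k) module" by (rule ring_Grassmann)
  have "\<ominus>\<^bsub>Grassmann n\<^esub> b = - b"
    by (rule minus_equality) (use assms in \<open>auto simp: Grassmann_ops gcar_closed\<close>)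
  then show ?thesis by (simp add: a_minus_def Grassmann_ops)
qed

lemma finsum_Grassmann:
  fixes f :: "'i \<Rightarrow> nat set \<Rightarrow> 'k::comm_ring_1"
  assumes "\<And>i. i \<in> A \<Longrightarrow> f i \<in> gcar n"
  shows "(\<Oplus>\<^bsub>Grassmann n\<^esub>i\<in>A. f i) = (\<Sum>i\<in>A. f i)"
proof -
  interpret ring "Grassmann n :: ('k, nat set \<Rightarrow> 'k) module" by (rule ring_Grassmann)
  show ?thesis using assms
  proof (induction A rule: infinite_finite_induct)
    case (insert x F)
    then show ?case by (simp add: Grassmann_ops)
  qed (simp_all add: Grassmann_ops)
qed

lemmas fun_apply = plus_fun_apply zero_fun_apply minus_apply uminus_apply

text \<open>Induction eta-expands function-valued terms, which these simp rules would then unfold.\<close>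

declare fun_apply [simp del]

section \<open>Ideals and endomorphisms\<close>

lemma finite_index_set: "\<alpha> \<subseteq> {1..n::nat} \<Longrightarrow> finite \<alpha>"
  by (erule finite_subset) simp

lemma sum_in_additive:
  assumes "0 \<in> S" "\<And>a b. a \<in> S \<Longrightarrow> b \<in> S \<Longrightarrow> a + b \<in> S" "\<And>i. i \<in> A \<Longrightarrow> f i \<in> S"
  shows "sum f A \<in> S"
  using assms(3) by (induction A rule: infinite_finite_induct) (simp_all add: assms(1,2))

text \<open>Degrees add in products, which gives one inclusion. For the other, a monomial of degree
  at least m + 1 splits off one generator, and the ideal product is closed under sums.\<close>

lemma max_ideal_pow_eq: "max_ideal_pow n m = mono_span n (\<lambda>\<alpha>. m \<le> card \<alpha>)"
proof (induction m)
  case 0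
  then show ?case by (simp add: gcar_eq_mono_span)
next
  case (Suc m)
  let ?I = "ideal_prod (Grassmann n) (max_ideal n) (max_ideal_pow n m) :: (nat set \<Rightarrow> 'a) set"
  have "a \<in> mono_span n (\<lambda>\<alpha>. Suc m \<le> card \<alpha>)" if "a \<in> ?I" for a
    using that
  proof induction
    case (prod i j)
    then have "i \<star> j \<in> mono_span n (\<lambda>\<alpha>. Suc m \<le> card \<alpha>)"
      unfolding Suc max_ideal_def
    proof (rule gmul_mono_span)
      fix \<alpha> \<beta> :: "nat set"
      assume "\<alpha> \<subseteq> {1..n}" "\<beta> \<subseteq> {1..n}" "\<alpha> \<inter> \<beta> = {}" "1 \<le> card \<alpha>" "m \<le> card \<beta>"
      then show "Suc m \<le> card (\<alpha> \<union> \<beta>)"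
        by (subst card_Un_disjoint) (simp_all add: finite_index_set)
    qed
    then show ?case by (simp add: Grassmann_ops)
  next
    case (sum a b)
    then show ?case by (simp add: Grassmann_ops mono_span_closed)
  qed
  moreover have "a \<in> ?I" if a: "a \<in> mono_span n (\<lambda>\<alpha>. Suc m \<le> card \<alpha>)" for a
  proof -
    have gmul_I: "u \<star> v \<in> ?I" if "u \<in> max_ideal n" "v \<in> max_ideal_pow n m" for u v
      using ideal_prod.prod[OF that, of "Grassmann n"] by (simp add: Grassmann_ops)
    have add_I: "u + v \<in> ?I" if "u \<in> ?I" "v \<in> ?I" for u v
      using ideal_prod.sum[OF that] by (simp add: Grassmann_ops)
    have zero_I: "0 \<in> ?I"
      using gmul_I[of 0 0] by (simp add: Suc max_ideal_def mono_span_closed)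
    have "scal (a \<alpha>) (xmon \<alpha>) \<in> ?I" if "\<alpha> \<subseteq> {1..n}" for \<alpha>
    proof (cases "a \<alpha> = 0")
      case False
      then have c: "Suc m \<le> card \<alpha>" using a by (auto simp: mono_span_iff)
      have fin: "finite \<alpha>" using that by (rule finite_subset) simp
      \<comment> \<open>Splitting off the least index produces no sign.\<close>
      define i where "i = Min \<alpha>"
      have "\<alpha> \<noteq> {}" using c by auto
      have lt: "i < k" if "k \<in> \<alpha> - {i}" for k
        using Min_le[OF fin, of k] that by (simp add: i_def order.strict_iff_order)
      have "xmon \<alpha> = (xmon (insert i (\<alpha> - {i})) :: nat set \<Rightarrow> 'a)"
        using fin \<open>\<alpha> \<noteq> {}\<close> by (simp add: i_def insert_absorb)
      also have "\<dots> = xgen i \<star> xmon (\<alpha> - {i})"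
        by (rule xmon_insert') (use fin lt in auto)
      finally have "scal (a \<alpha>) (xmon \<alpha>) = scal (a \<alpha>) (xgen i) \<star> xmon (\<alpha> - {i})"
        by (simp add: gmul_scal_left)
      moreover have "i \<in> \<alpha>" using fin \<open>\<alpha> \<noteq> {}\<close> by (simp add: i_def)
      then have "scal (a \<alpha>) (xgen i) \<in> max_ideal n"
        using that unfolding max_ideal_def xgen_def
        by (intro mono_span_closed xmon_in_mono_span) auto
      moreover have "(xmon (\<alpha> - {i}) :: nat set \<Rightarrow> 'a) \<in> max_ideal_pow n m"
        unfolding Suc using that c \<open>i \<in> \<alpha>\<close> fin by (intro xmon_in_mono_span) auto
      ultimately show ?thesis by (simp add: gmul_I)
    qed (simp add: scal_simps zero_I)
    then have "(\<Sum>\<alpha>\<in>Pow {1..n}. scal (a \<alpha>) (xmon \<alpha>)) \<in> ?I"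
      by (intro sum_in_additive zero_I add_I) auto
    then show ?thesis
      using monomial_expansion[OF mono_span_carrier[OF a]] by simp
  qed
  ultimately show ?case unfolding max_ideal_pow.simps by blast
qed

text \<open>The monomials containing i span a two-sided ideal through x_i; conversely each of its
  elements is x_i times its own skew derivative.\<close>

lemma genideal_xgen_eq:
  assumes "i \<in> {1..n}"
  shows "genideal (Grassmann n) {xgen i} = (mono_span n (\<lambda>\<alpha>. i \<in> \<alpha>) :: (nat set \<Rightarrow> 'k::comm_ring_1) set)"
    (is "?I = ?M")
proof -
  interpret ring "Grassmann n :: ('k, nat set \<Rightarrow> 'k) module" by (rule ring_Grassmann)
  have idl: "ideal (?M) (Grassmann n)"
  proof (rule idealI)
    show "subgroup ?M (add_monoid (Grassmann n :: ('k, nat set \<Rightarrow> 'k) module))"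
    proof
      fix a :: "nat set \<Rightarrow> 'k"
      assume a: "a \<in> ?M"
      have "\<ominus>\<^bsub>Grassmann n\<^esub> a = - a"
        by (rule minus_equality)
          (use mono_span_carrier[OF a] in \<open>auto simp: Grassmann_ops gcar_closed\<close>)
      then have "inv\<^bsub>add_monoid (Grassmann n)\<^esub> a = - a" by (simp add: a_inv_def)
      then show "inv\<^bsub>add_monoid (Grassmann n)\<^esub> a \<in> ?M"
        using a by (simp add: mono_span_closed)
    qed (auto simp: Grassmann_ops mono_span_closed mono_span_carrier)
  next
    fix a x :: "nat set \<Rightarrow> 'k"
    assume "a \<in> ?M" "x \<in> gcar n"
    then show "x \<otimes>\<^bsub>Grassmann n\<^esub> a \<in> ?M" "a \<otimes>\<^bsub>Grassmann n\<^esub> x \<in> ?M"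
      unfolding Grassmann_ops gcar_eq_mono_span by (auto elim!: gmul_mono_span)
  qed (rule ring_Grassmann)
  have "xgen i \<in> (?M)"
    unfolding xgen_def using assms by (intro xmon_in_mono_span) auto
  then have "?I \<subseteq> (?M)"
    by (intro genideal_minimal[OF idl]) auto
  moreover have "a \<in> ?I" if a: "a \<in> ?M" for a :: "nat set \<Rightarrow> 'k"
  proof -
    interpret I: ideal ?I "Grassmann n :: ('k, nat set \<Rightarrow> 'k) module"
      by (rule genideal_ideal) (use xgen_carrier[OF assms] in auto)
    have "xgen i \<in> ?I" by (rule genideal_self') (rule xgen_carrier[OF assms])
    moreover have "skew_deriv i a \<in> gcar n"
      by (rule skew_deriv_closed) (rule mono_span_carrier[OF a])
    ultimately have "xgen i \<otimes>\<^bsub>Grassmann n\<^esub> skew_deriv i a \<in> ?I" by (rule I.I_r_closed)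
    then show ?thesis using xgen_mult_skew_deriv[OF a] by (simp add: Grassmann_ops)
  qed
  ultimately show ?thesis by blast
qed

text \<open>The laws are asked on the carrier only and without bijectivity, so that a map
  constructed from the images of the generators fits before it is known to be invertible.\<close>

locale alg_endo =
  fixes n :: nat and \<sigma> :: "(nat set \<Rightarrow> 'k::comm_ring_1) \<Rightarrow> nat set \<Rightarrow> 'k"
  assumes closed: "a \<in> gcar n \<Longrightarrow> \<sigma> a \<in> gcar n"
    and add: "a \<in> gcar n \<Longrightarrow> b \<in> gcar n \<Longrightarrow> \<sigma> (a + b) = \<sigma> a + \<sigma> b"
    and scal: "a \<in> gcar n \<Longrightarrow> \<sigma> (scal c a) = scal c (\<sigma> a)"
    and mult: "a \<in> gcar n \<Longrightarrow> b \<in> gcar n \<Longrightarrow> \<sigma> (a \<star> b) = \<sigma> a \<star> \<sigma> b"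
    and one: "\<sigma> (xmon {}) = xmon {}"
begin

lemma zero: "\<sigma> 0 = 0"
  using scal[of 0 0] by (simp add: gcar_closed scal_simps)

lemma minus: "a \<in> gcar n \<Longrightarrow> \<sigma> (- a) = - \<sigma> a"
  using scal[of a "- 1"] by (simp add: scal_simps)

lemma diff: "a \<in> gcar n \<Longrightarrow> b \<in> gcar n \<Longrightarrow> \<sigma> (a - b) = \<sigma> a - \<sigma> b"
  using add[of a "- b"] by (simp add: minus gcar_closed)

lemma sum: "(\<And>i. i \<in> A \<Longrightarrow> f i \<in> gcar n) \<Longrightarrow> \<sigma> (sum f A) = (\<Sum>i\<in>A. \<sigma> (f i))"
proof (induction A rule: infinite_finite_induct)
  case (insert x F)
  then have "\<sigma> (f x + sum f F) = \<sigma> (f x) + \<sigma> (sum f F)"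
    by (intro add gcar_sum) auto
  with insert show ?case by simp
qed (simp_all add: zero)

lemma expansion: "a \<in> gcar n \<Longrightarrow> \<sigma> a = (\<Sum>\<alpha>\<in>Pow {1..n}. scal (a \<alpha>) (\<sigma> (xmon \<alpha>)))"
proof -
  assume a: "a \<in> gcar n"
  have "\<sigma> a = \<sigma> (\<Sum>\<alpha>\<in>Pow {1..n}. scal (a \<alpha>) (xmon \<alpha>))"
    using monomial_expansion[OF a] by simp
  also have "\<dots> = (\<Sum>\<alpha>\<in>Pow {1..n}. scal (a \<alpha>) (\<sigma> (xmon \<alpha>)))"
    by (subst sum) (auto simp: scal xmon_carrier gcar_closed intro!: sum.cong)
  finally show ?thesis .
qed

end

text \<open>Monomials are products of generators. The induction adjoins an index below all earlier
  ones, so that \<open>xmon_insert'\<close> applies and no sign appears.\<close>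

lemma alg_endo_eqI:
  assumes "alg_endo n \<sigma>" "alg_endo n \<tau>" "\<And>i. i \<in> {1..n} \<Longrightarrow> \<sigma> (xgen i) = \<tau> (xgen i)"
    and a: "a \<in> gcar n"
  shows "\<sigma> a = \<tau> a"
proof -
  interpret s: alg_endo n \<sigma> by fact
  interpret t: alg_endo n \<tau> by fact
  have "\<sigma> (xmon \<alpha>) = \<tau> (xmon \<alpha>)" if "finite \<alpha>" "\<alpha> \<subseteq> {1..n}" for \<alpha>
    using that
  proof (induction \<alpha> rule: finite_linorder_min_induct)
    case empty
    then show ?case by (simp add: s.one t.one)
  next
    case (insert i \<beta>)
    then show ?case
      by (simp add: xmon_insert' s.mult t.mult xgen_carrier xmon_carrier assms(3))
  qed
  then show ?thesis
    unfolding s.expansion[OF a] t.expansion[OF a]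
    by (intro sum.cong refl) (metis PowD finite_atLeastAtMost finite_subset)
qed

section \<open>The automorphism group inside the bijections of the carrier\<close>

lemma Grassmann_aut_iff: "\<sigma> \<in> Grassmann_aut n \<longleftrightarrow> \<sigma> \<in> Bij (gcar n) \<and> alg_endo n \<sigma>"
  by (auto simp: Grassmann_aut_def alg_endo_def Ring.ring_hom_def Grassmann_ops)

lemma Bij_mult_apply:
  "\<sigma> \<in> Bij S \<Longrightarrow> \<tau> \<in> Bij S \<Longrightarrow> a \<in> S \<Longrightarrow> (\<sigma> \<otimes>\<^bsub>BijGroup S\<^esub> \<tau>) a = \<sigma> (\<tau> a)"
  by (simp add: BijGroup_def compose_def)

lemma Bij_inv_apply:
  assumes "\<sigma> \<in> Bij S" "a \<in> S"
  shows "(inv\<^bsub>BijGroup S\<^esub> \<sigma>) a \<in> S" "\<sigma> ((inv\<^bsub>BijGroup S\<^esub> \<sigma>) a) = a" "(inv\<^bsub>BijGroup S\<^esub> \<sigma>) (\<sigma> a) = a"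
proof -
  have b: "bij_betw \<sigma> S S" and "\<sigma> a \<in> S"
    using assms Bij_imp_funcset by (auto simp: Bij_def)
  then show "(inv\<^bsub>BijGroup S\<^esub> \<sigma>) a \<in> S" "\<sigma> ((inv\<^bsub>BijGroup S\<^esub> \<sigma>) a) = a"
    "(inv\<^bsub>BijGroup S\<^esub> \<sigma>) (\<sigma> a) = a"
    using assms by
      (auto simp: inv_BijGroup Bij_inv_into_mem bij_betw_inv_into_right bij_betw_inv_into_left)
qed

lemma Bij_eqI: "\<sigma> \<in> Bij S \<Longrightarrow> \<tau> \<in> Bij S \<Longrightarrow> (\<And>a. a \<in> S \<Longrightarrow> \<sigma> a = \<tau> a) \<Longrightarrow> \<sigma> = \<tau>"
  by (rule extensionalityI[of _ S]) (auto simp: Bij_imp_extensional)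

lemma Grassmann_aut_eqI:
  assumes "\<sigma> \<in> Grassmann_aut n" "\<tau> \<in> Grassmann_aut n"
    and "\<And>i. i \<in> {1..n} \<Longrightarrow> \<sigma> (xgen i) = \<tau> (xgen i)"
  shows "\<sigma> = \<tau>"
proof (rule Bij_eqI)
  fix a :: "nat set \<Rightarrow> 'a" assume "a \<in> gcar n"
  with _ _ assms(3) show "\<sigma> a = \<tau> a"
    by (rule alg_endo_eqI) (use assms(1,2) in \<open>auto simp: Grassmann_aut_iff\<close>)
qed (use assms(1,2) in \<open>auto simp: Grassmann_aut_iff\<close>)

lemma subgroup_Grassmann_aut: "subgroup (Grassmann_aut n) (BijGroup (gcar n))"
proof -
  interpret group "BijGroup (gcar n)" by (rule group_BijGroup)
  have carr: "carrier (BijGroup (gcar n)) = Bij (gcar n)" by (simp add: BijGroup_def)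
  show ?thesis
  proof
    show "Grassmann_aut n \<subseteq> carrier (BijGroup (gcar n))"
      by (auto simp: carr Grassmann_aut_iff)
    show "\<one>\<^bsub>BijGroup (gcar n)\<^esub> \<in> Grassmann_aut n"
      using one_closed unfolding carr
      by (auto simp: Grassmann_aut_iff BijGroup_def alg_endo_def gcar_closed gcar_gmul xmon_carrier)
  next
    fix \<sigma> \<tau> :: "(nat set \<Rightarrow> 'a) \<Rightarrow> nat set \<Rightarrow> 'a"
    assume st: "\<sigma> \<in> Grassmann_aut n" "\<tau> \<in> Grassmann_aut n"
    then have b: "\<sigma> \<in> Bij (gcar n)" "\<tau> \<in> Bij (gcar n)" by (auto simp: Grassmann_aut_iff)
    interpret s: alg_endo n \<sigma> using st by (simp add: Grassmann_aut_iff)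
    interpret t: alg_endo n \<tau> using st by (simp add: Grassmann_aut_iff)
    note ap = Bij_mult_apply[OF b]
    have "alg_endo n (\<sigma> \<otimes>\<^bsub>BijGroup (gcar n)\<^esub> \<tau>)"
      by standard (simp_all add: ap gcar_closed gcar_gmul xmon_carrier s.closed t.closed
          s.add t.add s.scal t.scal s.mult t.mult s.one t.one)
    then show "\<sigma> \<otimes>\<^bsub>BijGroup (gcar n)\<^esub> \<tau> \<in> Grassmann_aut n"
      using b m_closed[of \<sigma> \<tau>] by (simp add: Grassmann_aut_iff carr)
  next
    fix \<sigma> :: "(nat set \<Rightarrow> 'a) \<Rightarrow> nat set \<Rightarrow> 'a"
    assume s: "\<sigma> \<in> Grassmann_aut n"
    then have b: "\<sigma> \<in> Bij (gcar n)" by (auto simp: Grassmann_aut_iff)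
    interpret s: alg_endo n \<sigma> using s by (simp add: Grassmann_aut_iff)
    let ?i = "inv\<^bsub>BijGroup (gcar n)\<^esub> \<sigma>"
    note iv = Bij_inv_apply[OF b]
    have eqI: "?i c = d" if "\<sigma> d = c" "d \<in> gcar n" for c d
      using iv(3)[OF that(2)] that(1) by simp
    have "alg_endo n ?i"
    proof
      fix a b :: "nat set \<Rightarrow> 'a" and c :: 'a
      assume a: "a \<in> gcar n"
      then show "?i a \<in> gcar n" by (rule iv)
      show "?i (scal c a) = scal c (?i a)"
        by (rule eqI) (use a iv in \<open>auto simp: gcar_closed s.scal\<close>)
      assume b: "b \<in> gcar n"
      show "?i (a + b) = ?i a + ?i b" "?i (a \<star> b) = ?i a \<star> ?i b"
        by (rule eqI; use a b iv in \<open>simp add: gcar_closed gcar_gmul s.add s.mult\<close>)+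
    next
      show "?i (xmon {}) = xmon {}" by (rule eqI) (auto simp: s.one xmon_carrier)
    qed
    then show "?i \<in> Grassmann_aut n"
      using b inv_closed[of \<sigma>] by (simp add: Grassmann_aut_iff carr)
  qed
qed

text \<open>For \<alpha> = {i} this single predicate carries the three conditions on the monomials
  of \<sigma>(x_i) - x_i: they contain i, their degree is odd, and it is at least e + 1. General
  \<alpha> is needed to propagate the condition to all monomials.\<close>

definition even_ext :: "nat \<Rightarrow> nat set \<Rightarrow> nat set \<Rightarrow> bool" where
  "even_ext e \<alpha> \<gamma> \<longleftrightarrow> \<alpha> \<subseteq> \<gamma> \<and> even (card (\<gamma> - \<alpha>)) \<and> e \<le> card (\<gamma> - \<alpha>)"

lemma even_ext_refl: "even_ext 0 \<alpha> \<alpha>"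
  by (simp add: even_ext_def)

lemma even_ext_weaken: "even_ext e \<alpha> \<gamma> \<Longrightarrow> e' \<le> e \<Longrightarrow> even_ext e' \<alpha> \<gamma>"
  by (simp add: even_ext_def)

lemma even_ext_card: "even_ext e \<alpha> \<gamma> \<Longrightarrow> finite \<gamma> \<Longrightarrow> card \<gamma> = card \<alpha> + card (\<gamma> - \<alpha>)"
  unfolding even_ext_def by (metis card_Diff_subset card_mono finite_subset le_add_diff_inverse)

lemma even_ext_card_le: "even_ext e \<alpha> \<gamma> \<Longrightarrow> finite \<gamma> \<Longrightarrow> card \<alpha> + e \<le> card \<gamma>"
  using even_ext_card[of e \<alpha> \<gamma>] unfolding even_ext_def by linarith

lemma even_ext_Un:
  assumes "even_ext e \<alpha> \<gamma>" "even_ext f \<beta> \<delta>" "finite \<gamma>" "finite \<delta>" "\<gamma> \<inter> \<delta> = {}"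
  shows "even_ext (e + f) (\<alpha> \<union> \<beta>) (\<gamma> \<union> \<delta>)"
proof -
  have "(\<gamma> \<union> \<delta>) - (\<alpha> \<union> \<beta>) = (\<gamma> - \<alpha>) \<union> (\<delta> - \<beta>)"
    using assms by (auto simp: even_ext_def)
  moreover have "card ((\<gamma> - \<alpha>) \<union> (\<delta> - \<beta>)) = card (\<gamma> - \<alpha>) + card (\<delta> - \<beta>)"
    by (rule card_Un_disjoint) (use assms in auto)
  ultimately show ?thesis using assms by (auto simp: even_ext_def)
qed

lemma even_ext_trans:
  assumes "even_ext e \<alpha> \<beta>" "even_ext f \<beta> \<gamma>" "finite \<gamma>"
  shows "even_ext (e + f) \<alpha> \<gamma>"
proof -
  have "\<gamma> - \<alpha> = (\<beta> - \<alpha>) \<union> (\<gamma> - \<beta>)" using assms by (auto simp: even_ext_def)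
  moreover have "card ((\<beta> - \<alpha>) \<union> (\<gamma> - \<beta>)) = card (\<beta> - \<alpha>) + card (\<gamma> - \<beta>)"
    by (rule card_Un_disjoint) (use assms finite_subset[of \<beta> \<gamma>] in \<open>auto simp: even_ext_def\<close>)
  ultimately show ?thesis using assms by (auto simp: even_ext_def)
qed

lemma gmul_even_ext:
  assumes "a \<in> mono_span n (even_ext e \<alpha>)" "b \<in> mono_span n (even_ext f \<beta>)"
  shows "a \<star> b \<in> mono_span n (even_ext (e + f) (\<alpha> \<union> \<beta>))"
proof (rule gmul_mono_span[OF assms])
  fix \<gamma> \<delta> :: "nat set"
  assume "\<gamma> \<subseteq> {1..n}" "\<delta> \<subseteq> {1..n}" "\<gamma> \<inter> \<delta> = {}" "even_ext e \<alpha> \<gamma>" "even_ext f \<beta> \<delta>"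
  then show "even_ext (e + f) (\<alpha> \<union> \<beta>) (\<gamma> \<union> \<delta>)"
    using even_ext_Un finite_subset[OF _ finite_atLeastAtMost] by blast
qed

section \<open>Unipotent endomorphisms\<close>

text \<open>The condition on generators extends to all monomials in \<open>xmon_level\<close>; in
  particular \<sigma> - 1 raises degrees by at least e and never changes parity.\<close>

locale unip_endo = alg_endo n \<sigma>
  for n :: nat and \<sigma> :: "(nat set \<Rightarrow> 'k::comm_ring_1) \<Rightarrow> nat set \<Rightarrow> 'k" +
  fixes e :: nat
  assumes level: "i \<in> {1..n} \<Longrightarrow> \<sigma> (xgen i) - xgen i \<in> mono_span n (even_ext e {i})"
begin

text \<open>The reason is \<sigma>(x y) - x y = (\<sigma>(x) - x) \<sigma>(y) + x (\<sigma>(y) - y)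
  with x a generator: each summand has one factor of level e and one of level 0.\<close>

lemma xmon_level:
  assumes "\<alpha> \<subseteq> {1..n}"
  shows "\<sigma> (xmon \<alpha>) - xmon \<alpha> \<in> mono_span n (even_ext e \<alpha>)"
proof -
  have "finite \<alpha>" using assms by (rule finite_subset) simp
  then show ?thesis using assms
  proof (induction \<alpha> rule: finite_linorder_min_induct)
    case empty
    then show ?case by (simp add: one mono_span_closed)
  next
    case (insert i \<beta>)
    have i: "i \<in> {1..n}" and \<beta>: "\<beta> \<subseteq> {1..n}" using insert by auto
    have x0: "xmon \<beta> \<in> mono_span n (even_ext 0 \<beta>)" "xgen i \<in> mono_span n (even_ext 0 {i})"
      unfolding xgen_def using i \<beta> by (auto intro!: xmon_in_mono_span simp: even_ext_refl)
    have "\<sigma> (xmon \<beta>) - xmon \<beta> \<in> mono_span n (even_ext e \<beta>)"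
      by (rule insert.IH) (rule \<beta>)
    note IH = this
    have "(\<sigma> (xmon \<beta>) - xmon \<beta>) + xmon \<beta> \<in> mono_span n (even_ext 0 \<beta>)"
      by (intro mono_span_closed(2) x0 mono_span_mono[OF IH]) (auto intro: even_ext_weaken)
    then have "(\<sigma> (xgen i) - xgen i) \<star> \<sigma> (xmon \<beta>) + xgen i \<star> (\<sigma> (xmon \<beta>) - xmon \<beta>)
        \<in> mono_span n (even_ext e ({i} \<union> \<beta>))"
      using gmul_even_ext[OF level[OF i], of "\<sigma> (xmon \<beta>)" 0 \<beta>] gmul_even_ext[OF x0(2) IH]
      by (intro mono_span_closed(2)) auto
    moreover have "\<sigma> (xmon (insert i \<beta>)) - xmon (insert i \<beta>) =
        (\<sigma> (xgen i) - xgen i) \<star> \<sigma> (xmon \<beta>) + xgen i \<star> (\<sigma> (xmon \<beta>) - xmon \<beta>)"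
      using insert i \<beta>
      by (simp add: xmon_insert' mult xgen_carrier xmon_carrier gmul_diff_left gmul_diff_right)
    ultimately show ?case by simp
  qed
qed

text \<open>By linearity it suffices to follow single monomials. An estimate for \<sigma> - 1 is
  obtained by choosing \<open>P\<close> and \<open>Q\<close> and checking a statement about
  sets.\<close>

lemma diff_in_mono_span:
  assumes a: "a \<in> mono_span n P"
    and "\<And>\<alpha> \<gamma>. \<alpha> \<subseteq> {1..n} \<Longrightarrow> \<gamma> \<subseteq> {1..n} \<Longrightarrow> P \<alpha> \<Longrightarrow> even_ext e \<alpha> \<gamma> \<Longrightarrow> Q \<gamma>"
  shows "\<sigma> a - a \<in> mono_span n Q"
proof -
  have c: "a \<in> gcar n" using a by (rule mono_span_carrier)
  have "\<sigma> a - a = (\<Sum>\<alpha>\<in>Pow {1..n}. scal (a \<alpha>) (\<sigma> (xmon \<alpha>))) - (\<Sum>\<alpha>\<in>Pow {1..n}. scal (a \<alpha>) (xmon \<alpha>))"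
    using expansion[OF c] monomial_expansion[OF c] by simp
  also have "\<dots> = (\<Sum>\<alpha>\<in>Pow {1..n}. scal (a \<alpha>) (\<sigma> (xmon \<alpha>) - xmon \<alpha>))"
    by (simp add: scal_simps sum_subtractf)
  also have "\<dots> \<in> mono_span n Q"
  proof (rule mono_span_sum)
    fix \<alpha> assume "\<alpha> \<in> Pow {1..n}"
    then have \<alpha>: "\<alpha> \<subseteq> {1..n}" by simp
    show "scal (a \<alpha>) (\<sigma> (xmon \<alpha>) - xmon \<alpha>) \<in> mono_span n Q"
    proof (cases "a \<alpha> = 0")
      case False
      then have "P \<alpha>" using a by (simp add: mono_span_iff)
      then show ?thesis
        by (intro mono_span_closed(5) mono_span_mono[OF xmon_level[OF \<alpha>]]) (rule assms(2)[OF \<alpha>])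
    qed (simp add: scal_simps mono_span_closed)
  qed
  finally show ?thesis .
qed

end

lemma unip_endo_weaken: "unip_endo n \<sigma> e \<Longrightarrow> e' \<le> e \<Longrightarrow> unip_endo n \<sigma> e'"
  unfolding unip_endo_def unip_endo_axioms_def
  by (metis even_ext_weaken mono_span_mono)

text \<open>A map that agrees with the identity up to terms of higher degree is invertible, by
  induction on the lowest degree of the argument, in descending order.\<close>

lemma bij_betw_raising_degree:
  fixes f :: "(nat set \<Rightarrow> 'k::comm_ring_1) \<Rightarrow> nat set \<Rightarrow> 'k"
  assumes maps: "\<And>a. a \<in> mono_span n P \<Longrightarrow> f a \<in> mono_span n P"
    and diff: "\<And>a b. a \<in> mono_span n P \<Longrightarrow> b \<in> mono_span n P \<Longrightarrow> f (a - b) = f a - f b"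
    and raise: "\<And>a d. a \<in> mono_span n P \<Longrightarrow> a \<in> mono_span n (\<lambda>\<alpha>. d \<le> card \<alpha>) \<Longrightarrow>
      f a - a \<in> mono_span n (\<lambda>\<alpha>. Suc d \<le> card \<alpha>)"
  shows "bij_betw f (mono_span n P) (mono_span n P)"
proof -
  \<comment> \<open>There are no monomials of degree above n; this is where the descending induction
    starts.\<close>
  have big: "a = 0" if "a \<in> mono_span n (\<lambda>\<alpha>. Suc n \<le> card \<alpha>)" for a :: "nat set \<Rightarrow> 'k"
  proof
    fix \<alpha>
    have "card \<alpha> \<le> n" if "\<alpha> \<subseteq> {1..n}" using card_mono[OF _ that] by simp
    then show "a \<alpha> = 0 \<alpha>" using that by (fastforce simp: mono_span_iff fun_apply)
  qed
  have inj: "a = b" if ab: "a \<in> mono_span n P" "b \<in> mono_span n P" "f a = f b" for a b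
  proof -
    have v: "a - b \<in> mono_span n P" "f (a - b) = 0"
      using ab by (auto simp: mono_span_closed diff)
    \<comment> \<open>An element v with f v = 0 equals -(f v - v), so its lowest degree can be
      raised again and again.\<close>
    have "a - b \<in> mono_span n (\<lambda>\<alpha>. d \<le> card \<alpha>)" for d
    proof (induction d)
      case 0
      then show ?case using v by (auto intro: mono_span_mono)
    next
      case (Suc d)
      have "f (a - b) - (a - b) \<in> mono_span n (\<lambda>\<alpha>. Suc d \<le> card \<alpha>)"
        by (rule raise[OF v(1) Suc])
      then have "- (f (a - b) - (a - b)) \<in> mono_span n (\<lambda>\<alpha>. Suc d \<le> card \<alpha>)"
        by (rule mono_span_closed)
      then show ?case by (simp only: v(2) diff_0 minus_minus)
    qed
    then have "a - b = 0" by (rule big)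
    then show ?thesis by simp
  qed
  have surj: "\<exists>b\<in>mono_span n P. f b = a"
    if "a \<in> mono_span n P" "a \<in> mono_span n (\<lambda>\<alpha>. d \<le> card \<alpha>)" for a d
    using that
  proof (induction "Suc n - d" arbitrary: a d)
    case 0
    then have "a \<in> mono_span n (\<lambda>\<alpha>. Suc n \<le> card \<alpha>)" by (auto intro: mono_span_mono)
    then have "a = 0" by (rule big)
    moreover have "f 0 = 0" using diff[of 0 0] by (simp add: mono_span_closed)
    ultimately show ?case by (auto simp: mono_span_closed)
  next
    case (Suc k)
    \<comment> \<open>The defect has degree at least d + 1, hence is some f b by induction; then f
      (a - b) = a.\<close>
    have "\<exists>b\<in>mono_span n P. f b = f a - a"
      by (rule Suc(1)[of "Suc d"]) (use Suc in \<open>auto intro: mono_span_closed maps raise\<close>)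
    then obtain b where b: "b \<in> mono_span n P" "f b = f a - a" by auto
    then have "f (a - b) = a" using diff[OF Suc(3) b(1)] by simp
    then show ?case using b Suc(3) by (auto intro!: bexI[of _ "a - b"] mono_span_closed)
  qed
  show ?thesis unfolding bij_betw_def inj_on_def
  proof (intro conjI ballI impI)
    show "f ` mono_span n P = mono_span n P"
      using maps surj[of _ 0] by (force intro: mono_span_mono)
  qed (use inj in auto)
qed

lemma (in unip_endo) in_mono_span:
  assumes "a \<in> mono_span n P"
    and "\<And>\<alpha> \<gamma>. \<alpha> \<subseteq> {1..n} \<Longrightarrow> \<gamma> \<subseteq> {1..n} \<Longrightarrow> P \<alpha> \<Longrightarrow> even_ext 0 \<alpha> \<gamma> \<Longrightarrow> P \<gamma>"
  shows "\<sigma> a \<in> mono_span n P"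
proof -
  have "\<sigma> a - a \<in> mono_span n P"
    by (rule diff_in_mono_span[OF assms(1)])
      (rule assms(2), assumption+, erule even_ext_weaken, simp)
  then have "(\<sigma> a - a) + a \<in> mono_span n P" using assms(1) by (rule mono_span_closed)
  then show ?thesis by simp
qed

text \<open>Bijectivity is proved on each span stable under even extensions, and not just on the
  whole algebra, because this makes the inverse automorphism preserve the same spans.\<close>

lemma (in unip_endo) bij_betw_mono_span:
  assumes "1 \<le> e"
    and "\<And>\<alpha> \<gamma>. \<alpha> \<subseteq> {1..n} \<Longrightarrow> \<gamma> \<subseteq> {1..n} \<Longrightarrow> P \<alpha> \<Longrightarrow> even_ext 0 \<alpha> \<gamma> \<Longrightarrow> P \<gamma>"
  shows "bij_betw \<sigma> (mono_span n P) (mono_span n P)"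
proof (rule bij_betw_raising_degree)
  fix a :: "nat set \<Rightarrow> 'k" and d
  assume "a \<in> mono_span n P" "a \<in> mono_span n (\<lambda>\<alpha>. d \<le> card \<alpha>)"
  show "\<sigma> a - a \<in> mono_span n (\<lambda>\<alpha>. Suc d \<le> card \<alpha>)"
  proof (rule diff_in_mono_span)
    fix \<alpha> \<gamma> :: "nat set"
    assume "\<gamma> \<subseteq> {1..n}" "d \<le> card \<alpha>" "even_ext e \<alpha> \<gamma>"
    then show "Suc d \<le> card \<gamma>"
      using even_ext_card_le[of e \<alpha> \<gamma>] finite_subset[of \<gamma> "{1..n}"] assms(1) by simp
  qed fact
qed (auto intro: in_mono_span assms(2) diff mono_span_carrier)

section \<open>Automorphisms of level e and the groups \<open>Phi_pow\<close>\<close>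

definition unip_group :: "nat \<Rightarrow> nat \<Rightarrow> ((nat set \<Rightarrow> 'k::comm_ring_1) \<Rightarrow> nat set \<Rightarrow> 'k) set" where
  "unip_group n e = {\<sigma> \<in> Bij (gcar n). unip_endo n \<sigma> e}"

lemma unip_group_D:
  assumes "\<sigma> \<in> unip_group n e"
  shows "\<sigma> \<in> Bij (gcar n)" "unip_endo n \<sigma> e" "alg_endo n \<sigma>" "\<sigma> \<in> Grassmann_aut n"
  using assms by (auto simp: unip_group_def Grassmann_aut_iff unip_endo_def)

lemma unip_group_iff:
  "\<sigma> \<in> unip_group n e \<longleftrightarrow> \<sigma> \<in> Grassmann_aut n \<and>
     (\<forall>i\<in>{1..n}. \<sigma> (xgen i) - xgen i \<in> mono_span n (even_ext e {i}))"
  by (auto simp: unip_group_def Grassmann_aut_iff unip_endo_def unip_endo_axioms_def)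

lemma unip_group_mono: "e' \<le> e \<Longrightarrow> unip_group n e \<subseteq> unip_group n e'"
  by (auto simp: unip_group_def intro: unip_endo_weaken)

lemma unip_group_inv_in_mono_span:
  assumes s: "\<sigma> \<in> unip_group n e" and e: "1 \<le> e" and a: "a \<in> mono_span n P"
    and P: "\<And>\<alpha> \<gamma>. \<alpha> \<subseteq> {1..n} \<Longrightarrow> \<gamma> \<subseteq> {1..n} \<Longrightarrow> P \<alpha> \<Longrightarrow> even_ext 0 \<alpha> \<gamma> \<Longrightarrow> P \<gamma>"
  shows "(inv\<^bsub>BijGroup (gcar n)\<^esub> \<sigma>) a \<in> mono_span n P"
proof -
  interpret unip_endo n \<sigma> e using s by (rule unip_group_D)
  have "bij_betw \<sigma> (mono_span n P) (mono_span n P)"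
    using e P by (rule bij_betw_mono_span)
  then have "a \<in> \<sigma> ` mono_span n P" using a by (simp add: bij_betw_imp_surj_on)
  then obtain b where b: "\<sigma> b = a" "b \<in> mono_span n P" by auto
  then have "(inv\<^bsub>BijGroup (gcar n)\<^esub> \<sigma>) a = b"
    using Bij_inv_apply(3)[OF unip_group_D(1)[OF s] mono_span_carrier[OF b(2)]] b(1) by simp
  then show ?thesis using b(2) by simp
qed

lemma subgroup_unip_group:
  assumes e: "1 \<le> e"
  shows "subgroup (unip_group n e) (BijGroup (gcar n))"
proof -
  interpret group "BijGroup (gcar n)" by (rule group_BijGroup)
  interpret A: subgroup "Grassmann_aut n" "BijGroup (gcar n)" by (rule subgroup_Grassmann_aut)
  have ext0: "even_ext e {i} \<gamma>" if "even_ext e {i} \<alpha>" "even_ext 0 \<alpha> \<gamma>" "\<gamma> \<subseteq> {1..n}" for i \<alpha> \<gamma>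
    using even_ext_trans[OF that(1,2)] finite_subset[OF that(3)] by simp
  show ?thesis
  proof
    show "unip_group n e \<subseteq> carrier (BijGroup (gcar n))"
      by (auto simp: unip_group_def BijGroup_def)
    show "\<one>\<^bsub>BijGroup (gcar n)\<^esub> \<in> unip_group n e"
      using A.one_closed by (auto simp: unip_group_iff BijGroup_def xgen_carrier mono_span_closed)
  next
    fix \<sigma> \<tau> :: "(nat set \<Rightarrow> 'a) \<Rightarrow> nat set \<Rightarrow> 'a"
    assume st: "\<sigma> \<in> unip_group n e" "\<tau> \<in> unip_group n e"
    interpret s: unip_endo n \<sigma> e using st(1) by (rule unip_group_D)
    interpret t: unip_endo n \<tau> e using st(2) by (rule unip_group_D)
    have "(\<sigma> \<otimes>\<^bsub>BijGroup (gcar n)\<^esub> \<tau>) (xgen i) - xgen i \<in> mono_span n (even_ext e {i})"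
      if i: "i \<in> {1..n}" for i
    proof -
      \<comment> \<open>This sum is \<sigma>(\<tau>(x_i)) - x_i.\<close>
      have "\<sigma> (\<tau> (xgen i) - xgen i) + (\<sigma> (xgen i) - xgen i) \<in> mono_span n (even_ext e {i})"
        by (intro mono_span_closed s.level i s.in_mono_span t.level) (rule ext0)
      then show ?thesis
        using i by (simp add: Bij_mult_apply unip_group_D[OF st(1)] unip_group_D[OF st(2)] xgen_carrier
            s.diff t.closed)
    qed
    then show "\<sigma> \<otimes>\<^bsub>BijGroup (gcar n)\<^esub> \<tau> \<in> unip_group n e"
      using st A.m_closed by (auto simp: unip_group_iff)
  next
    fix \<sigma> :: "(nat set \<Rightarrow> 'a) \<Rightarrow> nat set \<Rightarrow> 'a"
    assume s: "\<sigma> \<in> unip_group n e"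
    let ?i = "inv\<^bsub>BijGroup (gcar n)\<^esub> \<sigma>"
    interpret s: unip_endo n \<sigma> e using s by (rule unip_group_D)
    have ia: "?i \<in> Grassmann_aut n" using unip_group_D(4)[OF s] by (rule A.m_inv_closed)
    interpret i: alg_endo n ?i using ia by (simp add: Grassmann_aut_iff)
    have "?i (xgen i) - xgen i \<in> mono_span n (even_ext e {i})" if i: "i \<in> {1..n}" for i
    proof -
      \<comment> \<open>Up to sign this is the difference of the inverse at x_i, since the inverse
        takes \<sigma>(x_i) back to x_i.\<close>
      have "?i (\<sigma> (xgen i) - xgen i) \<in> mono_span n (even_ext e {i})"
        by (intro unip_group_inv_in_mono_span[OF s e s.level] i) (rule ext0)
      then have "- ?i (\<sigma> (xgen i) - xgen i) \<in> mono_span n (even_ext e {i})"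
        by (rule mono_span_closed)
      then show ?thesis
        using i by (simp add: i.diff s.closed xgen_carrier Bij_inv_apply(3)[OF unip_group_D(1)[OF s]])
    qed
    then show "?i \<in> unip_group n e" using ia by (auto simp: unip_group_iff)
  qed
qed

text \<open>The shift by one arises because the maximal ideal starts in degree 1, so raising degrees
  by e leads into its power e + 1. The bound 2 \<le> e accounts for the third power in
  \<open>Gamma\<close>.\<close>

lemma Phi_pow_eq:
  assumes "2 \<le> e" "m = Suc e"
  shows "Phi_pow n m = (unip_group n e :: ((nat set \<Rightarrow> 'k::comm_ring_1) \<Rightarrow> _) set)"
proof (intro equalityI subsetI)
  fix \<sigma> :: "(nat set \<Rightarrow> 'k) \<Rightarrow> nat set \<Rightarrow> 'k"
  assume s: "\<sigma> \<in> Phi_pow n m"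
  then have aut: "\<sigma> \<in> Grassmann_aut n" by (simp add: Phi_pow_def Phi_def Gamma_def)
  interpret alg_endo n \<sigma> using aut by (simp add: Grassmann_aut_iff)
  have "\<sigma> (xgen i) - xgen i \<in> mono_span n (even_ext e {i})" if i: "i \<in> {1..n}" for i
  proof -
    let ?d = "\<sigma> (xgen i) - xgen i"
    have mi: "?d = \<sigma> (xgen i) \<ominus>\<^bsub>Grassmann n\<^esub> xgen i"
      using i by (simp add: Grassmann_minus xgen_carrier closed)
    have x: "xgen i \<in> mono_span n (\<lambda>\<alpha>. i \<in> \<alpha>)" "xgen i \<in> max_ideal n"
      unfolding xgen_def max_ideal_def using i by (auto intro!: xmon_in_mono_span)
    have "\<sigma> (xgen i) \<in> mono_span n (\<lambda>\<alpha>. i \<in> \<alpha>)"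
      using s i by (auto simp: Phi_pow_def Phi_def genideal_xgen_eq)
    then have "?d \<in> mono_span n (\<lambda>\<alpha>. i \<in> \<alpha>)" using x by (intro mono_span_closed)
    moreover have "?d \<in> mono_span n (\<lambda>\<alpha>. odd (card \<alpha>))"
      using s i unfolding mi by (auto simp: Phi_pow_def Phi_def Gamma_def odd_part_def)
    moreover have "?d \<in> mono_span n (\<lambda>\<alpha>. Suc e \<le> card \<alpha>)"
      using s x unfolding mi max_ideal_pow_eq[symmetric] by (auto simp: Phi_pow_def assms)
    ultimately show ?thesis
      by (auto simp: mono_span_iff even_ext_def)
  qed
  then show "\<sigma> \<in> unip_group n e" using aut by (simp add: unip_group_iff)
next
  fix \<sigma> :: "(nat set \<Rightarrow> 'k) \<Rightarrow> nat set \<Rightarrow> 'k"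
  assume s: "\<sigma> \<in> unip_group n e"
  then have aut: "\<sigma> \<in> Grassmann_aut n" by (rule unip_group_D)
  interpret unip_endo n \<sigma> e using s by (rule unip_group_D)
  have x: "xgen i \<in> mono_span n (\<lambda>\<alpha>. i \<in> \<alpha>)" if "i \<in> {1..n}" for i
    unfolding xgen_def using that by (auto intro!: xmon_in_mono_span)
  have cd: "card \<gamma> = Suc (card (\<gamma> - {i}))" if "even_ext e {i} \<gamma>" "\<gamma> \<subseteq> {1..n}" for i \<gamma>
    using even_ext_card[OF that(1)] finite_subset[OF that(2)] by simp
  have g: "\<sigma> (xgen i) \<ominus>\<^bsub>Grassmann n\<^esub> xgen i \<in> odd_part n \<inter> max_ideal_pow n 3"
    if i: "i \<in> {1..n}" for i
  proof -
    have oc: "odd (card \<gamma>) \<and> 3 \<le> card \<gamma>"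
      if ext: "even_ext e {i} \<gamma>" "\<gamma> \<subseteq> {1..n}" for \<gamma>
    proof -
      obtain k where "card \<gamma> = Suc k" "even k" "e \<le> k"
        using cd[OF ext] ext(1) by (metis even_ext_def)
      then show ?thesis using assms by simp
    qed
    have "\<sigma> (xgen i) - xgen i \<in> odd_part n" "\<sigma> (xgen i) - xgen i \<in> max_ideal_pow n 3"
      unfolding odd_part_def max_ideal_pow_eq
      by (rule mono_span_mono[OF level[OF i]]; use oc in simp)+
    then show ?thesis using i by (simp add: Grassmann_minus xgen_carrier closed)
  qed
  have p: "\<sigma> (xgen i) \<in> genideal (Grassmann n) {xgen i}" if i: "i \<in> {1..n}" for i
    unfolding genideal_xgen_eq[OF i] by (rule in_mono_span[OF x[OF i]]) (auto simp: even_ext_def)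
  have "\<sigma> a \<ominus>\<^bsub>Grassmann n\<^esub> a \<in> max_ideal_pow n m" if a: "a \<in> max_ideal n" for a
  proof -
    have "\<sigma> a - a \<in> mono_span n (\<lambda>\<alpha>. m \<le> card \<alpha>)"
    proof (rule diff_in_mono_span[OF a[unfolded max_ideal_def]])
      fix \<alpha> \<gamma> :: "nat set"
      assume "\<gamma> \<subseteq> {1..n}" "1 \<le> card \<alpha>" "even_ext e \<alpha> \<gamma>"
      then show "m \<le> card \<gamma>"
        using even_ext_card_le[of e \<alpha> \<gamma>] finite_subset[of \<gamma> "{1..n}"] assms by simp
    qed
    moreover have "a \<in> gcar n" using a unfolding max_ideal_def by (rule mono_span_carrier)
    ultimately show ?thesis by (simp add: Grassmann_minus closed max_ideal_pow_eq)
  qed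
  then show "\<sigma> \<in> Phi_pow n m" using aut g p by (simp add: Phi_pow_def Phi_def Gamma_def)
qed

section \<open>The even part and existence of automorphisms\<close>

text \<open>A type of class \<open>comm_ring_1\<close> is needed for determinants, and it cannot
  depend on \<open>n\<close>. Finite supports take the place of the bound by {1..n}:
  \<open>gmul\<close> is zero at infinite sets, so without them \<open>xmon {}\<close> would not be
  a unit element.\<close>

typedef (overloaded) ('k::comm_ring_1) ev =
  "{a :: nat set \<Rightarrow> 'k. \<forall>\<alpha>. a \<alpha> \<noteq> 0 \<longrightarrow> finite \<alpha> \<and> even (card \<alpha>)}"
  morphisms rep_ev Abs_ev
  by (rule exI[of _ 0]) (simp add: fun_apply)

lemma rep_ev_nonzero: "rep_ev x \<alpha> \<noteq> 0 \<Longrightarrow> finite \<alpha> \<and> even (card \<alpha>)"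
  using rep_ev[of x] by simp

lemma rep_Abs_ev: "(\<And>\<alpha>. a \<alpha> \<noteq> 0 \<Longrightarrow> finite \<alpha> \<and> even (card \<alpha>)) \<Longrightarrow> rep_ev (Abs_ev a) = a"
  by (rule Abs_ev_inverse) simp

lemma rep_ev_central: "rep_ev x \<star> b = b \<star> rep_ev x"
  by (rule even_central) (use rep_ev_nonzero in blast)

instantiation ev :: (comm_ring_1) comm_ring_1
begin

definition "0 = Abs_ev 0"
definition "1 = Abs_ev (xmon {})"
definition "x + y = Abs_ev (rep_ev x + rep_ev y)"
definition "x - y = Abs_ev (rep_ev x - rep_ev y)"
definition "- x = Abs_ev (- rep_ev x)"
definition "x * y = Abs_ev (rep_ev x \<star> rep_ev y)"

lemma rep_ev_simps:
  "rep_ev 0 = 0"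
  "rep_ev 1 = xmon {}"
  "rep_ev (x + y) = rep_ev x + rep_ev y"
  "rep_ev (x - y) = rep_ev x - rep_ev y"
  "rep_ev (- x) = - rep_ev x"
  "rep_ev (x * y) = rep_ev x \<star> rep_ev y"
proof -
  show "rep_ev 0 = 0" unfolding zero_ev_def by (rule rep_Abs_ev) (simp add: fun_apply)
  show "rep_ev 1 = xmon {}"
    unfolding one_ev_def by (rule rep_Abs_ev) (auto simp: xmon_def split: if_splits)
  show "rep_ev (x + y) = rep_ev x + rep_ev y"
    unfolding plus_ev_def
    by (rule rep_Abs_ev) (metis add.right_neutral fun_apply(1) rep_ev_nonzero)
  show "rep_ev (x - y) = rep_ev x - rep_ev y"
    unfolding minus_ev_def
    by (rule rep_Abs_ev) (metis diff_self fun_apply(3) rep_ev_nonzero)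
  show "rep_ev (- x) = - rep_ev x"
    unfolding uminus_ev_def
    by (rule rep_Abs_ev) (metis fun_apply(4) neg_equal_0_iff_equal rep_ev_nonzero)
  have "finite \<gamma> \<and> even (card \<gamma>)" if nz_sum: "(rep_ev x \<star> rep_ev y) \<gamma> \<noteq> 0" for \<gamma>
  proof -
    obtain \<alpha> where \<alpha>: "\<alpha> \<in> Pow \<gamma>"
      and "(- 1) ^ inversions \<alpha> (\<gamma> - \<alpha>) * rep_ev x \<alpha> * rep_ev y (\<gamma> - \<alpha>) \<noteq> 0"
      by (rule sum.not_neutral_contains_not_neutral[OF nz_sum[unfolded gmul_def]])
    then have "rep_ev x \<alpha> \<noteq> 0" "rep_ev y (\<gamma> - \<alpha>) \<noteq> 0" by auto
    then have *: "finite \<alpha>" "even (card \<alpha>)" "finite (\<gamma> - \<alpha>)" "even (card (\<gamma> - \<alpha>))"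
      using rep_ev_nonzero by blast+
    have "card (\<alpha> \<union> (\<gamma> - \<alpha>)) = card \<alpha> + card (\<gamma> - \<alpha>)"
      using * by (intro card_Un_disjoint) auto
    moreover have "\<alpha> \<union> (\<gamma> - \<alpha>) = \<gamma>" using \<alpha> by auto
    ultimately show ?thesis using * by (metis even_add finite_Un)
  qed
  then show "rep_ev (x * y) = rep_ev x \<star> rep_ev y"
    unfolding times_ev_def by (rule rep_Abs_ev)
qed

instance
proof
  fix x y z :: "'a ev"
  show "1 * x = x"
  proof -
    have "(xmon {} \<star> rep_ev x) \<gamma> = rep_ev x \<gamma>" for \<gamma>
    proof (cases "finite \<gamma>")
      case True
      have "(xmon {} \<star> rep_ev x) \<gamma> = (\<Sum>\<alpha>\<in>Pow \<gamma>. if \<alpha> = {} then rep_ev x \<gamma> else 0)"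
        unfolding gmul_def by (rule sum.cong) (auto simp: xmon_def)
      then show ?thesis using True by simp
    next
      case False
      then show ?thesis using rep_ev_nonzero[of x \<gamma>] by (auto simp: gmul_def)
    qed
    then show ?thesis
      unfolding rep_ev_inject[symmetric] rep_ev_simps by (simp add: fun_eq_iff)
  qed
  show "x * y = y * x"
    unfolding rep_ev_inject[symmetric] rep_ev_simps by (rule rep_ev_central)
  show "(0::'a ev) \<noteq> 1"
    unfolding rep_ev_inject[symmetric] rep_ev_simps
    by (auto simp: fun_eq_iff xmon_def fun_apply)
qed (unfold rep_ev_inject[symmetric] rep_ev_simps,
  simp_all add: gmul_assoc gmul_add_left add_ac)

end

lemma rep_ev_sum: "rep_ev (sum f A) = (\<Sum>i\<in>A. rep_ev (f i))"
  using sum_comp_morphism[of rep_ev f A] by (simp add: rep_ev_simps o_def)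

text \<open>The candidate for the endomorphism with x_i mapped to x_i (1 + c_i): in the image of
  x^\<alpha> the factors 1 + c_i are even, hence central, and are collected on the right.\<close>

definition endo :: "nat \<Rightarrow> (nat \<Rightarrow> 'k::comm_ring_1 ev) \<Rightarrow> (nat set \<Rightarrow> 'k) \<Rightarrow> nat set \<Rightarrow> 'k" where
  "endo n c a = (\<Sum>\<alpha>\<in>Pow {1..n}. scal (a \<alpha>) (xmon \<alpha> \<star> rep_ev (\<Prod>i\<in>\<alpha>. 1 + c i)))"

lemma endo_add: "endo n c (a + b) = endo n c a + endo n c b"
proof -
  have *: "scal (p + q) v = scal p v + scal q v" for p q :: 'a and v
    by (simp add: fun_eq_iff fun_apply algebra_simps)
  show ?thesis by (simp add: endo_def fun_apply * sum.distrib)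
qed

lemma endo_scal: "endo n c (scal r a) = scal r (endo n c a)"
  by (simp add: endo_def scal_simps scal_sum)

lemma endo_zero: "endo n c 0 = 0"
  using endo_scal[of n c 0 0] by (simp add: scal_simps)

lemma endo_sum: "endo n c (sum f A) = (\<Sum>i\<in>A. endo n c (f i))"
  using sum_comp_morphism[of "endo n c" f A] by (simp add: endo_add endo_zero o_def)

lemma endo_xmon:
  assumes "\<alpha> \<subseteq> {1..n}"
  shows "endo n c (xmon \<alpha>) = xmon \<alpha> \<star> rep_ev (\<Prod>i\<in>\<alpha>. 1 + c i)"
proof -
  have "endo n c (xmon \<alpha>) =
      (\<Sum>\<beta>\<in>Pow {1..n}. if \<beta> = \<alpha> then xmon \<alpha> \<star> rep_ev (\<Prod>i\<in>\<alpha>. 1 + c i) else 0)"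
    unfolding endo_def by (rule sum.cong) (auto simp: xmon_def scal_simps)
  then show ?thesis using assms by simp
qed

text \<open>After the central factors have been moved to the right, disjoint \<alpha> and \<beta>
  leave a product over their union; if they meet, both sides vanish because x^\<alpha> x^\<beta>
  does.\<close>

lemma endo_mult_xmon:
  assumes "\<alpha> \<subseteq> {1..n}" "\<beta> \<subseteq> {1..n}"
  shows "endo n c (xmon \<alpha> \<star> xmon \<beta>) = endo n c (xmon \<alpha>) \<star> endo n c (xmon \<beta>)"
proof -
  let ?P = "\<lambda>\<alpha>. \<Prod>i\<in>\<alpha>. 1 + c i"
  have fin: "finite \<alpha>" "finite \<beta>" using assms finite_index_set by blast+
  have "endo n c (xmon \<alpha>) \<star> endo n c (xmon \<beta>) = xmon \<alpha> \<star> (rep_ev (?P \<alpha>) \<star> xmon \<beta>) \<star> rep_ev (?P \<beta>)"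
    using assms by (simp add: endo_xmon gmul_assoc)
  also have "\<dots> = (xmon \<alpha> \<star> xmon \<beta>) \<star> rep_ev (?P \<alpha> * ?P \<beta>)"
    by (simp add: rep_ev_central[of "?P \<alpha>" "xmon \<beta>"] gmul_assoc rep_ev_simps)
  also have "\<dots> = endo n c (xmon \<alpha> \<star> xmon \<beta>)"
  proof (cases "\<alpha> \<inter> \<beta> = {}")
    case True
    have "?P (\<alpha> \<union> \<beta>) = ?P \<alpha> * ?P \<beta>"
      using fin True by (rule prod.union_disjoint)
    then show ?thesis
      using assms fin True by (simp add: xmon_mult endo_scal endo_xmon gmul_scal_left)
  next
    case False
    then show ?thesis using fin by (simp add: xmon_mult endo_zero)
  qed
  finally show ?thesis ..
qed

lemma prod_ev_carrier:
  assumes "\<And>i. i \<in> A \<Longrightarrow> rep_ev (f i) \<in> gcar n"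
  shows "rep_ev (prod f A) \<in> gcar n"
  using assms
  by (induction A rule: infinite_finite_induct) (auto simp: rep_ev_simps xmon_carrier gcar_gmul)

lemma alg_endo_endo:
  assumes "\<And>i. i \<in> {1..n} \<Longrightarrow> rep_ev (c i) \<in> gcar n"
  shows "alg_endo n (endo n c)"
proof
  fix a b :: "nat set \<Rightarrow> 'a" and r
  assume a: "a \<in> gcar n"
  have "rep_ev (\<Prod>i\<in>\<alpha>. 1 + c i) \<in> gcar n" if "\<alpha> \<subseteq> {1..n}" for \<alpha>
    using that assms by (intro prod_ev_carrier) (auto simp: rep_ev_simps gcar_closed xmon_carrier)
  then show "endo n c a \<in> gcar n"
    unfolding endo_def by (intro gcar_sum gcar_closed gcar_gmul) (auto simp: xmon_carrier)
  show "endo n c (scal r a) = scal r (endo n c a)" by (rule endo_scal)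
  assume b: "b \<in> gcar n"
  show "endo n c (a + b) = endo n c a + endo n c b" by (rule endo_add)
  let ?S = "Pow {1..n}"
  have "endo n c (a \<star> b) = endo n c ((\<Sum>\<alpha>\<in>?S. scal (a \<alpha>) (xmon \<alpha>)) \<star> (\<Sum>\<beta>\<in>?S. scal (b \<beta>) (xmon \<beta>)))"
    using monomial_expansion[OF a] monomial_expansion[OF b] by simp
  also have "\<dots> = (\<Sum>\<alpha>\<in>?S. \<Sum>\<beta>\<in>?S. scal (a \<alpha>) (scal (b \<beta>) (endo n c (xmon \<alpha> \<star> xmon \<beta>))))"
    by (simp add: gmul_sum_left gmul_sum_right gmul_scal_left gmul_scal_right endo_sum endo_scal
        scal_sum) (subst sum.swap, simp add: scal_simps mult_ac)
  also have "\<dots> = (\<Sum>\<alpha>\<in>?S. \<Sum>\<beta>\<in>?S. scal (a \<alpha>) (scal (b \<beta>) (endo n c (xmon \<alpha>) \<star> endo n c (xmon \<beta>))))"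
    by (intro sum.cong refl) (simp add: endo_mult_xmon)
  also have "\<dots> = (\<Sum>\<alpha>\<in>?S. scal (a \<alpha>) (endo n c (xmon \<alpha>))) \<star> (\<Sum>\<beta>\<in>?S. scal (b \<beta>) (endo n c (xmon \<beta>)))"
    by (simp add: gmul_sum_left gmul_sum_right gmul_scal_left gmul_scal_right scal_sum)
      (subst sum.swap, simp add: scal_simps mult_ac)
  also have "\<dots> = endo n c (\<Sum>\<alpha>\<in>?S. scal (a \<alpha>) (xmon \<alpha>)) \<star> endo n c (\<Sum>\<beta>\<in>?S. scal (b \<beta>) (xmon \<beta>))"
    by (simp add: endo_sum endo_scal)
  also have "\<dots> = endo n c a \<star> endo n c b"
    using monomial_expansion[OF a] monomial_expansion[OF b] by simp
  finally show "endo n c (a \<star> b) = endo n c a \<star> endo n c b" .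
next
  show "endo n c (xmon {}) = xmon {}"
    by (simp add: endo_xmon rep_ev_simps gmul_one[OF xmon_carrier[of "{}" n]])
qed

text \<open>The common source of the automorphisms \<open>rho\<close> and of the factors in
  \<open>Phi'\<close>: even tails of degree at least e make the endomorphism unipotent, and
  unipotent endomorphisms are bijective.\<close>

lemma unip_group_exists:
  fixes b :: "nat \<Rightarrow> nat set \<Rightarrow> 'k::comm_ring_1"
  assumes e: "1 \<le> e"
    and b: "\<And>i. i \<in> {1..n} \<Longrightarrow> b i \<in> mono_span n (\<lambda>\<alpha>. even (card \<alpha>) \<and> e \<le> card \<alpha> \<and> i \<notin> \<alpha>)"
  obtains \<sigma> where "\<sigma> \<in> unip_group n e" "\<And>i. i \<in> {1..n} \<Longrightarrow> \<sigma> (xgen i) = xgen i \<star> (xmon {} + b i)"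
proof -
  define c where "c i = Abs_ev (b i)" for i
  have c: "rep_ev (c i) = b i" if "i \<in> {1..n}" for i
    unfolding c_def using b[OF that]
    unfolding mono_span_iff by (intro rep_Abs_ev) (blast intro: finite_index_set)
  interpret alg_endo n "endo n c"
    by (rule alg_endo_endo) (simp add: c mono_span_carrier[OF b])
  have im: "endo n c (xgen i) = xgen i \<star> (xmon {} + b i)" if "i \<in> {1..n}" for i
    using that by (simp add: xgen_def endo_xmon rep_ev_simps c)
  have "endo n c (xgen i) - xgen i \<in> mono_span n (even_ext e {i})" if i: "i \<in> {1..n}" for i
  proof -
    have "endo n c (xgen i) - xgen i = xgen i \<star> b i"
      using i by (simp add: im gmul_add_right gmul_one[OF xgen_carrier[OF i]])
    also have "\<dots> \<in> mono_span n (even_ext e {i})"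
      unfolding xgen_def
    proof (rule gmul_mono_span[OF xmon_in_mono_span[where P = "\<lambda>\<alpha>. \<alpha> = {i}"] b[OF i]])
      fix \<alpha> \<beta> assume *: "\<alpha> = {i}" "even (card \<beta>) \<and> e \<le> card \<beta> \<and> i \<notin> \<beta>"
      then have "\<alpha> \<union> \<beta> - {i} = \<beta>" by auto
      then show "even_ext e {i} (\<alpha> \<union> \<beta>)" using * by (simp add: even_ext_def)
    qed (use i in auto)
    finally show ?thesis .
  qed
  then interpret unip_endo n "endo n c" e by unfold_locales
  \<comment> \<open>Elements of \<open>BijGroup\<close> are extensional, so the map is cut down to
    the carrier.\<close>
  define \<sigma> where "\<sigma> = restrict (endo n c) (gcar n)"
  have bij: "bij_betw (endo n c) (gcar n) (gcar n)"
    unfolding gcar_eq_mono_span using e by (rule bij_betw_mono_span) simp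
  have ap: "\<sigma> a = endo n c a" if "a \<in> gcar n" for a
    using that by (simp add: \<sigma>_def)
  have "bij_betw \<sigma> (gcar n) (gcar n)" using bij by (subst bij_betw_cong[OF ap])
  then have "\<sigma> \<in> Bij (gcar n)" by (simp add: Bij_def \<sigma>_def)
  moreover have "unip_endo n \<sigma> e"
    by standard (simp_all add: ap gcar_closed gcar_gmul xmon_carrier xgen_carrier closed add scal
        mult one level)
  ultimately have "\<sigma> \<in> unip_group n e" by (simp add: unip_group_def)
  then show ?thesis by (rule that) (simp add: ap xgen_carrier im)
qed

section \<open>Determinants\<close>

definition leibniz_det :: "nat \<Rightarrow> (nat \<Rightarrow> nat \<Rightarrow> 'a::comm_ring_1) \<Rightarrow> 'a" where
  "leibniz_det n M = (\<Sum>p | p permutes {1..n}. of_int (sign p) * (\<Prod>i\<in>{1..n}. M i (p i)))"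

text \<open>Bordering by a row and a column with index \<open>0\<close> turns the index set \<open>{1..n}\<close> into
  \<open>{0..<n + 1}\<close>.\<close>

lemma det_bordered:
  fixes M :: "nat \<Rightarrow> nat \<Rightarrow> 'a::comm_ring_1"
  shows "det (mat (Suc n) (Suc n) (\<lambda>(i, j). if i = 0 \<or> j = 0 then of_bool (i = j) else M i j)) =
    leibniz_det n M" (is "det ?M = _")
proof -
  let ?N = "\<lambda>i j. if i = 0 \<or> j = 0 then of_bool (i = j) else M i j"
  let ?t = "\<lambda>p. of_int (sign p) * (\<Prod>i\<in>{0..<Suc n}. ?N i (p i))"
  have sub: "{1..n} \<subseteq> {0..<Suc n}" by auto
  have "det ?M = (\<Sum>p | p permutes {0..<Suc n}. signof p * (\<Prod>i = 0..<Suc n. ?M $$ (i, p i)))"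
    by (rule det_def') simp
  also have "\<dots> = (\<Sum>p | p permutes {0..<Suc n}. ?t p)"
  proof (rule sum.cong[OF refl])
    fix p assume "p \<in> {p. p permutes {0..<Suc n}}"
    then have lt: "p i < Suc n" if "i < Suc n" for i
      using that permutes_in_image[of p "{0..<Suc n}" i] by simp
    have "(\<Prod>i = 0..<Suc n. ?M $$ (i, p i)) = (\<Prod>i\<in>{0..<Suc n}. ?N i (p i))"
      by (rule prod.cong[OF refl]) (use lt in auto)
    then show "signof p * (\<Prod>i = 0..<Suc n. ?M $$ (i, p i)) = ?t p" by (simp only:)
  qed
  also have "\<dots> = (\<Sum>p | p permutes {1..n}. ?t p)"
  proof (rule sum.mono_neutral_right)
    show "{p. p permutes {1..n}} \<subseteq> {p. p permutes {0..<Suc n}}"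
      using permutes_subset[OF _ sub] by auto
    show "\<forall>p\<in>{p. p permutes {0..<Suc n}} - {p. p permutes {1..n}}. ?t p = 0"
    proof
      fix p assume p: "p \<in> {p. p permutes {0..<Suc n}} - {p. p permutes {1..n}}"
      \<comment> \<open>A permutation that moves 0 meets a zero in row 0; one that fixes 0 is a
        permutation of {1..n}.\<close>
      have "p 0 \<noteq> 0"
      proof
        assume "p 0 = 0"
        then have fix0: "p x = x" if "x \<in> {0..<Suc n} - {1..n}" for x
          using that by (cases x) auto
        have "p permutes {1..n}"
          by (rule permutes_superset[of p "{0..<Suc n}"]) (use p in simp, fact fix0)
        with p show False by simp
      qed
      then have "(\<Prod>i\<in>{0..<Suc n}. ?N i (p i)) = 0"
        by (intro prod_zero) (auto intro!: bexI[of _ 0])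
      then show "?t p = 0" by simp
    qed
  qed (simp add: finite_permutations)
  also have "\<dots> = leibniz_det n M"
    unfolding leibniz_det_def
  proof (rule sum.cong[OF refl])
    fix p assume "p \<in> {p. p permutes {1..n}}"
    then have p: "p permutes {1..n}" by simp
    have "p 0 = 0" using permutes_not_in[OF p, of 0] by simp
    moreover have "{0..<Suc n} = insert 0 {1..n}" by auto
    moreover have "(\<Prod>i\<in>{1..n}. ?N i (p i)) = (\<Prod>i\<in>{1..n}. M i (p i))"
    proof (rule prod.cong[OF refl])
      fix i assume "i \<in> {1..n}"
      then have "p i \<in> {1..n}" using permutes_in_image[OF p] by simp
      then show "?N i (p i) = M i (p i)" using \<open>i \<in> {1..n}\<close> by simp
    qed
    ultimately show "?t p = of_int (sign p) * (\<Prod>i\<in>{1..n}. M i (p i))" by simp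
  qed
  finally show ?thesis .
qed

text \<open>Bordering is compatible with matrix products, so the product formula for the bordered
  matrices can be used.\<close>

lemma leibniz_det_mult:
  "leibniz_det n (\<lambda>i j. \<Sum>k\<in>{1..n}. A i k * B k j) = leibniz_det n A * leibniz_det n B"
proof -
  let ?m = "\<lambda>M. mat (Suc n) (Suc n) (\<lambda>(i, j). if i = 0 \<or> j = 0 then of_bool (i = j) else M i j)"
  have set: "{0..<Suc n} = insert 0 {1..n}" by auto
  have "?m A * ?m B = ?m (\<lambda>i j. \<Sum>k\<in>{1..n}. A i k * B k j)"
    by (rule eq_matI) (auto simp: scalar_prod_def set of_bool_def simp del: atLeastLessThanSuc_atLeastAtMost intro!: sum.cong)
  then have "leibniz_det n (\<lambda>i j. \<Sum>k\<in>{1..n}. A i k * B k j) = det (?m A * ?m B)"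
    by (simp only: det_bordered)
  also have "\<dots> = det (?m A) * det (?m B)"
    by (rule det_mult[of _ "Suc n"]) auto
  finally show ?thesis by (simp only: det_bordered)
qed

section \<open>The chain rule and the Jacobian\<close>

lemma skew_deriv_add: "skew_deriv j (a + b) = skew_deriv j a + skew_deriv j b"
  and skew_deriv_scal: "skew_deriv j (scal c a) = scal c (skew_deriv j a)"
  by (rule skew_deriv_linear[unfolded Grassmann_ops])+

lemma skew_deriv_zero: "skew_deriv j 0 = 0"
  using skew_deriv_scal[of j 0 0] by (simp add: scal_simps)

lemma skew_deriv_sum: "skew_deriv j (sum f A) = (\<Sum>i\<in>A. skew_deriv j (f i))"
  using sum_comp_morphism[of "skew_deriv j" f A, OF skew_deriv_zero skew_deriv_add]
  by (simp add: o_def)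

lemma skew_deriv_diff: "skew_deriv j (a - b) = skew_deriv j a - skew_deriv j b"
  using skew_deriv_add[of j "a - b" b] by simp

lemma skew_deriv_generator: "skew_deriv j (xgen k) = (if j = k then xmon {} else 0)"
  by (rule skew_deriv_xgen[unfolded Grassmann_ops])

lemma skew_deriv_gcar: "a \<in> gcar n \<Longrightarrow> skew_deriv j a \<in> gcar n"
  by (rule skew_deriv_closed)

text \<open>The skew Leibniz rule is given for homogeneous elements; as every odd degree yields the
  same sign -1, it extends by linearity to all odd elements.\<close>

lemma skew_deriv_odd_mult:
  assumes a: "a \<in> mono_span n (\<lambda>\<alpha>. odd (card \<alpha>))"
  shows "skew_deriv j (a \<star> b) = skew_deriv j a \<star> b - a \<star> skew_deriv j b"
proof -
  let ?S = "Pow {1..n}"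
  note ex = monomial_expansion[OF mono_span_carrier[OF a]]
  have "scal (a \<alpha>) (skew_deriv j (xmon \<alpha> \<star> b)) =
      scal (a \<alpha>) (skew_deriv j (xmon \<alpha>) \<star> b) - scal (a \<alpha>) (xmon \<alpha> \<star> skew_deriv j b)"
    if "\<alpha> \<in> ?S" for \<alpha>
  proof (cases "a \<alpha> = 0")
    case False
    then have o: "odd (card \<alpha>)" using a by (auto simp: mono_span_iff)
    have "(xmon \<alpha> :: nat set \<Rightarrow> 'a) \<in> mono_span n (\<lambda>\<beta>. card \<beta> = card \<alpha>)"
      using that by (intro xmon_in_mono_span) auto
    from skew_deriv_mult[OF this, of j b] o
    have "skew_deriv j (xmon \<alpha> \<star> b) = skew_deriv j (xmon \<alpha>) \<star> b - xmon \<alpha> \<star> skew_deriv j b"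
      by (simp add: Grassmann_ops scal_simps)
    then show ?thesis by (simp add: scal_simps)
  qed (simp add: scal_simps)
  then have "(\<Sum>\<alpha>\<in>?S. scal (a \<alpha>) (skew_deriv j (xmon \<alpha> \<star> b))) =
      (\<Sum>\<alpha>\<in>?S. scal (a \<alpha>) (skew_deriv j (xmon \<alpha>) \<star> b)) -
      (\<Sum>\<alpha>\<in>?S. scal (a \<alpha>) (xmon \<alpha> \<star> skew_deriv j b))"
    by (simp add: sum_subtractf)
  then have "skew_deriv j ((\<Sum>\<alpha>\<in>?S. scal (a \<alpha>) (xmon \<alpha>)) \<star> b) =
      skew_deriv j (\<Sum>\<alpha>\<in>?S. scal (a \<alpha>) (xmon \<alpha>)) \<star> b -
      (\<Sum>\<alpha>\<in>?S. scal (a \<alpha>) (xmon \<alpha>)) \<star> skew_deriv j b"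
    by (simp add: gmul_sum_left gmul_scal_left skew_deriv_sum skew_deriv_scal)
  then show ?thesis using ex by simp
qed

lemma skew_deriv_lower_degree:
  assumes "a \<in> mono_span n P" "\<And>\<beta>. j \<notin> \<beta> \<Longrightarrow> insert j \<beta> \<subseteq> {1..n} \<Longrightarrow> P (insert j \<beta>) \<Longrightarrow> Q \<beta>"
  shows "skew_deriv j a \<in> mono_span n Q"
  unfolding mono_span_iff
proof (intro allI impI)
  fix \<beta> assume "skew_deriv j a \<beta> \<noteq> 0"
  then have "j \<notin> \<beta>" "a (insert j \<beta>) \<noteq> 0" by (auto simp: skew_deriv_def split: if_splits)
  then have "j \<notin> \<beta>" "insert j \<beta> \<subseteq> {1..n}" "P (insert j \<beta>)"
    using assms(1) unfolding mono_span_iff by blast+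
  then show "\<beta> \<subseteq> {1..n} \<and> Q \<beta>" using assms(2) by blast
qed

lemma skew_deriv_odd:
  "a \<in> mono_span n (\<lambda>\<alpha>. odd (card \<alpha>)) \<Longrightarrow> skew_deriv j a \<in> mono_span n (\<lambda>\<alpha>. even (card \<alpha>))"
proof (erule skew_deriv_lower_degree)
  fix \<beta>
  assume "j \<notin> \<beta>" "insert j \<beta> \<subseteq> {1..n}" "odd (card (insert j \<beta>))"
  then show "even (card \<beta>)" using finite_index_set[of "insert j \<beta>" n] by simp
qed

lemma even_ext_parity:
  "even_ext e \<alpha> \<gamma> \<Longrightarrow> \<gamma> \<subseteq> {1..n::nat} \<Longrightarrow> even (card \<gamma>) \<longleftrightarrow> even (card \<alpha>)"
  by (metis even_add even_ext_card even_ext_def finite_index_set)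

context unip_endo
begin

lemma xgen_odd: "i \<in> {1..n} \<Longrightarrow> \<sigma> (xgen i) \<in> mono_span n (\<lambda>\<alpha>. odd (card \<alpha>))"
  by (rule in_mono_span) (auto simp: xgen_def even_ext_parity intro: xmon_in_mono_span)

lemma skew_deriv_xgen_even:
  "i \<in> {1..n} \<Longrightarrow> skew_deriv j (\<sigma> (xgen i)) \<in> mono_span n (\<lambda>\<alpha>. even (card \<alpha>))"
  by (rule skew_deriv_odd[OF xgen_odd])

lemma skew_deriv_xgen_central:
  "i \<in> {1..n} \<Longrightarrow> skew_deriv j (\<sigma> (xgen i)) \<star> b = b \<star> skew_deriv j (\<sigma> (xgen i))"
  by (rule even_central) (use skew_deriv_xgen_even[of i j] in \<open>auto simp: mono_span_iff\<close>)

text \<open>Prefix a generator x_i and apply the skew Leibniz rule on both sides. The term k = i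
  gains the derivative of \<sigma>(x_i); in all terms \<sigma>(x_i) has to come to the front, which
  is possible because the derivatives of the \<sigma>(x_k) are even.\<close>

lemma chain_rule_xmon:
  assumes "\<alpha> \<subseteq> {1..n}"
  shows "skew_deriv j (\<sigma> (xmon \<alpha>)) =
    (\<Sum>k\<in>{1..n}. skew_deriv j (\<sigma> (xgen k)) \<star> \<sigma> (skew_deriv k (xmon \<alpha>)))"
proof -
  have "finite \<alpha>" using assms by (rule finite_index_set)
  then show ?thesis using assms
  proof (induction \<alpha> rule: finite_linorder_min_induct)
    case empty
    have "skew_deriv k (xmon {}) = (0 :: nat set \<Rightarrow> 'k)" for k
      by (auto simp: skew_deriv_def xmon_def fun_eq_iff fun_apply)
    then show ?case by (simp add: one zero)
  next
    case (insert i \<beta>)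
    have i: "i \<in> {1..n}" and \<beta>: "\<beta> \<subseteq> {1..n}" using insert by auto
    let ?J = "\<lambda>k. skew_deriv j (\<sigma> (xgen k))"
    let ?d = "\<lambda>k. skew_deriv k (xmon \<beta>)"
    have IH: "skew_deriv j (\<sigma> (xmon \<beta>)) = (\<Sum>k\<in>{1..n}. ?J k \<star> \<sigma> (?d k))"
      by (rule insert.IH) (rule \<beta>)
    have xi: "xmon (insert i \<beta>) = xgen i \<star> xmon \<beta>"
      by (rule xmon_insert') (use insert in auto)
    have xb: "xmon \<beta> \<in> gcar n" using \<beta> by (rule xmon_carrier)
    have one_i: "xgen i \<in> mono_span n (\<lambda>\<alpha>. odd (card \<alpha>))"
      unfolding xgen_def using i by (intro xmon_in_mono_span) auto
    have d: "\<sigma> (skew_deriv k (xgen i \<star> xmon \<beta>)) =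
        (if k = i then \<sigma> (xmon \<beta>) else 0) - \<sigma> (xgen i) \<star> \<sigma> (?d k)" for k
    proof -
      have dk: "skew_deriv k (xgen i \<star> xmon \<beta>) = (if k = i then xmon \<beta> else 0) - xgen i \<star> ?d k"
        by (simp add: skew_deriv_odd_mult[OF one_i] skew_deriv_generator gmul_one[OF xb])
      have c: "xgen i \<in> gcar n" "?d k \<in> gcar n"
        using i xb by (auto intro: xgen_carrier skew_deriv_gcar)
      have "\<sigma> (xmon \<beta> - xgen i \<star> ?d k) = \<sigma> (xmon \<beta>) - \<sigma> (xgen i) \<star> \<sigma> (?d k)"
        "\<sigma> (- (xgen i \<star> ?d k)) = - (\<sigma> (xgen i) \<star> \<sigma> (?d k))"
        by (simp_all add: diff[OF xb gcar_gmul[OF c]] minus[OF gcar_gmul[OF c]] mult[OF c])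
      then show ?thesis unfolding dk by (cases "k = i") simp_all
    qed
    have "(\<Sum>k\<in>{1..n}. ?J k \<star> \<sigma> (skew_deriv k (xgen i \<star> xmon \<beta>))) =
        (\<Sum>k\<in>{1..n}. ?J k \<star> (if k = i then \<sigma> (xmon \<beta>) else 0)) -
        (\<Sum>k\<in>{1..n}. ?J k \<star> (\<sigma> (xgen i) \<star> \<sigma> (?d k)))"
      by (simp only: d gmul_diff_right sum_subtractf)
    also have "(\<Sum>k\<in>{1..n}. ?J k \<star> (if k = i then \<sigma> (xmon \<beta>) else 0)) =
        (\<Sum>k\<in>{1..n}. if k = i then ?J i \<star> \<sigma> (xmon \<beta>) else 0)"
      by (rule sum.cong) auto
    also have "\<dots> = ?J i \<star> \<sigma> (xmon \<beta>)" using i by simp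
    \<comment> \<open>Here centrality of the Jacobian entries is used.\<close>
    also have "(\<Sum>k\<in>{1..n}. ?J k \<star> (\<sigma> (xgen i) \<star> \<sigma> (?d k))) =
        \<sigma> (xgen i) \<star> (\<Sum>k\<in>{1..n}. ?J k \<star> \<sigma> (?d k))"
      unfolding gmul_sum_right
      by (intro sum.cong refl)
        (simp add: skew_deriv_xgen_central[of _ j "\<sigma> (xgen i)"] flip: gmul_assoc)
    also have "(\<Sum>k\<in>{1..n}. ?J k \<star> \<sigma> (?d k)) = skew_deriv j (\<sigma> (xmon \<beta>))"
      by (rule IH[symmetric])
    also have "?J i \<star> \<sigma> (xmon \<beta>) - \<sigma> (xgen i) \<star> skew_deriv j (\<sigma> (xmon \<beta>)) =
        skew_deriv j (\<sigma> (xgen i \<star> xmon \<beta>))"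
      by (simp add: mult[OF xgen_carrier[OF i] xb] skew_deriv_odd_mult[OF xgen_odd[OF i]])
    finally show ?case by (simp only: xi)
  qed
qed

lemma chain_rule:
  assumes a: "a \<in> gcar n"
  shows "skew_deriv j (\<sigma> a) = (\<Sum>k\<in>{1..n}. skew_deriv j (\<sigma> (xgen k)) \<star> \<sigma> (skew_deriv k a))"
proof -
  let ?S = "Pow {1..n}" and ?J = "\<lambda>k. skew_deriv j (\<sigma> (xgen k))"
  have d: "\<sigma> (skew_deriv k a) = (\<Sum>\<alpha>\<in>?S. scal (a \<alpha>) (\<sigma> (skew_deriv k (xmon \<alpha>))))" for k
  proof -
    have "skew_deriv k a = (\<Sum>\<alpha>\<in>?S. scal (a \<alpha>) (skew_deriv k (xmon \<alpha>)))"
      using arg_cong[OF monomial_expansion[OF a], of "skew_deriv k"]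
      by (simp only: skew_deriv_sum skew_deriv_scal)
    then have "\<sigma> (skew_deriv k a) = \<sigma> (\<Sum>\<alpha>\<in>?S. scal (a \<alpha>) (skew_deriv k (xmon \<alpha>)))"
      by simp
    also have "\<dots> = (\<Sum>\<alpha>\<in>?S. scal (a \<alpha>) (\<sigma> (skew_deriv k (xmon \<alpha>))))"
      by (subst sum) (auto simp: scal xmon_carrier gcar_closed skew_deriv_gcar intro!: sum.cong)
    finally show ?thesis .
  qed
  have "skew_deriv j (\<sigma> a) = (\<Sum>\<alpha>\<in>?S. scal (a \<alpha>) (skew_deriv j (\<sigma> (xmon \<alpha>))))"
    by (simp add: expansion[OF a] skew_deriv_sum skew_deriv_scal)
  also have "\<dots> = (\<Sum>\<alpha>\<in>?S. \<Sum>k\<in>{1..n}. scal (a \<alpha>) (?J k \<star> \<sigma> (skew_deriv k (xmon \<alpha>))))"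
    by (intro sum.cong refl) (simp add: chain_rule_xmon scal_sum)
  also have "\<dots> = (\<Sum>k\<in>{1..n}. \<Sum>\<alpha>\<in>?S. scal (a \<alpha>) (?J k \<star> \<sigma> (skew_deriv k (xmon \<alpha>))))"
    by (rule sum.swap)
  also have "\<dots> = (\<Sum>k\<in>{1..n}. ?J k \<star> \<sigma> (skew_deriv k a))"
    by (simp add: d gmul_sum_right gmul_scal_right)
  finally show ?thesis .
qed

end

section \<open>The Jacobian as a determinant over the commutative even part\<close>

definition jacobian ::
    "((nat set \<Rightarrow> 'k::comm_ring_1) \<Rightarrow> nat set \<Rightarrow> 'k) \<Rightarrow> nat \<Rightarrow> nat \<Rightarrow> 'k ev" where
  "jacobian \<sigma> i j = Abs_ev (skew_deriv j (\<sigma> (xgen i)))"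

text \<open>\<sigma>(x_i) is odd and a skew derivation lowers the degree by one, so the entry is
  even and \<open>Abs_ev\<close> loses nothing.\<close>

lemma rep_jacobian:
  assumes "\<sigma> \<in> unip_group n e" "i \<in> {1..n}"
  shows "rep_ev (jacobian \<sigma> i j) = skew_deriv j (\<sigma> (xgen i))"
proof -
  interpret unip_endo n \<sigma> e using assms by (simp add: unip_group_D)
  show ?thesis unfolding jacobian_def
    using skew_deriv_xgen_even[OF assms(2), of j] unfolding mono_span_iff
    by (intro rep_Abs_ev) (blast intro: finite_index_set)
qed

lemma rep_jacobian_carrier:
  assumes "\<sigma> \<in> unip_group n e" "i \<in> {1..n}"
  shows "rep_ev (jacobian \<sigma> i j) \<in> gcar n"
proof -
  interpret unip_endo n \<sigma> e using assms by (simp add: unip_group_D)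
  show ?thesis using assms by (simp add: rep_jacobian skew_deriv_gcar closed xgen_carrier)
qed

lemma of_int_sign_mult: "of_int (sign p) * x = (if sign p = 1 then x else - (x :: 'a::ring_1))"
  by (cases p rule: sign_cases) simp_all

lemma rep_ev_sign: "rep_ev (of_int (sign p) * x) = scal (of_int (sign p)) (rep_ev x)"
  by (cases p rule: sign_cases) (simp_all add: rep_ev_simps scal_simps)

lemma rep_ev_foldr:
  "(\<And>i. i \<in> set xs \<Longrightarrow> f i = rep_ev (m i)) \<Longrightarrow>
    foldr (\<lambda>i a. f i \<star> a) xs (xmon {}) = rep_ev (prod_list (map m xs))"
  by (induction xs) (simp_all add: rep_ev_simps)

lemma Grassmann_det_eq:
  fixes M :: "nat \<Rightarrow> nat \<Rightarrow> 'k::comm_ring_1 ev"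
  assumes "\<And>i j. i \<in> {1..n} \<Longrightarrow> j \<in> {1..n} \<Longrightarrow> f i j = rep_ev (M i j)"
    and "\<And>i j. i \<in> {1..n} \<Longrightarrow> j \<in> {1..n} \<Longrightarrow> rep_ev (M i j) \<in> gcar n"
  shows "Grassmann_det n f = rep_ev (leibniz_det n M)"
proof -
  have t: "of_int (sign p) \<odot>\<^bsub>Grassmann n\<^esub>
      foldr (\<lambda>i a. f i (p i) \<otimes>\<^bsub>Grassmann n\<^esub> a) [1..<Suc n] \<one>\<^bsub>Grassmann n\<^esub> =
      rep_ev (of_int (sign p) * (\<Prod>i\<in>{1..n}. M i (p i)))"
    and c: "rep_ev (of_int (sign p) * (\<Prod>i\<in>{1..n}. M i (p i))) \<in> gcar n"
    if p: "p permutes {1..n}" for p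
  proof -
    have pi: "p i \<in> {1..n}" if "i \<in> {1..n}" for i using that permutes_in_image[OF p] by simp
    have "foldr (\<lambda>i a. f i (p i) \<star> a) [1..<Suc n] (xmon {}) =
        rep_ev (prod_list (map (\<lambda>i. M i (p i)) [1..<Suc n]))"
      by (rule rep_ev_foldr) (use pi assms in auto)
    also have "prod_list (map (\<lambda>i. M i (p i)) [1..<Suc n]) = (\<Prod>i\<in>{1..n}. M i (p i))"
      by (subst prod.distinct_set_conv_list[symmetric])
        (simp_all only: set_upt distinct_upt atLeastLessThanSuc_atLeastAtMost)
    finally show "of_int (sign p) \<odot>\<^bsub>Grassmann n\<^esub>
      foldr (\<lambda>i a. f i (p i) \<otimes>\<^bsub>Grassmann n\<^esub> a) [1..<Suc n] \<one>\<^bsub>Grassmann n\<^esub> =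
      rep_ev (of_int (sign p) * (\<Prod>i\<in>{1..n}. M i (p i)))"
      by (simp only: Grassmann_ops rep_ev_sign)
    show "rep_ev (of_int (sign p) * (\<Prod>i\<in>{1..n}. M i (p i))) \<in> gcar n"
      unfolding rep_ev_sign by (intro gcar_closed prod_ev_carrier assms pi)
  qed
  have "Grassmann_det n f =
      (\<Oplus>\<^bsub>Grassmann n\<^esub>p\<in>{p. p permutes {1..n}}. rep_ev (of_int (sign p) * (\<Prod>i\<in>{1..n}. M i (p i))))"
    unfolding Grassmann_det_def
  proof (rule abelian_monoid.finsum_cong')
    show "abelian_monoid (Grassmann n :: ('k, nat set \<Rightarrow> 'k) module)"
      using ring_Grassmann by (auto simp: ring_def abelian_group_def)
  qed (use t c in auto)
  also have "\<dots> = rep_ev (leibniz_det n M)"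
    unfolding leibniz_det_def rep_ev_sum by (rule finsum_Grassmann) (use c in auto)
  finally show ?thesis .
qed

lemma Jac_eq:
  assumes "\<sigma> \<in> unip_group n e"
  shows "Jac n \<sigma> = rep_ev (leibniz_det n (jacobian \<sigma>))"
  unfolding Jac_def
  by (rule Grassmann_det_eq)
    (simp_all add: rep_jacobian[OF assms, symmetric] rep_jacobian_carrier[OF assms])

text \<open>A determinant is polynomial in its entries. Since \<sigma> acts on coefficient functions
  and not on the type \<open>ev\<close>, its effect is described by a second matrix
  \<open>N\<close>.\<close>

lemma (in alg_endo) apply_leibniz_det:
  assumes M: "\<And>i j. i \<in> {1..n} \<Longrightarrow> j \<in> {1..n} \<Longrightarrow> rep_ev (M i j) \<in> gcar n"
    and N: "\<And>i j. i \<in> {1..n} \<Longrightarrow> j \<in> {1..n} \<Longrightarrow> \<sigma> (rep_ev (M i j)) = rep_ev (N i j)"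
  shows "rep_ev (leibniz_det n M) \<in> gcar n"
    "\<sigma> (rep_ev (leibniz_det n M)) = rep_ev (leibniz_det n N)"
proof -
  have pr: "rep_ev (prod f A) \<in> gcar n \<and> \<sigma> (rep_ev (prod f A)) = rep_ev (prod g A)"
    if "\<And>i. i \<in> A \<Longrightarrow> rep_ev (f i) \<in> gcar n \<and> \<sigma> (rep_ev (f i)) = rep_ev (g i)"
    for f g :: "nat \<Rightarrow> 'k ev" and A :: "nat set"
    using that
    by (induction A rule: infinite_finite_induct)
      (auto simp: rep_ev_simps one xmon_carrier gcar_gmul mult)
  have t: "rep_ev (of_int (sign p) * (\<Prod>i\<in>{1..n}. M i (p i))) \<in> gcar n \<and>
      \<sigma> (rep_ev (of_int (sign p) * (\<Prod>i\<in>{1..n}. M i (p i)))) =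
      rep_ev (of_int (sign p) * (\<Prod>i\<in>{1..n}. N i (p i)))"
    if p: "p permutes {1..n}" for p
  proof -
    have "p i \<in> {1..n}" if "i \<in> {1..n}" for i using that permutes_in_image[OF p] by simp
    then have "rep_ev (\<Prod>i\<in>{1..n}. M i (p i)) \<in> gcar n \<and>
        \<sigma> (rep_ev (\<Prod>i\<in>{1..n}. M i (p i))) = rep_ev (\<Prod>i\<in>{1..n}. N i (p i))"
      by (intro pr) (simp add: M N)
    then show ?thesis unfolding rep_ev_sign by (simp add: gcar_closed scal)
  qed
  show "rep_ev (leibniz_det n M) \<in> gcar n"
    unfolding leibniz_det_def rep_ev_sum by (rule gcar_sum) (use t in blast)
  show "\<sigma> (rep_ev (leibniz_det n M)) = rep_ev (leibniz_det n N)"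
    unfolding leibniz_det_def rep_ev_sum
    by (subst sum) (use t in \<open>auto intro!: sum.cong\<close>)
qed

lemma Jac_carrier:
  assumes "\<sigma> \<in> unip_group n e"
  shows "Jac n \<sigma> \<in> gcar n"
proof -
  \<comment> \<open>Membership in the carrier is the first conclusion of
    \<open>apply_leibniz_det\<close>, which does not mention the endomorphism; the identity
    serves.\<close>
  have "alg_endo n (\<lambda>a. a)" by standard auto
  then show ?thesis
    unfolding Jac_eq[OF assms]
      by (rule alg_endo.apply_leibniz_det) (auto simp: rep_jacobian_carrier[OF assms])
qed

lemma Jac_mult:
  assumes s: "\<sigma> \<in> unip_group n e" and t: "\<tau> \<in> unip_group n e" and e: "1 \<le> e"
  shows "Jac n (\<sigma> \<otimes>\<^bsub>BijGroup (gcar n)\<^esub> \<tau>) = \<sigma> (Jac n \<tau>) \<star> Jac n \<sigma>"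
proof -
  let ?st = "\<sigma> \<otimes>\<^bsub>BijGroup (gcar n)\<^esub> \<tau>"
  interpret s: unip_endo n \<sigma> e using s by (rule unip_group_D)
  interpret t: unip_endo n \<tau> e using t by (rule unip_group_D)
  interpret U: subgroup "unip_group n e" "BijGroup (gcar n)" by (rule subgroup_unip_group[OF e])
  have st: "?st \<in> unip_group n e" using s t by (rule U.m_closed)
  \<comment> \<open>The Jacobian matrix of \<tau> with \<sigma> applied to its entries, which stay
    even. In the chain rule for \<sigma> \<tau> it is the left factor.\<close>
  define N where "N i j = Abs_ev (\<sigma> (rep_ev (jacobian \<tau> i j)))" for i j
  have N: "rep_ev (N i j) = \<sigma> (rep_ev (jacobian \<tau> i j))" if i: "i \<in> {1..n}" for i j
  proof -
    have "rep_ev (jacobian \<tau> i j) \<in> mono_span n (\<lambda>\<alpha>. even (card \<alpha>))"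
      using i t.skew_deriv_xgen_even[OF i] by (simp add: rep_jacobian[OF t])
    then have "\<sigma> (rep_ev (jacobian \<tau> i j)) \<in> mono_span n (\<lambda>\<alpha>. even (card \<alpha>))"
      by (rule s.in_mono_span) (simp add: even_ext_parity)
    then show ?thesis unfolding N_def mono_span_iff
      by (intro rep_Abs_ev) (blast intro: finite_index_set)
  qed
  have J: "jacobian ?st i j = (\<Sum>k\<in>{1..n}. N i k * jacobian \<sigma> k j)" if i: "i \<in> {1..n}" for i j
    unfolding rep_ev_inject[symmetric] rep_ev_sum rep_jacobian[OF st i] rep_ev_simps N[OF i]
  proof -
    have "skew_deriv j (?st (xgen i)) = skew_deriv j (\<sigma> (\<tau> (xgen i)))"
      using i by (simp add: Bij_mult_apply[OF unip_group_D(1)[OF s] unip_group_D(1)[OF t]] xgen_carrier)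
    also have "\<dots> = (\<Sum>k\<in>{1..n}. skew_deriv j (\<sigma> (xgen k)) \<star> \<sigma> (skew_deriv k (\<tau> (xgen i))))"
      using i by (intro s.chain_rule t.closed xgen_carrier)
    also have "\<dots> = (\<Sum>k\<in>{1..n}. \<sigma> (rep_ev (jacobian \<tau> i k)) \<star> rep_ev (jacobian \<sigma> k j))"
      using i by (intro sum.cong refl)
        (simp add: rep_jacobian[OF s] rep_jacobian[OF t] s.skew_deriv_xgen_central)
    finally show "skew_deriv j (?st (xgen i)) = \<dots>" .
  qed
  have "leibniz_det n (jacobian ?st) = leibniz_det n (\<lambda>i j. \<Sum>k\<in>{1..n}. N i k * jacobian \<sigma> k j)"
    unfolding leibniz_det_def by (intro sum.cong arg_cong2[where f = "(*)"] prod.cong refl) (rule J)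
  also have "\<dots> = leibniz_det n N * leibniz_det n (jacobian \<sigma>)"
    by (rule leibniz_det_mult)
  finally have "Jac n ?st = rep_ev (leibniz_det n N) \<star> Jac n \<sigma>"
    by (simp add: Jac_eq[OF st] Jac_eq[OF s] rep_ev_simps)
  also have "rep_ev (leibniz_det n N) = \<sigma> (Jac n \<tau>)"
    unfolding Jac_eq[OF t]
    by (rule s.apply_leibniz_det(2)[symmetric]) (simp_all add: N rep_jacobian_carrier[OF t])
  finally show ?thesis .
qed

section \<open>Automorphisms of Jacobian one\<close>

definition unimod_group :: "nat \<Rightarrow> nat \<Rightarrow> ((nat set \<Rightarrow> 'k::comm_ring_1) \<Rightarrow> nat set \<Rightarrow> 'k) set" where
  "unimod_group n e = {\<sigma> \<in> unip_group n e. Jac n \<sigma> = xmon {}}"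

lemma Sigma'_pow_eq:
  assumes "2 \<le> e" "m = Suc e"
  shows "Sigma'_pow n m = unimod_group n e"
  using Phi_pow_eq[OF assms, of n]
  by (auto simp: Sigma'_pow_def Sigma'_def unimod_group_def Grassmann_ops Phi_pow_def)

text \<open>Formulated through permutations because the matrix need not be diagonal: the Jacobian
  matrix of \<open>rho\<close> may have nonzero entries in the columns belonging to
  \<alpha>.\<close>

lemma leibniz_det_diagonal:
  assumes "\<And>p. p permutes {1..n} \<Longrightarrow> p \<noteq> id \<Longrightarrow> \<exists>i\<in>{1..n}. M i (p i) = 0"
  shows "leibniz_det n M = (\<Prod>i\<in>{1..n}. M i i)"
proof -
  have "of_int (sign p) * (\<Prod>i\<in>{1..n}. M i (p i)) = (if p = id then \<Prod>i\<in>{1..n}. M i i else 0)"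
    if p: "p permutes {1..n}" for p
  proof (cases "p = id")
    case False
    then have "(\<Prod>i\<in>{1..n}. M i (p i)) = 0" using assms[OF p] by (intro prod_zero) auto
    then show ?thesis using False by simp
  qed simp
  then have "leibniz_det n M = (\<Sum>p | p permutes {1..n}. if p = id then \<Prod>i\<in>{1..n}. M i i else 0)"
    unfolding leibniz_det_def by (intro sum.cong) auto
  also have "\<dots> = (\<Prod>i\<in>{1..n}. M i i)" by (simp add: finite_permutations permutes_id)
  finally show ?thesis .
qed

lemma leibniz_det_one:
  assumes "\<And>i j. i \<in> {1..n} \<Longrightarrow> j \<in> {1..n} \<Longrightarrow> M i j = of_bool (i = j)"
  shows "leibniz_det n M = (1 :: 'a::comm_ring_1)"
proof (subst leibniz_det_diagonal)
  fix p assume p: "p permutes {1..n}" "p \<noteq> id"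
  then obtain i where i: "p i \<noteq> i" by (auto simp: fun_eq_iff)
  then have "i \<in> {1..n}" using permutes_not_in[OF p(1)] by blast
  moreover have "p i \<in> {1..n}" using permutes_in_image[OF p(1)] calculation by simp
  ultimately show "\<exists>i\<in>{1..n}. M i (p i) = 0"
    using i by (intro bexI[of _ i]) (simp_all add: assms)
qed (simp add: assms)

lemma Jac_one:
  fixes e :: nat
  assumes "1 \<le> e"
  shows "Jac n (\<one>\<^bsub>BijGroup (gcar n)\<^esub>) = (xmon {} :: nat set \<Rightarrow> 'k::comm_ring_1)"
proof -
  interpret U: subgroup "unip_group n e" "BijGroup (gcar n :: (nat set \<Rightarrow> 'k) set)"
    by (rule subgroup_unip_group[OF assms])
  have "\<one>\<^bsub>BijGroup (gcar n)\<^esub> a = a" if "a \<in> gcar n" for a :: "nat set \<Rightarrow> 'k"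
    using that by (simp add: BijGroup_def)
  then have "rep_ev (jacobian \<one>\<^bsub>BijGroup (gcar n)\<^esub> i j) = rep_ev (of_bool (i = j) :: 'k ev)"
    if "i \<in> {1..n}" for i j
    using that by
      (simp add: rep_jacobian[OF U.one_closed] xgen_carrier skew_deriv_generator rep_ev_simps)
  then show ?thesis
    unfolding Jac_eq[OF U.one_closed] rep_ev_inject
      by (subst leibniz_det_one) (auto simp: rep_ev_simps)
qed

lemma subgroup_unimod_group:
  assumes e: "1 \<le> e"
  shows "subgroup (unimod_group n e) (BijGroup (gcar n))"
proof -
  interpret group "BijGroup (gcar n)" by (rule group_BijGroup)
  interpret U: subgroup "unip_group n e" "BijGroup (gcar n)" by (rule subgroup_unip_group[OF e])
  show ?thesis
  proof
    show "unimod_group n e \<subseteq> carrier (BijGroup (gcar n))"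
      using U.subset by (auto simp: unimod_group_def)
    show "\<one>\<^bsub>BijGroup (gcar n)\<^esub> \<in> unimod_group n e"
      by (simp add: unimod_group_def U.one_closed Jac_one[OF e])
  next
    fix \<sigma> \<tau> :: "(nat set \<Rightarrow> 'a) \<Rightarrow> nat set \<Rightarrow> 'a"
    assume "\<sigma> \<in> unimod_group n e" "\<tau> \<in> unimod_group n e"
    then have u: "\<sigma> \<in> unip_group n e" "\<tau> \<in> unip_group n e"
      and j: "Jac n \<sigma> = xmon {}" "Jac n \<tau> = xmon {}"
      by (auto simp: unimod_group_def)
    interpret s: alg_endo n \<sigma> using u(1) by (rule unip_group_D)
    have "xmon {} \<star> xmon {} = (xmon {} :: nat set \<Rightarrow> 'a)"
      by (rule gmul_one[OF xmon_carrier[of _ n]]) simp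
    then show "\<sigma> \<otimes>\<^bsub>BijGroup (gcar n)\<^esub> \<tau> \<in> unimod_group n e"
      using u j by (simp add: unimod_group_def U.m_closed Jac_mult[OF u e] s.one)
  next
    fix \<sigma> :: "(nat set \<Rightarrow> 'a) \<Rightarrow> nat set \<Rightarrow> 'a"
    assume "\<sigma> \<in> unimod_group n e"
    then have u: "\<sigma> \<in> unip_group n e" and j: "Jac n \<sigma> = xmon {}" by (auto simp: unimod_group_def)
    let ?i = "inv\<^bsub>BijGroup (gcar n)\<^esub> \<sigma>"
    have i: "?i \<in> unip_group n e" using u by (rule U.m_inv_closed)
    interpret i: alg_endo n ?i using i by (rule unip_group_D)
    have "xmon {} = Jac n (?i \<otimes>\<^bsub>BijGroup (gcar n)\<^esub> \<sigma>)"
      using u U.subset by (subst l_inv) (auto simp: Jac_one[OF e])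
    also have "\<dots> = ?i (Jac n \<sigma>) \<star> Jac n ?i" by (rule Jac_mult[OF i u e])
    also have "\<dots> = Jac n ?i" by (simp add: j i.one gmul_one[OF Jac_carrier[OF i]])
    finally show "?i \<in> unimod_group n e" using i by (simp add: unimod_group_def)
  qed
qed

text \<open>Modulo degree \<open>2e\<close>, the determinant of \<open>1 + U\<close> with \<open>U\<close> of degree at least \<open>e\<close> is
  \<open>1 + tr U\<close>.\<close>

definition ev_deg :: "nat \<Rightarrow> nat \<Rightarrow> 'k::comm_ring_1 ev \<Rightarrow> bool" where
  "ev_deg n d x \<longleftrightarrow> rep_ev x \<in> mono_span n (\<lambda>\<alpha>. d \<le> card \<alpha>)"

lemma ev_deg_add: "ev_deg n d x \<Longrightarrow> ev_deg n d y \<Longrightarrow> ev_deg n d (x + y)"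
  and ev_deg_diff: "ev_deg n d x \<Longrightarrow> ev_deg n d y \<Longrightarrow> ev_deg n d (x - y)"
  and ev_deg_zero: "ev_deg n d 0"
  by (simp_all add: ev_deg_def rep_ev_simps mono_span_closed)

lemma ev_deg_mono: "ev_deg n d x \<Longrightarrow> d' \<le> d \<Longrightarrow> ev_deg n d' x"
  unfolding ev_deg_def by (erule mono_span_mono) simp

lemma ev_deg_sum: "(\<And>i. i \<in> A \<Longrightarrow> ev_deg n d (f i)) \<Longrightarrow> ev_deg n d (sum f A)"
  by (induction A rule: infinite_finite_induct) (simp_all add: ev_deg_add ev_deg_zero)

lemma ev_deg_mult:
  assumes "ev_deg n d x" "ev_deg n d' y"
  shows "ev_deg n (d + d') (x * y)"
  unfolding ev_deg_def rep_ev_simps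
proof (rule gmul_mono_span[OF assms[unfolded ev_deg_def]])
  fix \<alpha> \<beta> :: "nat set"
  assume "\<alpha> \<subseteq> {1..n}" "\<beta> \<subseteq> {1..n}" "\<alpha> \<inter> \<beta> = {}" "d \<le> card \<alpha>" "d' \<le> card \<beta>"
  then show "d + d' \<le> card (\<alpha> \<union> \<beta>)"
    by (subst card_Un_disjoint) (simp_all add: finite_index_set)
qed

lemma ev_deg_one: "ev_deg n 0 1"
  unfolding ev_deg_def rep_ev_simps by (rule xmon_in_mono_span) auto

lemma ev_deg_prod: "(\<And>i. i \<in> A \<Longrightarrow> ev_deg n 0 (f i)) \<Longrightarrow> ev_deg n 0 (prod f A)"
proof (induction A rule: infinite_finite_induct)
  case (insert x F)
  then show ?case using ev_deg_mult[of n 0 "f x" 0 "prod f F"] by simp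
qed (simp_all add: ev_deg_one)

text \<open>Any product of two of the \<open>u i\<close> has degree at least 2e, so only the linear
  part of the expanded product survives.\<close>

lemma prod_one_plus_deg:
  assumes "finite A" "\<And>i. i \<in> A \<Longrightarrow> ev_deg n e (u i)"
  shows "ev_deg n (2 * e) ((\<Prod>i\<in>A. 1 + u i) - (1 + (\<Sum>i\<in>A. u i)))"
  using assms
proof (induction A)
  case (insert x F)
  let ?P = "\<Prod>i\<in>F. 1 + u i" and ?S = "\<Sum>i\<in>F. u i"
  have IH: "ev_deg n (2 * e) (?P - (1 + ?S))" using insert by simp
  have u: "ev_deg n e (u x)" and S: "ev_deg n e ?S" using insert by (auto intro: ev_deg_sum)
  have "(1 + u x) * ?P - (1 + (u x + ?S)) = (1 + u x) * (?P - (1 + ?S)) + u x * ?S"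
    by (simp add: algebra_simps)
  moreover have "ev_deg n (0 + 2 * e) ((1 + u x) * (?P - (1 + ?S)))"
    by (intro ev_deg_mult IH ev_deg_add ev_deg_one ev_deg_mono[OF u]) simp
  moreover have "ev_deg n (2 * e) (u x * ?S)"
    using ev_deg_mult[OF u S] by (simp add: mult_2)
  ultimately show ?case using insert(1,2) by (simp add: ev_deg_add)
qed (simp add: ev_deg_zero)

text \<open>A permutation other than the identity moves at least two indices, and each contributes
  an off-diagonal entry of degree at least e. The identity is covered by
  \<open>prod_one_plus_deg\<close>.\<close>

lemma leibniz_det_deg:
  assumes M: "\<And>i j. i \<in> {1..n} \<Longrightarrow> j \<in> {1..n} \<Longrightarrow> ev_deg n e (M i j - of_bool (i = j))"
  shows "ev_deg n (2 * e) (leibniz_det n M - (1 + (\<Sum>i\<in>{1..n}. M i i - 1)))"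
proof -
  let ?t = "\<lambda>p. of_int (sign p) * (\<Prod>i\<in>{1..n}. M i (p i))"
  have M0: "ev_deg n 0 (M i j)" if "i \<in> {1..n}" "j \<in> {1..n}" for i j
  proof -
    have "ev_deg n 0 ((M i j - of_bool (i = j)) + of_bool (i = j))"
      by (intro ev_deg_add ev_deg_mono[OF M[OF that]])
        (auto simp: ev_deg_one ev_deg_zero of_bool_def)
    then show ?thesis by simp
  qed
  have t: "ev_deg n (2 * e) (?t p)" if p: "p permutes {1..n}" "p \<noteq> id" for p
  proof -
    have pi: "p i \<in> {1..n}" if "i \<in> {1..n}" for i using that permutes_in_image[OF p(1)] by simp
    obtain i where i: "p i \<noteq> i" using p(2) by (auto simp: fun_eq_iff)
    then have i_in: "i \<in> {1..n}" using permutes_not_in[OF p(1)] by blast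
    \<comment> \<open>The second moved index: p k = k would contradict injectivity.\<close>
    define k where "k = p i"
    have k: "p k \<noteq> k" "k \<noteq> i" and k_in: "k \<in> {1..n}"
      using i pi[OF i_in] permutes_inj[OF p(1)] by (auto simp: k_def dest: injD)
    have off: "ev_deg n e (M l (p l))" if "p l \<noteq> l" "l \<in> {1..n}" for l
      using M[OF that(2) pi[OF that(2)]] that(1) by simp
    have "ev_deg n (e + (e + 0))
        (M i (p i) * (M k (p k) * (\<Prod>l\<in>{1..n} - {i} - {k}. M l (p l))))"
      by (intro ev_deg_mult ev_deg_prod off i k i_in k_in M0 pi) auto
    also have "M k (p k) * (\<Prod>l\<in>{1..n} - {i} - {k}. M l (p l)) = (\<Prod>l\<in>{1..n} - {i}. M l (p l))"
      by (rule prod.remove[symmetric]) (use k_in k(2) in auto)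
    also have "M i (p i) * (\<Prod>l\<in>{1..n} - {i}. M l (p l)) = (\<Prod>l\<in>{1..n}. M l (p l))"
      by (rule prod.remove[symmetric]) (use i_in in auto)
    finally have d: "ev_deg n (2 * e) (\<Prod>l\<in>{1..n}. M l (p l))" by (simp add: mult_2)
    then show ?thesis
      unfolding of_int_sign_mult using ev_deg_diff[OF ev_deg_zero d] by simp
  qed
  have fin: "finite {p. p permutes {1..n}}" by (simp add: finite_permutations)
  have "leibniz_det n M = ?t id + (\<Sum>p\<in>{p. p permutes {1..n}} - {id}. ?t p)"
    unfolding leibniz_det_def by (rule sum.remove[OF fin]) (simp add: permutes_id)
  then have "leibniz_det n M - (1 + (\<Sum>i\<in>{1..n}. M i i - 1)) =
      ((\<Prod>i\<in>{1..n}. 1 + (M i i - 1)) - (1 + (\<Sum>i\<in>{1..n}. M i i - 1))) +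
      (\<Sum>p\<in>{p. p permutes {1..n}} - {id}. ?t p)"
    by simp
  moreover have "ev_deg n (2 * e) ((\<Prod>i\<in>{1..n}. 1 + (M i i - 1)) - (1 + (\<Sum>i\<in>{1..n}. M i i - 1)))"
  proof (rule prod_one_plus_deg)
    fix i assume "i \<in> {1..n}"
    then show "ev_deg n e (M i i - 1)" using M[of i i] by simp
  qed simp
  moreover have "ev_deg n (2 * e) (\<Sum>p\<in>{p. p permutes {1..n}} - {id}. ?t p)"
    by (rule ev_deg_sum) (use t in auto)
  ultimately show ?thesis by (simp only: ev_deg_add)
qed

text \<open>Since 1 \<le> e, degree e lies below 2e, so the degree e part of the trace already
  vanishes when the determinant is 1. The constant term of each diagonal entry does not reach
  \<alpha>, which is nonempty.\<close>

lemma unimod_group_trace: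
  assumes s: "\<sigma> \<in> unimod_group n e" and e: "1 \<le> e" and \<alpha>: "card \<alpha> = e"
  shows "(\<Sum>i\<in>{1..n}. skew_deriv i (\<sigma> (xgen i)) \<alpha>) = 0"
proof -
  have u: "\<sigma> \<in> unip_group n e" and J: "Jac n \<sigma> = xmon {}" using s by (auto simp: unimod_group_def)
  interpret unip_endo n \<sigma> e using u by (rule unip_group_D)
  let ?M = "jacobian \<sigma>"
  have M: "ev_deg n e (?M i j - of_bool (i = j))" if i: "i \<in> {1..n}" for i j
  proof -
    have "rep_ev (?M i j - of_bool (i = j)) = skew_deriv j (\<sigma> (xgen i) - xgen i)"
      by (auto simp: rep_ev_simps rep_jacobian[OF u i] skew_deriv_diff skew_deriv_generator)
    moreover have "skew_deriv j (\<sigma> (xgen i) - xgen i) \<in> mono_span n (\<lambda>\<alpha>. e \<le> card \<alpha>)"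
    proof (rule skew_deriv_lower_degree[OF level[OF i]])
      fix \<beta> assume "j \<notin> \<beta>" "insert j \<beta> \<subseteq> {1..n}" "even_ext e {i} (insert j \<beta>)"
      then show "e \<le> card \<beta>"
        using even_ext_card_le[of e "{i}" "insert j \<beta>"] finite_index_set[of \<beta> n] by simp
    qed
    ultimately show ?thesis by (simp add: ev_deg_def)
  qed
  have "ev_deg n (2 * e) (leibniz_det n ?M - (1 + (\<Sum>i\<in>{1..n}. ?M i i - 1)))"
    by (rule leibniz_det_deg) (rule M)
  moreover have "leibniz_det n ?M = 1"
    using J unfolding Jac_eq[OF u] by (simp add: rep_ev_inject[symmetric] rep_ev_simps)
  ultimately have "rep_ev (1 - (1 + (\<Sum>i\<in>{1..n}. ?M i i - 1))) \<alpha> = 0"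
    using e \<alpha> unfolding ev_deg_def mono_span_iff by fastforce
  then have "(\<Sum>i\<in>{1..n}. rep_ev (?M i i - 1)) \<alpha> = 0"
    by (simp add: rep_ev_simps rep_ev_sum fun_apply)
  moreover have "rep_ev (?M i i - 1) \<alpha> = skew_deriv i (\<sigma> (xgen i)) \<alpha>" if "i \<in> {1..n}" for i
    using that e \<alpha> by (auto simp: rep_ev_simps rep_jacobian[OF u] fun_apply xmon_def)
  ultimately show ?thesis by (simp add: sum_fun_apply)
qed

section \<open>Quotients mapped to a commutative group\<close>

lemma hom_quotient:
  assumes G: "group G" and A: "subgroup A G" and V: "comm_group V"
    and L: "L \<in> hom (G\<lparr>carrier := A\<rparr>) V"
    and N: "N = {x \<in> A. L x = \<one>\<^bsub>V\<^esub>}"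
  shows "N \<lhd> G\<lparr>carrier := A\<rparr>"
    and "G\<lparr>carrier := A\<rparr> Mod N \<cong> V\<lparr>carrier := L ` A\<rparr>"
    and "comm_group (G\<lparr>carrier := A\<rparr> Mod N)"
    and "subgroup (L ` A) V"
proof -
  interpret V: comm_group V by (rule V)
  have GA: "group (G\<lparr>carrier := A\<rparr>)" using A G by (rule subgroup.subgroup_is_group)
  interpret h: group_hom "G\<lparr>carrier := A\<rparr>" V L
    by (intro group_hom.intro group_hom_axioms.intro GA L V.group_axioms)
  show LA: "subgroup (L ` A) V" using h.img_is_subgroup by simp
  have VA: "comm_group (V\<lparr>carrier := L ` A\<rparr>)"
    by (rule group.group_comm_groupI[OF subgroup.subgroup_is_group[OF LA V.group_axioms]])
      (use subgroup.mem_carrier[OF LA] V.m_comm in auto)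
  interpret k: group_hom "G\<lparr>carrier := A\<rparr>" "V\<lparr>carrier := L ` A\<rparr>" L
    by (intro group_hom.intro group_hom_axioms.intro GA comm_group.axioms(2)[OF VA])
      (use L in \<open>auto simp: hom_def\<close>)
  have ker: "kernel (G\<lparr>carrier := A\<rparr>) (V\<lparr>carrier := L ` A\<rparr>) L = N"
    by (auto simp: kernel_def N)
  show n: "N \<lhd> G\<lparr>carrier := A\<rparr>" using k.normal_kernel unfolding ker .
  show iso: "G\<lparr>carrier := A\<rparr> Mod N \<cong> V\<lparr>carrier := L ` A\<rparr>"
    using k.FactGroup_iso unfolding ker by simp
  have g: "group (G\<lparr>carrier := A\<rparr> Mod N)" using n by (rule normal.factorgroup_is_group)
  show "comm_group (G\<lparr>carrier := A\<rparr> Mod N)"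
    using comm_group.iso_imp_comm_group[OF VA group.iso_sym[OF g iso]] g group.is_monoid by blast
qed

lemma internal_direct_product_iso:
  assumes "comm_group V" "subgroup U V" "subgroup W V"
    and int: "U \<inter> W \<subseteq> {\<one>\<^bsub>V\<^esub>}"
    and gen: "\<And>v. v \<in> carrier V \<Longrightarrow> \<exists>u\<in>U. \<exists>w\<in>W. v = u \<otimes>\<^bsub>V\<^esub> w"
  shows "V \<cong> V\<lparr>carrier := U\<rparr> \<times>\<times> V\<lparr>carrier := W\<rparr>"
proof -
  interpret V: comm_group V by fact
  interpret U: subgroup U V by fact
  interpret W: subgroup W V by fact
  let ?P = "V\<lparr>carrier := U\<rparr> \<times>\<times> V\<lparr>carrier := W\<rparr>" and ?f = "\<lambda>(u, w). u \<otimes>\<^bsub>V\<^esub> w"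
  have P: "group ?P"
    by (intro DirProd_group U.subgroup_is_group W.subgroup_is_group V.group_axioms)
  have hom: "?f \<in> hom ?P V"
    by (auto simp: hom_def V.m_ac)
  interpret h: group_hom ?P V ?f
    by (intro group_hom.intro group_hom_axioms.intro P hom V.group_axioms)
  have "u = \<one>\<^bsub>V\<^esub> \<and> w = \<one>\<^bsub>V\<^esub>" if "u \<in> U" "w \<in> W" "u \<otimes>\<^bsub>V\<^esub> w = \<one>\<^bsub>V\<^esub>" for u w
  proof -
    have "inv\<^bsub>V\<^esub> w = u"
      by (rule V.inv_equality[OF that(3) W.mem_carrier[OF that(2)] U.mem_carrier[OF that(1)]])
    then have "u \<in> W" using W.m_inv_closed[OF that(2)] by simp
    then have "u = \<one>\<^bsub>V\<^esub>" using int that by auto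
    then show ?thesis using that by simp
  qed
  then have "?f \<in> iso ?P V"
    unfolding h.iso_iff using gen by (force simp: image_iff)
  then have "?P \<cong> V" by (auto simp: is_iso_def)
  then show ?thesis by (rule group.iso_sym[OF P])
qed

text \<open>All quotients are identified with subgroups of \<open>V\<close> through \<open>L\<close>.\<close>

lemma quotient_decomposition:
  assumes G: "group G" and H: "subgroup H G" and A: "subgroup A G" and B: "subgroup B G"
    and AH: "A \<subseteq> H" and BH: "B \<subseteq> H"
    and V: "comm_group V" and L: "L \<in> hom (G\<lparr>carrier := H\<rparr>) V" and surj: "L ` H = carrier V"
    and N: "N = {x \<in> H. L x = \<one>\<^bsub>V\<^esub>}" and NB: "N \<subseteq> B"
    and gen: "\<forall>v\<in>carrier V. \<exists>a\<in>A. \<exists>b\<in>B. v = L a \<otimes>\<^bsub>V\<^esub> L b"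
    and int: "\<forall>a\<in>A. \<forall>b\<in>B. L a = L b \<longrightarrow> L a = \<one>\<^bsub>V\<^esub>"
  shows "H = B <#>\<^bsub>G\<^esub> A" and "H = A <#>\<^bsub>G\<^esub> B"
    and "N \<lhd> G\<lparr>carrier := H\<rparr>" and "A \<inter> N \<lhd> G\<lparr>carrier := A\<rparr>" and "N \<lhd> G\<lparr>carrier := B\<rparr>"
    and "comm_group (G\<lparr>carrier := H\<rparr> Mod N)" and "comm_group (G\<lparr>carrier := A\<rparr> Mod (A \<inter> N))"
    and "comm_group (G\<lparr>carrier := B\<rparr> Mod N)"
    and "G\<lparr>carrier := H\<rparr> Mod N \<cong> (G\<lparr>carrier := A\<rparr> Mod (A \<inter> N)) \<times>\<times> (G\<lparr>carrier := B\<rparr> Mod N)"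
proof -
  interpret G: group G by (rule G)
  interpret V: comm_group V by (rule V)
  interpret H: subgroup H G by (rule H)
  interpret A: subgroup A G by (rule A)
  interpret B: subgroup B G by (rule B)
  have LA: "L \<in> hom (G\<lparr>carrier := A\<rparr>) V" and LB: "L \<in> hom (G\<lparr>carrier := B\<rparr>) V"
    unfolding hom_def using hom_mult[OF L] hom_in_carrier[OF L] subsetD[OF AH] subsetD[OF BH]
    by simp_all
  have NA: "A \<inter> N = {x \<in> A. L x = \<one>\<^bsub>V\<^esub>}" and NB': "N = {x \<in> B. L x = \<one>\<^bsub>V\<^esub>}"
    using AH BH N NB by auto
  note qH = hom_quotient[OF G H V L N] and qA = hom_quotient[OF G A V LA NA]
    and qB = hom_quotient[OF G B V LB NB']
  show "N \<lhd> G\<lparr>carrier := H\<rparr>" "A \<inter> N \<lhd> G\<lparr>carrier := A\<rparr>" "N \<lhd> G\<lparr>carrier := B\<rparr>"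
    "comm_group (G\<lparr>carrier := H\<rparr> Mod N)" "comm_group (G\<lparr>carrier := A\<rparr> Mod (A \<inter> N))"
    "comm_group (G\<lparr>carrier := B\<rparr> Mod N)"
    by (fact qH(1) qA(1) qB(1) qH(3) qA(3) qB(3))+
  have "V \<cong> V\<lparr>carrier := L ` A\<rparr> \<times>\<times> V\<lparr>carrier := L ` B\<rparr>"
    by (rule internal_direct_product_iso[OF V qA(4) qB(4)]) (use int gen in blast)+
  moreover have "V\<lparr>carrier := L ` A\<rparr> \<times>\<times> V\<lparr>carrier := L ` B\<rparr> \<cong>
      (G\<lparr>carrier := A\<rparr> Mod (A \<inter> N)) \<times>\<times> (G\<lparr>carrier := B\<rparr> Mod N)"
  proof (rule group.DirProd_iso_trans)
    show "group (V\<lparr>carrier := L ` A\<rparr>)"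
      using qA(4) V.group_axioms by (rule subgroup.subgroup_is_group)
    show "V\<lparr>carrier := L ` A\<rparr> \<cong> G\<lparr>carrier := A\<rparr> Mod (A \<inter> N)"
      using normal.factorgroup_is_group[OF qA(1)] qA(2) by (rule group.iso_sym)
    show "V\<lparr>carrier := L ` B\<rparr> \<cong> G\<lparr>carrier := B\<rparr> Mod N"
      using normal.factorgroup_is_group[OF qB(1)] qB(2) by (rule group.iso_sym)
  qed
  moreover have "G\<lparr>carrier := H\<rparr> Mod N \<cong> V" using qH(2) by (simp add: surj)
  ultimately show "G\<lparr>carrier := H\<rparr> Mod N \<cong>
      (G\<lparr>carrier := A\<rparr> Mod (A \<inter> N)) \<times>\<times> (G\<lparr>carrier := B\<rparr> Mod N)"
    by (blast intro: iso_trans)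
  have Lm: "L (x \<otimes>\<^bsub>G\<^esub> y) = L x \<otimes>\<^bsub>V\<^esub> L y" if "x \<in> H" "y \<in> H" for x y
    using hom_mult[OF L] that by simp
  have Lc: "L x \<in> carrier V" if "x \<in> H" for x using hom_in_carrier[OF L] that by simp
  have L1: "L \<one>\<^bsub>G\<^esub> = \<one>\<^bsub>V\<^esub>"
    using Lm[of "\<one>\<^bsub>G\<^esub>" "\<one>\<^bsub>G\<^esub>"] Lc[of "\<one>\<^bsub>G\<^esub>"] by (simp add: V.l_cancel_one')
  have Li: "L (inv\<^bsub>G\<^esub> x) = inv\<^bsub>V\<^esub> L x" if "x \<in> H" for x
    by (rule V.inv_equality[symmetric]) (use that Lm[of "inv\<^bsub>G\<^esub> x" x] L1 Lc in auto)
  have fac: "\<exists>a\<in>A. \<exists>b\<in>B. x = a \<otimes>\<^bsub>G\<^esub> b" if x: "x \<in> H" for x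
  proof -
    obtain a b where ab: "a \<in> A" "b \<in> B" "L x = L a \<otimes>\<^bsub>V\<^esub> L b" using gen Lc[OF x] by blast
    then have abH: "a \<in> H" "b \<in> H" using AH BH by auto
    \<comment> \<open>The element y has the same image as b, so it differs from b by an element of
      N. As N lies in B, y itself belongs to B, and x = a y.\<close>
    let ?y = "inv\<^bsub>G\<^esub> a \<otimes>\<^bsub>G\<^esub> x"
    have y: "?y \<in> H" using x abH by simp
    have "L ?y = L b" using x abH ab(3) by (simp add: Lm Li Lc flip: V.m_assoc)
    then have "?y \<otimes>\<^bsub>G\<^esub> inv\<^bsub>G\<^esub> b \<in> N" using y abH by (simp add: N Lm Li Lc)
    then have "(?y \<otimes>\<^bsub>G\<^esub> inv\<^bsub>G\<^esub> b) \<otimes>\<^bsub>G\<^esub> b \<in> B" using NB ab(2) by auto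
    then have "?y \<in> B" using y abH by (simp add: G.m_assoc)
    moreover have "x = a \<otimes>\<^bsub>G\<^esub> ?y" using x abH by (simp flip: G.m_assoc)
    ultimately show ?thesis using ab(1) by blast
  qed
  show AB: "H = A <#>\<^bsub>G\<^esub> B"
    using fac AH BH by (auto simp: set_mult_def)
  \<comment> \<open>The other order follows by factoring the inverse of x.\<close>
  have "\<exists>b\<in>B. \<exists>a\<in>A. x = b \<otimes>\<^bsub>G\<^esub> a" if x: "x \<in> H" for x
  proof -
    obtain a b where ab: "a \<in> A" "b \<in> B" "inv\<^bsub>G\<^esub> x = a \<otimes>\<^bsub>G\<^esub> b" using fac[of "inv\<^bsub>G\<^esub> x"] x by auto
    then have "x = inv\<^bsub>G\<^esub> b \<otimes>\<^bsub>G\<^esub> inv\<^bsub>G\<^esub> a"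
      using x by (metis A.mem_carrier B.mem_carrier G.inv_inv G.inv_mult_group H.mem_carrier)
    then show ?thesis using ab by blast
  qed
  then show "H = B <#>\<^bsub>G\<^esub> A"
    using AH BH by (auto simp: set_mult_def)
qed

lemma coset_eq_iff:
  assumes G: "group G" and H: "subgroup H G" and V: "group V"
    and L: "L \<in> hom (G\<lparr>carrier := H\<rparr>) V" and N: "N = {x \<in> H. L x = \<one>\<^bsub>V\<^esub>}"
    and xy: "x \<in> H" "y \<in> H"
  shows "N #>\<^bsub>G\<^esub> x = N #>\<^bsub>G\<^esub> y \<longleftrightarrow> L x = L y"
proof -
  have GH: "group (G\<lparr>carrier := H\<rparr>)" using H G by (rule subgroup.subgroup_is_group)
  interpret V: group V by (rule V)
  interpret h: group_hom "G\<lparr>carrier := H\<rparr>" V L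
    by (intro group_hom.intro group_hom_axioms.intro GH L V)
  have ker: "kernel (G\<lparr>carrier := H\<rparr>) V L = N" by (auto simp: kernel_def N)
  have sub: "subgroup N (G\<lparr>carrier := H\<rparr>)" using h.subgroup_kernel unfolding ker .
  \<comment> \<open>Cosets depend only on the multiplication, which restricting the carrier leaves
    unchanged.\<close>
  have c: "N #>\<^bsub>G\<^esub> z = N #>\<^bsub>G\<lparr>carrier := H\<rparr>\<^esub> z" for z by (simp add: r_coset_def)
  show ?thesis
  proof
    assume eq: "N #>\<^bsub>G\<^esub> x = N #>\<^bsub>G\<^esub> y"
    have "y \<in> N #>\<^bsub>G\<lparr>carrier := H\<rparr>\<^esub> y" by (rule h.G.rcos_self[OF _ sub]) (use xy in simp)
    then have "y \<in> N #>\<^bsub>G\<^esub> x" by (simp only: eq flip: c)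
    then obtain u where u: "u \<in> N" "y = u \<otimes>\<^bsub>G\<^esub> x" by (auto simp: r_coset_def)
    then show "L x = L y" using xy h.hom_mult[of u x] h.hom_closed[of x] by (simp add: N)
  next
    assume eq: "L x = L y"
    let ?u = "y \<otimes>\<^bsub>G\<^esub> inv\<^bsub>G\<lparr>carrier := H\<rparr>\<^esub> x"
    have ix: "inv\<^bsub>G\<lparr>carrier := H\<rparr>\<^esub> x \<in> H" using xy h.G.inv_closed[of x] by simp
    have "?u \<in> H" using xy ix h.G.m_closed[of y "inv\<^bsub>G\<lparr>carrier := H\<rparr>\<^esub> x"] by simp
    moreover have "L ?u = \<one>\<^bsub>V\<^esub>"
      using xy ix eq h.hom_mult[of y
        "inv\<^bsub>G\<lparr>carrier := H\<rparr>\<^esub> x"] h.hom_inv[of x] h.hom_closed[of x] by simp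
    ultimately have "?u \<in> N" by (simp add: N)
    moreover have "y = ?u \<otimes>\<^bsub>G\<^esub> x"
      using xy ix h.G.m_assoc[of y
        "inv\<^bsub>G\<lparr>carrier := H\<rparr>\<^esub> x" x] h.G.l_inv[of x] h.G.r_one[of y] by simp
    ultimately have "y \<in> N #>\<^bsub>G\<^esub> x" by (auto simp: r_coset_def)
    then show "N #>\<^bsub>G\<^esub> x = N #>\<^bsub>G\<^esub> y"
      unfolding c by (rule h.G.repr_independence) (use xy sub in auto)
  qed
qed

lemma coset_mult:
  assumes "N \<lhd> G\<lparr>carrier := H\<rparr>" "x \<in> H" "y \<in> H"
  shows "(N #>\<^bsub>G\<^esub> x) \<otimes>\<^bsub>G\<lparr>carrier := H\<rparr> Mod N\<^esub> (N #>\<^bsub>G\<^esub> y) = N #>\<^bsub>G\<^esub> (x \<otimes>\<^bsub>G\<^esub> y)"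
  using normal.rcos_sum[OF assms(1), of x y] assms(2,3)
  by (simp add: FactGroup_def r_coset_def set_mult_def)

text \<open>The value of a product of cosets is tracked through the additive images of representatives.\<close>

lemma finprod_coset:
  fixes L :: "'a \<Rightarrow> 'v::comm_monoid_add" and F :: "'i \<Rightarrow> 'a set"
  assumes H: "subgroup H G" and n: "N \<lhd> G\<lparr>carrier := H\<rparr>" and Q: "comm_group (G\<lparr>carrier := H\<rparr> Mod N)"
    and L: "\<forall>x\<in>H. \<forall>y\<in>H. L (x \<otimes>\<^bsub>G\<^esub> y) = L x + L y" "L \<one>\<^bsub>G\<^esub> = 0"
    and F: "\<And>i. i \<in> I \<Longrightarrow> \<exists>g\<in>H. F i = N #>\<^bsub>G\<^esub> g \<and> L g = v i"
  shows "\<exists>g\<in>H. (\<Otimes>\<^bsub>G\<lparr>carrier := H\<rparr> Mod N\<^esub>i\<in>I. F i) = N #>\<^bsub>G\<^esub> g \<and> L g = (\<Sum>i\<in>I. v i)"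
proof -
  interpret Q: comm_group "G\<lparr>carrier := H\<rparr> Mod N" by (rule Q)
  interpret H: subgroup H G by (rule H)
  interpret N: normal N "G\<lparr>carrier := H\<rparr>" by (rule n)
  have c: "N #>\<^bsub>G\<^esub> z = N #>\<^bsub>G\<lparr>carrier := H\<rparr>\<^esub> z" for z by (simp add: r_coset_def)
  have one: "N #>\<^bsub>G\<^esub> \<one>\<^bsub>G\<^esub> = \<one>\<^bsub>G\<lparr>carrier := H\<rparr> Mod N\<^esub>"
    using N.coset_join2[OF _ N.subgroup_axioms subgroup.one_closed[OF N.subgroup_axioms]]
    unfolding c by (simp add: FactGroup_def)
  have carr: "N #>\<^bsub>G\<^esub> g \<in> carrier (G\<lparr>carrier := H\<rparr> Mod N)" if "g \<in> H" for g
    unfolding c using that N.rcosetsI[OF N.subset] by (simp add: FactGroup_def)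
  have Fc: "F i \<in> carrier (G\<lparr>carrier := H\<rparr> Mod N)" if "i \<in> I" for i
    using F[OF that] carr by auto
  show ?thesis using F Fc
  \<comment> \<open>For infinite \<open>I\<close> the product and the sum both have their neutral
    default value.\<close>
  proof (induction I rule: infinite_finite_induct)
    case (insert x I)
    obtain g where g: "g \<in> H" "(\<Otimes>\<^bsub>G\<lparr>carrier := H\<rparr> Mod N\<^esub>i\<in>I. F i) = N #>\<^bsub>G\<^esub> g"
      "L g = (\<Sum>i\<in>I. v i)"
      using insert by auto
    obtain k where k: "k \<in> H" "F x = N #>\<^bsub>G\<^esub> k" "L k = v x" using insert(4)[of x] by auto
    have "(\<Otimes>\<^bsub>G\<lparr>carrier := H\<rparr> Mod N\<^esub>i\<in>insert x I. F i) =
        F x \<otimes>\<^bsub>G\<lparr>carrier := H\<rparr> Mod N\<^esub> (\<Otimes>\<^bsub>G\<lparr>carrier := H\<rparr> Mod N\<^esub>i\<in>I. F i)"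
      using insert(1,2,5) by (intro Q.finprod_insert) auto
    also have "\<dots> = N #>\<^bsub>G\<^esub> (k \<otimes>\<^bsub>G\<^esub> g)"
      unfolding g(2) k(2) by (rule coset_mult[OF n k(1) g(1)])
    finally have "(\<Otimes>\<^bsub>G\<lparr>carrier := H\<rparr> Mod N\<^esub>i\<in>insert x I. F i) = N #>\<^bsub>G\<^esub> (k \<otimes>\<^bsub>G\<^esub> g)" .
    moreover have "L (k \<otimes>\<^bsub>G\<^esub> g) = (\<Sum>i\<in>insert x I. v i)"
      using insert g k by (simp add: L(1))
    ultimately show ?case using g(1) k(1) by blast
  qed (use one L(2) in \<open>auto intro!: bexI[of _ "\<one>\<^bsub>G\<^esub>"]\<close>)
qed

section \<open>Leading terms\<close>

text \<open>The space V as functions of i and \<alpha> that are zero outside the admissible places.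
  Addition is then pointwise, in contrast to the extensional families of
  \<open>leading_terms\<close>.\<close>

definition Vcar :: "nat \<Rightarrow> nat \<Rightarrow> (nat \<Rightarrow> nat set \<Rightarrow> 'k::comm_ring_1) set" where
  "Vcar n e = {v. \<forall>i \<alpha>. v i \<alpha> \<noteq> 0 \<longrightarrow> i \<in> {1..n} \<and> \<alpha> \<subseteq> {1..n} \<and> card \<alpha> = e \<and> i \<notin> \<alpha>}"

definition Vgrp :: "nat \<Rightarrow> nat \<Rightarrow> (nat \<Rightarrow> nat set \<Rightarrow> 'k::comm_ring_1) monoid" where
  "Vgrp n e = \<lparr>carrier = Vcar n e, monoid.mult = (+), one = 0\<rparr>"

lemma Vcar_D:
  "v \<in> Vcar n e \<Longrightarrow> v i \<alpha> \<noteq> 0 \<Longrightarrow> i \<in> {1..n} \<and> \<alpha> \<subseteq> {1..n} \<and> card \<alpha> = e \<and> i \<notin> \<alpha>"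
  by (simp add: Vcar_def)

lemma Vcar_closed:
  "0 \<in> Vcar n e"
  "v \<in> Vcar n e \<Longrightarrow> w \<in> Vcar n e \<Longrightarrow> v + w \<in> Vcar n e"
  "v \<in> Vcar n e \<Longrightarrow> - v \<in> Vcar n e"
proof -
  show "v + w \<in> Vcar n e" if vw: "v \<in> Vcar n e" "w \<in> Vcar n e"
    unfolding Vcar_def mem_Collect_eq
  proof (intro allI impI)
    fix i \<alpha> assume "(v + w) i \<alpha> \<noteq> 0"
    then have "v i \<alpha> \<noteq> 0 \<or> w i \<alpha> \<noteq> 0" by (auto simp: fun_apply)
    then show "i \<in> {1..n} \<and> \<alpha> \<subseteq> {1..n} \<and> card \<alpha> = e \<and> i \<notin> \<alpha>"
      using Vcar_D[OF vw(1), of i \<alpha>] Vcar_D[OF vw(2), of i \<alpha>] by blast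
  qed
qed (simp_all add: Vcar_def fun_apply)

lemma comm_group_Vgrp: "comm_group (Vgrp n e)"
proof (rule comm_groupI)
  fix v :: "nat \<Rightarrow> nat set \<Rightarrow> 'a" assume "v \<in> carrier (Vgrp n e)"
  then show "\<exists>w\<in>carrier (Vgrp n e). w \<otimes>\<^bsub>Vgrp n e\<^esub> v = \<one>\<^bsub>Vgrp n e\<^esub>"
    by (intro bexI[of _ "- v"]) (auto simp: Vgrp_def Vcar_closed)
qed (auto simp: Vgrp_def Vcar_closed add_ac)

text \<open>The leading terms \<open>(b\<^sub>1, \<dots>, b\<^sub>n)\<close>; \<open>\<partial>\<sigma>(x\<^sub>i)/\<partial>x\<^sub>i = 1 + c\<^sub>i\<close> if \<open>\<sigma>(x\<^sub>i) = x\<^sub>i(1 + c\<^sub>i)\<close>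
  and \<open>c\<^sub>i\<close> does not involve \<open>x\<^sub>i\<close>.\<close>

definition lead ::
    "nat \<Rightarrow> nat \<Rightarrow> ((nat set \<Rightarrow> 'k::comm_ring_1) \<Rightarrow> nat set \<Rightarrow> 'k) \<Rightarrow> nat \<Rightarrow> nat set \<Rightarrow> 'k" where
  "lead n e \<sigma> = (\<lambda>i \<alpha>. if i \<in> {1..n} \<and> card \<alpha> = e then skew_deriv i (\<sigma> (xgen i)) \<alpha> else 0)"

lemma lead_Vcar: "alg_endo n \<sigma> \<Longrightarrow> lead n e \<sigma> \<in> Vcar n e"
proof -
  assume "alg_endo n \<sigma>"
  then interpret alg_endo n \<sigma> .
  show ?thesis unfolding Vcar_def mem_Collect_eq
  proof (intro allI impI)
    fix i \<alpha> assume "lead n e \<sigma> i \<alpha> \<noteq> 0"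
    then have *: "i \<in> {1..n}" "card \<alpha> = e" "skew_deriv i (\<sigma> (xgen i)) \<alpha> \<noteq> 0"
      by (auto simp: lead_def split: if_splits)
    then have "i \<notin> \<alpha>" by (auto simp: skew_deriv_def)
    moreover have "skew_deriv i (\<sigma> (xgen i)) \<in> gcar n"
      using *(1) by (intro skew_deriv_gcar closed xgen_carrier)
    ultimately show "i \<in> {1..n} \<and> \<alpha> \<subseteq> {1..n} \<and> card \<alpha> = e \<and> i \<notin> \<alpha>"
      using * by (auto simp: gcar_iff)
  qed
qed

lemma xmon_empty_apply: "1 \<le> card \<alpha> \<Longrightarrow> xmon {} \<alpha> = 0"
  by (auto simp: xmon_def)

text \<open>Division by x_i recovers 1 + b. The tail h may involve x_i, so it is only estimated: x_i
  h has degree above e + 1, and the derivation lowers this by one.\<close>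

lemma lead_explicit:
  assumes x: "\<sigma> (xgen i) = xgen i \<star> (xmon {} + b + h)" and b: "b \<in> mono_span n (\<lambda>\<alpha>. i \<notin> \<alpha>)"
    and h: "h \<in> mono_span n (\<lambda>\<alpha>. e < card \<alpha>)" and i: "i \<in> {1..n}" and \<alpha>: "card \<alpha> = e" and e: "1 \<le> e"
  shows "lead n e \<sigma> i \<alpha> = b \<alpha>"
proof -
  have "xmon {} + b \<in> mono_span n (\<lambda>\<alpha>. i \<notin> \<alpha>)"
    by (intro mono_span_closed b xmon_in_mono_span) auto
  then have 1: "skew_deriv i (\<sigma> (xgen i)) = xmon {} + b + skew_deriv i (xgen i \<star> h)"
    unfolding x gmul_add_right[of "xgen i" "xmon {} + b" h] skew_deriv_add
    by (simp add: skew_deriv_xgen_mult)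
  have "xgen i \<star> h \<in> mono_span n (\<lambda>\<alpha>. Suc e < card \<alpha>)"
    unfolding xgen_def
  proof (rule gmul_mono_span[OF xmon_in_mono_span[where P = "\<lambda>\<alpha>. \<alpha> = {i}"] h])
    fix \<alpha> \<beta> :: "nat set"
    assume "\<beta> \<subseteq> {1..n}" "\<alpha> \<inter> \<beta> = {}" "\<alpha> = {i}" "e < card \<beta>"
    then show "Suc e < card (\<alpha> \<union> \<beta>)" using finite_index_set[of \<beta> n] by simp
  qed (use i in auto)
  then have "skew_deriv i (xgen i \<star> h) \<in> mono_span n (\<lambda>\<alpha>. e < card \<alpha>)"
  proof (rule skew_deriv_lower_degree)
    fix \<beta> assume "i \<notin> \<beta>" "insert i \<beta> \<subseteq> {1..n}" "Suc e < card (insert i \<beta>)"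
    then show "e < card \<beta>" using finite_index_set[of \<beta> n] by simp
  qed
  then have "skew_deriv i (xgen i \<star> h) \<alpha> = 0" using \<alpha> unfolding mono_span_iff by blast
  then show ?thesis
    using i \<alpha> e by (simp add: lead_def 1 fun_apply xmon_empty_apply)
qed

lemma (in unip_endo) skew_deriv_level:
  assumes i: "i \<in> {1..n}"
  shows "skew_deriv i (\<sigma> (xgen i) - xgen i) \<in> mono_span n (\<lambda>\<alpha>. even (card \<alpha>) \<and> e \<le> card \<alpha> \<and> i \<notin> \<alpha>)"
proof (rule skew_deriv_lower_degree[OF level[OF i]])
  fix \<beta> assume b: "i \<notin> \<beta>" "even_ext e {i} (insert i \<beta>)"
  then have "insert i \<beta> - {i} = \<beta>" by simp
  then show "even (card \<beta>) \<and> e \<le> card \<beta> \<and> i \<notin> \<beta>" using b by (simp add: even_ext_def)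
qed

lemma lead_mult:
  assumes s: "\<sigma> \<in> unip_group n e" and t: "\<tau> \<in> unip_group n e" and e: "1 \<le> e"
  shows "lead n e (\<sigma> \<otimes>\<^bsub>BijGroup (gcar n)\<^esub> \<tau>) = lead n e \<sigma> + lead n e \<tau>"
proof (intro ext)
  fix i and \<alpha> :: "nat set"
  interpret s: unip_endo n \<sigma> e using s by (rule unip_group_D)
  interpret t: unip_endo n \<tau> e using t by (rule unip_group_D)
  show "lead n e (\<sigma> \<otimes>\<^bsub>BijGroup (gcar n)\<^esub> \<tau>) i \<alpha> = (lead n e \<sigma> + lead n e \<tau>) i \<alpha>"
  proof (cases "i \<in> {1..n} \<and> card \<alpha> = e")
    case True
    then have i: "i \<in> {1..n}" and \<alpha>: "card \<alpha> = e" by auto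
    \<comment> \<open>Applying \<sigma> to \<tau>(x_i) = x_i + y gives \<sigma>(x_i) + y +
      (\<sigma>(y) - y). As y starts in degree e + 1, the last term starts in degree 2e + 1 and does
      not affect the leading terms.\<close>
    let ?y = "\<tau> (xgen i) - xgen i"
    have x: "(xgen i :: nat set \<Rightarrow> 'a) \<in> gcar n" using i by (rule xgen_carrier)
    have "\<sigma> ?y - ?y \<in> mono_span n (\<lambda>\<gamma>. Suc e < card \<gamma>)"
    proof (rule s.diff_in_mono_span[OF t.level[OF i]])
      fix \<beta> \<gamma> :: "nat set"
      assume *: "\<beta> \<subseteq> {1..n}" "\<gamma> \<subseteq> {1..n}" "even_ext e {i} \<beta>" "even_ext e \<beta> \<gamma>"
      then have "1 + e \<le> card \<beta>" "card \<beta> + e \<le> card \<gamma>"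
        using even_ext_card_le[of e "{i}" \<beta>] even_ext_card_le[of e \<beta> \<gamma>]
          finite_index_set[of \<beta> n] finite_index_set[of \<gamma> n] by simp_all
      then show "Suc e < card \<gamma>" using e by simp
    qed
    then have "skew_deriv i (\<sigma> ?y - ?y) \<in> mono_span n (\<lambda>\<alpha>. e < card \<alpha>)"
    proof (rule skew_deriv_lower_degree)
      fix \<beta> assume "i \<notin> \<beta>" "insert i \<beta> \<subseteq> {1..n}" "Suc e < card (insert i \<beta>)"
      then show "e < card \<beta>" using finite_index_set[of \<beta> n] by simp
    qed
    then have 0: "skew_deriv i (\<sigma> ?y - ?y) \<alpha> = 0" using \<alpha> unfolding mono_span_iff by blast
    have "(\<sigma> \<otimes>\<^bsub>BijGroup (gcar n)\<^esub> \<tau>) (xgen i) = (\<sigma> ?y - ?y) + \<tau> (xgen i) - xgen i + \<sigma> (xgen i)"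
      using x by (simp add: Bij_mult_apply[OF unip_group_D(1)[OF s] unip_group_D(1)[OF t]] s.diff t.closed)
    then have "skew_deriv i ((\<sigma> \<otimes>\<^bsub>BijGroup (gcar n)\<^esub> \<tau>) (xgen i)) \<alpha> =
        skew_deriv i (\<tau> (xgen i)) \<alpha> + skew_deriv i (\<sigma> (xgen i)) \<alpha>"
      using 0 \<alpha> e
      by (simp only: skew_deriv_add skew_deriv_diff[of i "_ + _"
        "xgen i"] skew_deriv_generator fun_apply)
        (simp add: xmon_empty_apply)
    then show ?thesis using True by (simp add: lead_def fun_apply)
  qed (auto simp: lead_def fun_apply)
qed

text \<open>The number of indices adjoined to {i} is even and at least e. Vanishing leading terms
  exclude e itself, and since e is even the next possible value is e + 2; this accounts for the step
  from 2s + 1 to 2s + 3.\<close>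

lemma lead_eq_zero_iff:
  assumes s: "\<sigma> \<in> unip_group n e" and e: "1 \<le> e" "even e"
  shows "lead n e \<sigma> = 0 \<longleftrightarrow> \<sigma> \<in> unip_group n (e + 2)"
proof
  interpret unip_endo n \<sigma> e using s by (rule unip_group_D)
  assume 0: "lead n e \<sigma> = 0"
  have "\<sigma> (xgen i) - xgen i \<in> mono_span n (even_ext (e + 2) {i})" if i: "i \<in> {1..n}" for i
    unfolding mono_span_iff
  proof (intro allI impI conjI)
    fix \<gamma> assume nz: "(\<sigma> (xgen i) - xgen i) \<gamma> \<noteq> 0"
    then have \<gamma>: "\<gamma> \<subseteq> {1..n}" "even_ext e {i} \<gamma>" using level[OF i] by (auto simp: mono_span_iff)
    then show "\<gamma> \<subseteq> {1..n}" by simp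
    have "card (\<gamma> - {i}) \<noteq> e"
    proof
      assume c: "card (\<gamma> - {i}) = e"
      then have "\<gamma> \<noteq> {i}" using e by auto
      then have "\<sigma> (xgen i) \<gamma> \<noteq> 0" using nz by (simp add: fun_apply xgen_def xmon_def)
      moreover have "insert i (\<gamma> - {i}) = \<gamma>" using \<gamma> by (auto simp: even_ext_def)
      ultimately have "lead n e \<sigma> i (\<gamma> - {i}) \<noteq> 0"
        using i c by (simp add: lead_def skew_deriv_def minus_one_power_iff)
      then show False using 0 by (simp add: fun_apply)
    qed
    moreover have "e + 2 \<le> k" if "k \<noteq> e" "even k" "e \<le> k" for k
      using that e(2) by presburger
    ultimately show "even_ext (e + 2) {i} \<gamma>"
      using \<gamma>(2) unfolding even_ext_def by blast
  qed
  then show "\<sigma> \<in> unip_group n (e + 2)" using unip_group_D(4)[OF s] by (simp add: unip_group_iff)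
next
  assume s': "\<sigma> \<in> unip_group n (e + 2)"
  interpret unip_endo n \<sigma> "e + 2" using s' by (rule unip_group_D)
  have "skew_deriv i (\<sigma> (xgen i)) \<alpha> = 0" if i: "i \<in> {1..n}" and \<alpha>: "card \<alpha> = e" for i \<alpha>
  proof -
    have "skew_deriv i (\<sigma> (xgen i) - xgen i) \<alpha> = 0"
      using skew_deriv_level[OF i] \<alpha> unfolding mono_span_iff by force
    then show ?thesis
      using \<alpha> e by (simp add: skew_deriv_diff skew_deriv_generator fun_apply xmon_empty_apply)
  qed
  then show "lead n e \<sigma> = 0" by (auto simp: lead_def fun_eq_iff fun_apply)
qed

section \<open>The automorphisms \<open>rho\<close>\<close>

lemma skew_deriv_avoiding: "a \<in> mono_span n (\<lambda>\<alpha>. m \<notin> \<alpha>) \<Longrightarrow> skew_deriv m a = 0"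
proof -
  assume "a \<in> mono_span n (\<lambda>\<alpha>. m \<notin> \<alpha>)"
  then have "a (insert m \<beta>) = 0" for \<beta> unfolding mono_span_iff by blast
  then show ?thesis by (simp add: skew_deriv_def fun_eq_iff fun_apply)
qed

lemma unimod_group_subset_Sigma': "2 \<le> e \<Longrightarrow> unimod_group n e \<subseteq> Sigma' n"
  using Sigma'_pow_eq[of e "Suc e" n] by (auto simp: Sigma'_pow_def)

lemma Sigma'_subset_aut: "Sigma' n \<subseteq> Grassmann_aut n"
  by (auto simp: Sigma'_def Phi_def Gamma_def)

text \<open>As \<open>rho\<close> is a definite description, existence comes from
  \<open>unip_group_exists\<close> and uniqueness from the images of the generators. The Jacobian is
  (1 + b)(1 - b) with b = l x^\<alpha>, and b squares to zero.\<close>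

lemma rho_properties:
  fixes l :: "'k::comm_ring_1"
  assumes e: "2 \<le> e" "even e" and ij: "i \<in> {1..n}" "j \<in> {1..n}" "i \<noteq> j"
    and \<alpha>: "\<alpha> \<subseteq> {1..n}" "card \<alpha> = e" "i \<notin> \<alpha>" "j \<notin> \<alpha>"
  shows "rho n i j l \<alpha> \<in> unimod_group n e"
    and "lead n e (rho n i j l \<alpha>) = (\<lambda>k. scal (l * (unit_vec i k - unit_vec j k)) (xmon \<alpha>))"
proof -
  define b :: "nat \<Rightarrow> nat set \<Rightarrow> 'k" where
    "b k = scal (l * (unit_vec i k - unit_vec j k)) (xmon \<alpha>)" for k
  have bv: "b i = scal l (xmon \<alpha>)" "b j = - scal l (xmon \<alpha>)" "k \<notin> {i, j} \<Longrightarrow> b k = 0" for k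
    using ij(3) by (auto simp: b_def unit_vec_def scal_simps fun_eq_iff fun_apply)
  have xa: "xmon \<alpha> \<in> mono_span n (\<lambda>\<beta>. \<beta> = \<alpha>)" using \<alpha> by (intro xmon_in_mono_span) auto
  have b: "b k \<in> mono_span n (\<lambda>\<beta>. even (card \<beta>) \<and> e \<le> card \<beta> \<and> k \<notin> \<beta>)" for k
  proof (cases "k \<in> {i, j}")
    case True
    show ?thesis unfolding b_def
      by (intro mono_span_closed mono_span_mono[OF xa]) (use \<alpha> e True in auto)
  qed (simp add: bv mono_span_closed)
  obtain \<sigma> where s: "\<sigma> \<in> unip_group n e"
    and x: "\<And>k. k \<in> {1..n} \<Longrightarrow> \<sigma> (xgen k) = xgen k \<star> (xmon {} + b k)"
    by (rule unip_group_exists[of e n b]) (use e b in auto)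
  have bc: "b k \<in> gcar n" for k using b by (rule mono_span_carrier)
  have x': "\<sigma> (xgen k) = xgen k + xgen k \<star> b k" if k: "k \<in> {1..n}" for k
    by (simp add: x[OF k] gmul_add_right gmul_one[OF xgen_carrier[OF k]])
  let ?J = "jacobian \<sigma>"
  \<comment> \<open>Rows outside {i, j} belong to fixed generators; in rows i and j the columns i
    and j vanish off the diagonal because \<alpha> avoids both indices.\<close>
  have off: "?J k m = 0" if km: "k \<in> {1..n}" "m \<in> {1..n}" "m \<noteq> k" "k \<notin> {i, j} \<or> m \<in> {i, j}" for k m
  proof -
    have "xgen k \<star> b k \<in> mono_span n (\<lambda>\<beta>. m \<notin> \<beta>)"
    proof (cases "k \<in> {i, j}")
      case True
      then have m: "m \<in> {i, j}" using km by simp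
      show ?thesis unfolding xgen_def
      proof (rule gmul_mono_span[OF xmon_in_mono_span[where P = "\<lambda>\<beta>. \<beta> = {k}"]])
        show "b k \<in> mono_span n (\<lambda>\<beta>. \<beta> = \<alpha>)" unfolding b_def by (rule mono_span_closed) (rule xa)
      qed (use km m \<alpha> in auto)
    qed (simp add: bv mono_span_closed)
    then have "skew_deriv m (\<sigma> (xgen k)) = 0"
      using km(3) by
        (simp add: x'[OF km(1)] skew_deriv_add skew_deriv_avoiding skew_deriv_generator)
    then show ?thesis by (simp add: rep_ev_inject[symmetric] rep_jacobian[OF s km(1)] rep_ev_simps)
  qed
  have diag: "rep_ev (?J k k) = xmon {} + b k" if k: "k \<in> {1..n}" for k
  proof -
    have "xmon {} + b k \<in> mono_span n (\<lambda>\<beta>. k \<notin> \<beta>)"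
      by (intro mono_span_closed xmon_in_mono_span mono_span_mono[OF b]) auto
    then show ?thesis by (simp add: rep_jacobian[OF s k] x[OF k] skew_deriv_xgen_mult)
  qed
  have "leibniz_det n ?J = (\<Prod>k\<in>{1..n}. ?J k k)"
  proof (rule leibniz_det_diagonal)
    fix p assume p: "p permutes {1..n}" "p \<noteq> id"
    have pk: "p k \<in> {1..n}" if "k \<in> {1..n}" for k using that permutes_in_image[OF p(1)] by simp
    \<comment> \<open>If no factor vanished, p would fix every index outside {i, j}, hence preserve
      {i, j}, where the block is diagonal; so p would be the identity.\<close>
    show "\<exists>k\<in>{1..n}. ?J k (p k) = 0"
    proof (rule ccontr)
      assume "\<not> ?thesis"
      then have nz: "?J k (p k) \<noteq> 0" if "k \<in> {1..n}" for k using that by blast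
      have fix1: "p k = k" if "k \<in> {1..n}" "k \<notin> {i, j}" for k
        using off[OF that(1) pk[OF that(1)]] nz[OF that(1)] that(2) by blast
      have fix2: "p k = k" if k: "k \<in> {i, j}" for k
      proof (rule ccontr)
        have k_in: "k \<in> {1..n}" using k ij by auto
        assume ne: "p k \<noteq> k"
        have "p k \<in> {i, j}"
        proof (rule ccontr)
          assume "p k \<notin> {i, j}"
          then have "p (p k) = p k" using fix1 pk[OF k_in] by blast
          then show False using ne permutes_inj[OF p(1)] by (auto dest: injD)
        qed
        then show False using off[OF k_in pk[OF k_in]] nz[OF k_in] ne by blast
      qed
      have "p k = k" for k using fix1 fix2 permutes_not_in[OF p(1)] by blast
      then show False using p(2) by (auto simp: fun_eq_iff)
    qed
  qed
  also have "\<dots> = (\<Prod>k\<in>{i, j}. ?J k k)"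
  proof (rule prod.mono_neutral_right)
    show "\<forall>k\<in>{1..n} - {i, j}. ?J k k = 1"
    proof
      fix k assume "k \<in> {1..n} - {i, j}"
      then show "?J k k = 1" by (simp add: rep_ev_inject[symmetric] diag rep_ev_simps bv)
    qed
  qed (use ij in auto)
  also have "\<dots> = ?J i i * ?J j j" using ij(3) by simp
  finally have "Jac n \<sigma> = rep_ev (?J i i) \<star> rep_ev (?J j j)"
    by (simp add: Jac_eq[OF s] rep_ev_simps)
  also have "\<dots> = (xmon {} + b i) \<star> (xmon {} - b i)"
    using ij by (simp add: diag bv)
  also have "\<dots> = xmon {} - b i \<star> b i"
    by (simp add: gmul_add_left gmul_diff_right gmul_one[OF bc] gmul_one[OF xmon_carrier[of
      "{}" n]])
  also have "b i \<star> b i = 0"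
  proof -
    have "\<alpha> \<inter> \<alpha> \<noteq> {}" using \<alpha> e by auto
    then show ?thesis
      using finite_index_set[OF \<alpha>(1)]
        by (simp add: bv gmul_scal_left gmul_scal_right xmon_mult scal_simps)
  qed
  finally have sS: "\<sigma> \<in> unimod_group n e" using s by (simp add: unimod_group_def)
  have xac: "scal l (xmon \<alpha>) \<in> gcar n" "xmon {} \<in> gcar n"
    by (intro gcar_closed(5) xmon_carrier \<alpha>(1), intro xmon_carrier empty_subsetI)
  have "rho n i j l \<alpha> = \<sigma>"
    unfolding rho_def
  proof (rule the_equality)
    show P: "\<sigma> \<in> Sigma' n \<and>
      \<sigma> (xgen i) = xgen i \<otimes>\<^bsub>Grassmann n\<^esub> (\<one>\<^bsub>Grassmann n\<^esub> \<oplus>\<^bsub>Grassmann n\<^esub> l \<odot>\<^bsub>Grassmann n\<^esub> xmon \<alpha>) \<and>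
      \<sigma> (xgen j) = xgen j \<otimes>\<^bsub>Grassmann n\<^esub> (\<one>\<^bsub>Grassmann n\<^esub> \<ominus>\<^bsub>Grassmann n\<^esub> l \<odot>\<^bsub>Grassmann n\<^esub> xmon \<alpha>) \<and>
      (\<forall>k\<in>{1..n} - {i, j}. \<sigma> (xgen k) = xgen k)"
      using sS unimod_group_subset_Sigma'[OF e(1), of n] ij
      by (auto simp: Grassmann_ops Grassmann_minus[OF xac(2,1)] x bv gmul_one[OF xgen_carrier])
    fix \<tau>
    assume Q: "\<tau> \<in> Sigma' n \<and>
      \<tau> (xgen i) = xgen i \<otimes>\<^bsub>Grassmann n\<^esub> (\<one>\<^bsub>Grassmann n\<^esub> \<oplus>\<^bsub>Grassmann n\<^esub> l \<odot>\<^bsub>Grassmann n\<^esub> xmon \<alpha>) \<and>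
      \<tau> (xgen j) = xgen j \<otimes>\<^bsub>Grassmann n\<^esub> (\<one>\<^bsub>Grassmann n\<^esub> \<ominus>\<^bsub>Grassmann n\<^esub> l \<odot>\<^bsub>Grassmann n\<^esub> xmon \<alpha>) \<and>
      (\<forall>k\<in>{1..n} - {i, j}. \<tau> (xgen k) = xgen k)"
    have "\<tau> (xgen k) = \<sigma> (xgen k)" if "k \<in> {1..n}" for k
      using P Q that by (cases "k = i"; cases "k = j") auto
    moreover have "\<tau> \<in> Grassmann_aut n" "\<sigma> \<in> Grassmann_aut n"
      using P Q Sigma'_subset_aut by blast+
    ultimately show "\<tau> = \<sigma>" by (rule Grassmann_aut_eqI[rotated 2])
  qed
  moreover have "lead n e \<sigma> = b"
  proof (intro ext)
    fix k \<beta>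
    show "lead n e \<sigma> k \<beta> = b k \<beta>"
    proof (cases "k \<in> {1..n} \<and> card \<beta> = e")
      case True
      show ?thesis
        by (rule lead_explicit[where b = "b k" and h = 0])
          (use True e x mono_span_mono[OF b, of k "\<lambda>\<alpha>. k \<notin> \<alpha>"] in \<open>auto simp: mono_span_closed\<close>)
    next
      case False
      then have "b k \<beta> = 0" using ij \<alpha> by (auto simp: b_def unit_vec_def xmon_def)
      then show ?thesis using False by (auto simp: lead_def)
    qed
  qed
  ultimately show "rho n i j l \<alpha> \<in> unimod_group n e"
    and "lead n e (rho n i j l \<alpha>) = (\<lambda>k. scal (l * (unit_vec i k - unit_vec j k)) (xmon \<alpha>))"
    using sS by (simp_all add: b_def[abs_def])
qed

text \<open>The existential condition on the tails c_i becomes a support condition on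
  \<open>lead\<close>, which is additive under composition.\<close>

lemma Phi'_eq:
  assumes s: "1 \<le> s"
  shows "Phi' n s = {\<sigma> \<in> unip_group n (2 * s). \<forall>i \<alpha>. lead n (2 * s) \<sigma> i \<alpha> \<noteq> 0 \<longrightarrow> {i+1..n} \<subseteq> \<alpha>}"
    (is "_ = ?R")
proof (intro equalityI subsetI)
  have P: "Phi_pow n (2 * s + 1) = unip_group n (2 * s)" using s by (intro Phi_pow_eq) auto
  fix \<sigma> :: "(nat set \<Rightarrow> 'a) \<Rightarrow> nat set \<Rightarrow> 'a"
  assume "\<sigma> \<in> Phi' n s"
  then have u: "\<sigma> \<in> unip_group n (2 * s)" unfolding Phi'_def P by blast
  have *: "\<exists>c\<in>mono_span n (\<lambda>\<alpha>. even (card \<alpha>) \<and> card \<alpha> \<ge> 2 \<and> i \<notin> \<alpha>).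
       \<sigma> (xgen i) = xgen i \<star> (xmon {} + c) \<and> hom_component (2 * s) c \<in> A_space n s i"
    if "i \<in> {1..n}" for i
    using that \<open>\<sigma> \<in> Phi' n s\<close> unfolding Phi'_def Grassmann_ops by blast
  have "{i+1..n} \<subseteq> \<alpha>" if nz: "lead n (2 * s) \<sigma> i \<alpha> \<noteq> 0" for i \<alpha>
  proof -
    have i: "i \<in> {1..n}" and \<alpha>: "card \<alpha> = 2 * s" using nz by (auto simp: lead_def split: if_splits)
    obtain c where c: "c \<in> mono_span n (\<lambda>\<alpha>. even (card \<alpha>) \<and> card \<alpha> \<ge> 2 \<and> i \<notin> \<alpha>)"
      "\<sigma> (xgen i) = xgen i \<star> (xmon {} + c)" "hom_component (2 * s) c \<in> A_space n s i"
      using *[OF i] by blast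
    have "lead n (2 * s) \<sigma> i \<alpha> = c \<alpha>"
      by (rule lead_explicit[where b = c and h = 0])
        (use c(2) mono_span_mono[OF c(1), of "\<lambda>\<alpha>. i \<notin> \<alpha>"] i \<alpha> s in \<open>auto simp: mono_span_closed\<close>)
    then have "hom_component (2 * s) c \<alpha> \<noteq> 0" using nz \<alpha> by (simp add: hom_component_def)
    then show ?thesis using c(3) by (simp add: A_space_def mono_span_iff)
  qed
  then show "\<sigma> \<in> ?R" using u by blast
next
  have P: "Phi_pow n (2 * s + 1) = unip_group n (2 * s)" using s by (intro Phi_pow_eq) auto
  fix \<sigma> :: "(nat set \<Rightarrow> 'a) \<Rightarrow> nat set \<Rightarrow> 'a"
  assume R: "\<sigma> \<in> ?R"
  then interpret unip_endo n \<sigma> "2 * s" by (simp add: unip_group_D)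
  have "\<exists>c\<in>mono_span n (\<lambda>\<alpha>. even (card \<alpha>) \<and> card \<alpha> \<ge> 2 \<and> i \<notin> \<alpha>).
       \<sigma> (xgen i) = xgen i \<star> (xmon {} + c) \<and> hom_component (2 * s) c \<in> A_space n s i"
    if i: "i \<in> {1..n}" for i
  proof (intro bexI conjI)
    \<comment> \<open>The only possible tail: divide \<sigma>(x_i) - x_i by x_i.\<close>
    let ?c = "skew_deriv i (\<sigma> (xgen i) - xgen i)"
    have c: "?c = skew_deriv i (\<sigma> (xgen i)) - xmon {}"
      by (simp add: skew_deriv_diff skew_deriv_generator)
    show "?c \<in> mono_span n (\<lambda>\<alpha>. even (card \<alpha>) \<and> card \<alpha> \<ge> 2 \<and> i \<notin> \<alpha>)"
      by (rule mono_span_mono[OF skew_deriv_level[OF i]]) (use s in auto)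
    have "\<sigma> (xgen i) \<in> mono_span n (\<lambda>\<alpha>. i \<in> \<alpha>)"
      by (rule in_mono_span) (use i in \<open>auto simp: xgen_def even_ext_def intro: xmon_in_mono_span\<close>)
    then show "\<sigma> (xgen i) = xgen i \<star> (xmon {} + ?c)"
      by (simp add: c xgen_mult_skew_deriv)
    show "hom_component (2 * s) ?c \<in> A_space n s i"
      unfolding A_space_def mono_span_iff
    proof (intro allI impI)
      fix \<alpha> assume nz: "hom_component (2 * s) ?c \<alpha> \<noteq> 0"
      then have \<alpha>: "card \<alpha> = 2 * s" by (auto simp: hom_component_def split: if_splits)
      then have "lead n (2 * s) \<sigma> i \<alpha> \<noteq> 0"
        using nz i s by (simp add: hom_component_def lead_def c fun_apply xmon_empty_apply)
      then show "\<alpha> \<subseteq> {1..n} \<and> card \<alpha> = 2 * s \<and> i \<notin> \<alpha> \<and> {i+1..n} \<subseteq> \<alpha>"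
        using R Vcar_D[OF lead_Vcar[OF alg_endo_axioms]] by blast
    qed
  qed
  then show "\<sigma> \<in> Phi' n s" using R unfolding Phi'_def P Grassmann_ops by blast
qed

text \<open>\<open>lead_explicit\<close> forces b, and the remainder after division by x_i and
  removal of the leading term serves as h. \<open>restrict\<close> passes from functions vanishing
  outside {1..n} to extensional ones.\<close>

lemma leading_terms_iff:
  assumes u: "\<sigma> \<in> unip_group n (2 * s)" and s: "1 \<le> s"
  shows "leading_terms n s \<sigma> b \<longleftrightarrow> b = restrict (lead n (2 * s) \<sigma>) {1..n}"
proof
  assume l: "leading_terms n s \<sigma> b"
  then have b: "b \<in> (\<Pi>\<^sub>E i\<in>{1..n}. hom_avoiding n (2 * s) i)" by (simp add: leading_terms_def)
  have "b i = lead n (2 * s) \<sigma> i" if i: "i \<in> {1..n}" for i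
  proof
    fix \<alpha>
    have bi: "b i \<in> mono_span n (\<lambda>\<alpha>. card \<alpha> = 2 * s \<and> i \<notin> \<alpha>)"
      using b i by (auto simp: hom_avoiding_def PiE_iff)
    obtain h where h: "h \<in> mono_span n (\<lambda>\<alpha>. card \<alpha> > 2 * s)"
      "\<sigma> (xgen i) = xgen i \<star> (xmon {} + b i + h)"
      using l i unfolding leading_terms_def Grassmann_ops by blast
    show "b i \<alpha> = lead n (2 * s) \<sigma> i \<alpha>"
    proof (cases "card \<alpha> = 2 * s")
      case True
      show ?thesis
        by (rule lead_explicit[where b = "b i" and h = h, symmetric])
          (use mono_span_mono[OF bi, of "\<lambda>\<alpha>. i \<notin> \<alpha>"] h i True s in auto)
    next
      case False
      then show ?thesis using bi by (auto simp: mono_span_iff lead_def)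
    qed
  qed
  then show "b = restrict (lead n (2 * s) \<sigma>) {1..n}"
    using b by (intro extensionalityI[of _ "{1..n}"]) (auto simp: PiE_iff)
next
  interpret unip_endo n \<sigma> "2 * s" using u by (rule unip_group_D)
  let ?l = "lead n (2 * s) \<sigma>"
  assume b: "b = restrict ?l {1..n}"
  have l: "?l i \<in> mono_span n (\<lambda>\<alpha>. card \<alpha> = 2 * s \<and> i \<notin> \<alpha>)" for i
    using Vcar_D[OF lead_Vcar[OF alg_endo_axioms]] unfolding mono_span_iff by blast
  have "\<exists>h\<in>mono_span n (\<lambda>\<alpha>. card \<alpha> > 2 * s). \<sigma> (xgen i) = xgen i \<star> (xmon {} + ?l i + h)"
    if i: "i \<in> {1..n}" for i
  proof
    let ?d = "skew_deriv i (\<sigma> (xgen i) - xgen i)"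
    have d: "?d = skew_deriv i (\<sigma> (xgen i)) - xmon {}"
      by (simp add: skew_deriv_diff skew_deriv_generator)
    show "?d - ?l i \<in> mono_span n (\<lambda>\<alpha>. card \<alpha> > 2 * s)"
      unfolding mono_span_iff
    proof (intro allI impI)
      fix \<alpha> assume nz: "(?d - ?l i) \<alpha> \<noteq> 0"
      have "?d - ?l i \<in> mono_span n (\<lambda>\<alpha>. 2 * s \<le> card \<alpha>)"
        by (rule mono_span_closed(3))
          (rule mono_span_mono[OF skew_deriv_level[OF i]] mono_span_mono[OF l[of i]]; simp)+
      then have "\<alpha> \<subseteq> {1..n}" "2 * s \<le> card \<alpha>" using nz by (auto simp: mono_span_iff)
      moreover have "card \<alpha> \<noteq> 2 * s"
        using nz i s by (auto simp: d lead_def fun_apply xmon_empty_apply)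
      ultimately show "\<alpha> \<subseteq> {1..n} \<and> 2 * s < card \<alpha>" by simp
    qed
    have "\<sigma> (xgen i) \<in> mono_span n (\<lambda>\<alpha>. i \<in> \<alpha>)"
      by (rule in_mono_span) (use i in \<open>auto simp: xgen_def even_ext_def intro: xmon_in_mono_span\<close>)
    then show "\<sigma> (xgen i) = xgen i \<star> (xmon {} + ?l i + (?d - ?l i))"
      by (simp add: d xgen_mult_skew_deriv)
  qed
  then show "leading_terms n s \<sigma> b"
    using l by (auto simp: leading_terms_def b Grassmann_ops hom_avoiding_def)
qed

section \<open>Decomposition of the leading terms\<close>

text \<open>Forward substitution for a triangular system: the value at k uses only the values at
  smaller indices.\<close>

fun solve_recurrence :: "(nat \<Rightarrow> 'a::comm_ring_1) \<Rightarrow> (nat \<Rightarrow> nat \<Rightarrow> 'a) \<Rightarrow> nat \<Rightarrow> 'a" where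
  "solve_recurrence b c k = b k + (\<Sum>i<k. c k i * solve_recurrence b c i)"

declare solve_recurrence.simps [simp del]

text \<open>The bound 2s < n is the range of s in the theorem. It gives n - 2s \<ge> 1 without
  truncation, so that the indices of the a_i lie in {1..n}.\<close>

locale avoidance =
  fixes n s :: nat and j :: "nat \<Rightarrow> nat set \<Rightarrow> nat"
  assumes s_pos: "1 \<le> s" and s_bound: "2 * s < n" and avoid: "avoidance_functions n s j"
begin

lemma S'_iff: "\<alpha> \<in> S' n s i \<longleftrightarrow> \<alpha> \<subseteq> {1..n} \<and> i \<notin> \<alpha> \<and> card \<alpha> = 2 * s \<and> \<not> {i+1..n} \<subseteq> \<alpha>"
  by (auto simp: S'_def)

lemma avoid_D:
  assumes "i \<in> {1..n-1}" "\<alpha> \<in> S' n s i"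
  shows "i < j i \<alpha>" "j i \<alpha> \<in> {1..n}" "j i \<alpha> \<notin> \<alpha>"
proof -
  have "j i \<alpha> \<in> {i+1..n} - \<alpha>" using avoid assms unfolding avoidance_functions_def by blast
  then show "i < j i \<alpha>" "j i \<alpha> \<in> {1..n}" "j i \<alpha> \<notin> \<alpha>" by auto
qed

lemma finite_S': "finite (S' n s i)"
  by (rule finite_subset[of _ "Pow {1..n}"]) (auto simp: S'_def)

definition rvec :: "(nat \<Rightarrow> nat set \<Rightarrow> 'k::comm_ring_1) \<Rightarrow> nat \<Rightarrow> nat set \<Rightarrow> nat \<Rightarrow> nat set \<Rightarrow> 'k" where
  "rvec lam i \<alpha> = (\<lambda>k. scal (lam i \<alpha> * (unit_vec i k - unit_vec (j i \<alpha>) k)) (xmon \<alpha>))"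

definition rsum :: "(nat \<Rightarrow> nat set \<Rightarrow> 'k::comm_ring_1) \<Rightarrow> nat \<Rightarrow> nat set \<Rightarrow> 'k" where
  "rsum lam = (\<Sum>i\<in>{1..n-1}. \<Sum>\<alpha>\<in>S' n s i. rvec lam i \<alpha>)"

text \<open>Extension by zero: an extensional \<open>a\<close> is \<open>undefined\<close> outside
  {n - 2s..n}.\<close>

definition avec :: "(nat \<Rightarrow> nat set \<Rightarrow> 'k::comm_ring_1) \<Rightarrow> nat \<Rightarrow> nat set \<Rightarrow> 'k" where
  "avec a = (\<lambda>k. if k \<in> {n - 2 * s..n} then a k else 0)"

lemma a_params_D:
  assumes "a \<in> a_params n s" "k \<in> {n - 2 * s..n}"
  shows "a k \<in> mono_span n (\<lambda>\<alpha>. card \<alpha> = 2 * s \<and> k \<notin> \<alpha> \<and> {k+1..n} \<subseteq> \<alpha>)"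
  using assms by (auto simp: a_params_def A_space_def PiE_iff)

lemma V_decomposition_iff:
  "V_decomposition n s j b lam a \<longleftrightarrow> lam \<in> lambda_params n s \<and> a \<in> a_params n s \<and>
    (\<forall>k\<in>{1..n}. b k = (rsum lam + avec a) k)"
proof -
  have "(\<Oplus>\<^bsub>Grassmann n\<^esub>i\<in>{1..n-1}. \<Oplus>\<^bsub>Grassmann n\<^esub>\<alpha>\<in>S' n s i.
          (lam i \<alpha> * (unit_vec i k - unit_vec (j i \<alpha>) k)) \<odot>\<^bsub>Grassmann n\<^esub> xmon \<alpha>)
       \<oplus>\<^bsub>Grassmann n\<^esub>
       (\<Oplus>\<^bsub>Grassmann n\<^esub>i\<in>{n - 2 * s..n}. unit_vec i k \<odot>\<^bsub>Grassmann n\<^esub> a i) = (rsum lam + avec a) k"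
    if a: "a \<in> a_params n s" for k
  proof -
    have x: "scal c (xmon \<alpha>) \<in> gcar n" if "\<alpha> \<in> S' n s i" for c i \<alpha>
      using that by (intro gcar_closed(5) xmon_carrier) (simp add: S'_iff)
    have ai: "scal c (a i) \<in> gcar n" if "i \<in> {n - 2 * s..n}" for c i
      by (intro gcar_closed(5) mono_span_carrier[OF a_params_D[OF a that]])
    have inner: "(\<Oplus>\<^bsub>Grassmann n\<^esub>\<alpha>\<in>S' n s i. scal (lam i \<alpha> * (unit_vec i k - unit_vec (j i \<alpha>) k)) (xmon \<alpha>))
        = (\<Sum>\<alpha>\<in>S' n s i. rvec lam i \<alpha> k)" for i
      unfolding rvec_def by (rule finsum_Grassmann) (rule x)
    have "rsum lam k = (\<Sum>i\<in>{1..n-1}. \<Sum>\<alpha>\<in>S' n s i. rvec lam i \<alpha> k)"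
      unfolding rsum_def by (subst sum_fun_apply, rule sum.cong, rule refl, rule sum_fun_apply)
    then have "(\<Oplus>\<^bsub>Grassmann n\<^esub>i\<in>{1..n-1}. \<Sum>\<alpha>\<in>S' n s i. rvec lam i \<alpha> k) = rsum lam k"
      by (simp only:) (rule finsum_Grassmann, auto intro!: gcar_sum x simp: rvec_def)
    moreover have "(\<Oplus>\<^bsub>Grassmann n\<^esub>i\<in>{n - 2 * s..n}. scal (unit_vec i k) (a i)) = avec a k"
    proof -
      have "(\<Oplus>\<^bsub>Grassmann n\<^esub>i\<in>{n - 2 * s..n}. scal (unit_vec i k) (a i)) =
          (\<Sum>i\<in>{n - 2 * s..n}. scal (unit_vec i k) (a i))"
        by (rule finsum_Grassmann) (rule ai)
      also have "\<dots> = (\<Sum>i\<in>{n - 2 * s..n}. if i = k then a k else 0)"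
        by (rule sum.cong) (auto simp: unit_vec_def scal_simps)
      also have "\<dots> = avec a k" by (simp add: avec_def)
      finally show ?thesis .
    qed
    ultimately show ?thesis by (simp only: Grassmann_ops inner fun_apply)
  qed
  then show ?thesis unfolding V_decomposition_def by auto
qed

text \<open>All unknowns at a fixed \<beta> in one family: at a vertex k of the tree that is not the
  root the unknown is the coefficient of the edge leaving k, at the root it is the coefficient from
  \<open>a\<close>. By \<open>avec_S'_zero\<close> the two summands never overlap.\<close>

definition mu ::
    "(nat \<Rightarrow> nat set \<Rightarrow> 'k::comm_ring_1) \<Rightarrow> (nat \<Rightarrow> nat set \<Rightarrow> 'k) \<Rightarrow> nat \<Rightarrow> nat set \<Rightarrow> 'k" where
  "mu lam a k \<beta> = (if k \<in> {1..n-1} \<and> \<beta> \<in> S' n s k then lam k \<beta> else 0) + avec a k \<beta>"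

text \<open>The indicator that k is the parent of i in the tree belonging to \<beta>.\<close>

definition edge :: "nat set \<Rightarrow> nat \<Rightarrow> nat \<Rightarrow> 'k::comm_ring_1" where
  "edge \<beta> k i = of_bool (i \<in> {1..n-1} \<and> \<beta> \<in> S' n s i \<and> j i \<beta> = k)"

lemma avec_S'_zero:
  assumes "a \<in> a_params n s" "\<beta> \<in> S' n s i"
  shows "avec a i \<beta> = 0"
  using a_params_D[OF assms(1), of i] assms(2)
    by (auto simp: avec_def mono_span_iff S'_iff fun_apply)

lemma edge_sum:
  "(\<Sum>i\<in>{1..n-1}. edge \<beta> k i * f i) = (\<Sum>i<k. edge \<beta> k i * f i)"
proof (rule sum.mono_neutral_cong)
  fix i assume "i \<in> {..<k} - {1..n-1}"
  then show "edge \<beta> k i * f i = 0" by (auto simp: edge_def)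
next
  fix i assume "i \<in> {1..n-1} - {..<k}"
  then show "edge \<beta> k i * f i = 0" using avoid_D(1)[of i \<beta>] by (auto simp: edge_def)
qed auto

text \<open>On the coefficients of a fixed \<open>x\<^sup>\<beta>\<close> the decomposition is a triangular linear system, as
  \<open>j\<^sub>i(\<beta>) > i\<close>.\<close>

lemma triangular:
  assumes a: "a \<in> a_params n s"
  shows "mu lam a k \<beta> = (rsum lam + avec a) k \<beta> + (\<Sum>i<k. edge \<beta> k i * mu lam a i \<beta>)"
proof -
  have "rsum lam k \<beta> = (\<Sum>i\<in>{1..n-1}. \<Sum>\<alpha>\<in>S' n s i. rvec lam i \<alpha> k \<beta>)"
    by (simp add: rsum_def sum_fun_apply)
  \<comment> \<open>The edge leaving k contributes with sign +, the edges arriving from its children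
    with sign -. At each child \<open>avec\<close> vanishes, so its edge coefficient is
    \<open>mu\<close>.\<close>
  also have "\<dots> = (\<Sum>i\<in>{1..n-1}. (if i = k then if \<beta> \<in> S' n s k then lam k \<beta> else 0 else 0)
      - edge \<beta> k i * mu lam a i \<beta>)"
  proof (rule sum.cong[OF refl])
    fix i assume i: "i \<in> {1..n-1}"
    have "(\<Sum>\<alpha>\<in>S' n s i. rvec lam i \<alpha> k \<beta>) =
        (\<Sum>\<alpha>\<in>S' n s i. if \<alpha> = \<beta> then lam i \<beta> * (unit_vec i k - unit_vec (j i \<beta>) k) else 0)"
      by (rule sum.cong) (auto simp: rvec_def xmon_def)
    also have "\<dots> = (if \<beta> \<in> S' n s i then lam i \<beta> * (unit_vec i k - unit_vec (j i \<beta>) k) else 0)"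
      by (simp add: finite_S')
    also have "\<dots> = (if i = k then if \<beta> \<in> S' n s k then lam k \<beta> else 0 else 0)
        - edge \<beta> k i * mu lam a i \<beta>"
      using i avec_S'_zero[OF a, of \<beta> i] by (auto simp: edge_def mu_def unit_vec_def)
    finally show "(\<Sum>\<alpha>\<in>S' n s i. rvec lam i \<alpha> k \<beta>) = \<dots>" .
  qed
  also have "\<dots> = (if k \<in> {1..n-1} \<and> \<beta> \<in> S' n s k then lam k \<beta> else 0)
      - (\<Sum>i<k. edge \<beta> k i * mu lam a i \<beta>)"
    unfolding sum_subtractf edge_sum by simp
  finally show ?thesis by (simp add: mu_def fun_apply)
qed

text \<open>Solve the triangular system for each \<beta> separately and store the solution as
  \<lambda> or as a, according to whether the vertex is the root.\<close>

lemma decomposition_exists: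
  assumes b: "b \<in> Vcar n (2 * s)"
  obtains lam a where "lam \<in> lambda_params n s" "a \<in> a_params n s" "b = rsum lam + avec a"
proof -
  define m where "m \<beta> = solve_recurrence (\<lambda>k. b k \<beta>) (edge \<beta>)" for \<beta>
  have m: "m \<beta> k = b k \<beta> + (\<Sum>i<k. edge \<beta> k i * m \<beta> i)" for \<beta> k
    unfolding m_def by (rule solve_recurrence.simps)
  define lam where "lam = (\<lambda>i\<in>{1..n-1}. \<lambda>\<alpha>\<in>S' n s i. m \<alpha> i)"
  define a where "a = (\<lambda>i\<in>{n - 2 * s..n}. \<lambda>\<beta>.
      if \<beta> \<subseteq> {1..n} \<and> card \<beta> = 2 * s \<and> i \<notin> \<beta> \<and> {i+1..n} \<subseteq> \<beta> then m \<beta> i else 0)"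
  have lam: "lam \<in> lambda_params n s" by (auto simp: lam_def lambda_params_def)
  have a: "a \<in> a_params n s" by (auto simp: a_def a_params_def A_space_def mono_span_iff)
  have mu: "mu lam a k \<beta> = m \<beta> k" for k \<beta>
  proof (cases "k \<in> {1..n} \<and> \<beta> \<subseteq> {1..n} \<and> card \<beta> = 2 * s \<and> k \<notin> \<beta>")
    case True
    then have k: "k \<in> {1..n}" and \<beta>: "\<beta> \<subseteq> {1..n}" "card \<beta> = 2 * s" "k \<notin> \<beta>" by auto
    show ?thesis
    proof (cases "{k+1..n} \<subseteq> \<beta>")
      case sub: True
      \<comment> \<open>A root k has all n - k larger indices in \<beta>, so n - k \<le> 2s and k is
        in the range of the a_i.\<close>
      have "card {k+1..n} \<le> 2 * s" using card_mono[OF finite_index_set[OF \<beta>(1)] sub] \<beta>(2) by simp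
      then have "k \<in> {n - 2 * s..n}" using k by auto
      moreover have "\<beta> \<notin> S' n s k" using sub by (simp add: S'_iff)
      ultimately show ?thesis using \<beta> sub by (simp add: mu_def avec_def a_def)
    next
      case False
      then have "k \<noteq> n" by auto
      then have "k \<in> {1..n-1}" using k by auto
      moreover have "\<beta> \<in> S' n s k" using \<beta> False by (simp add: S'_iff)
      ultimately show ?thesis using avec_S'_zero[OF a] by (simp add: mu_def lam_def)
    qed
  next
    case False
    then have "b k \<beta> = 0" using Vcar_D[OF b] by blast
    \<comment> \<open>An inadmissible vertex has no incoming edges by \<open>avoid_D\<close>, so the
      recurrence gives zero there.\<close>
    moreover have "edge \<beta> k i = (0 :: 'a)" for i
      using False avoid_D[of i \<beta>] by (auto simp: edge_def S'_iff)
    ultimately have "m \<beta> k = 0" using m[of \<beta> k] by simp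
    moreover have "mu lam a k \<beta> = 0"
      using False s_bound by (auto simp: mu_def avec_def a_def S'_iff fun_apply)
    ultimately show ?thesis by simp
  qed
  have "b = rsum lam + avec a"
  proof (intro ext)
    fix k \<beta>
    have "(rsum lam + avec a) k \<beta> + (\<Sum>i<k. edge \<beta> k i * m \<beta> i) =
        b k \<beta> + (\<Sum>i<k. edge \<beta> k i * m \<beta> i)"
      using triangular[OF a, of lam k \<beta>] m[of \<beta> k] by (simp add: mu)
    then show "b k \<beta> = (rsum lam + avec a) k \<beta>" by simp
  qed
  then show ?thesis using lam a that by blast
qed

text \<open>The triangular system determines \<open>mu\<close> in increasing order of k, and both
  parameter families can be read off from \<open>mu\<close>.\<close>

lemma decomposition_unique:
  assumes lam: "lam \<in> lambda_params n s" "lam' \<in> lambda_params n s"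
    and a: "a \<in> a_params n s" "a' \<in> a_params n s"
    and eq: "\<And>k. k \<in> {1..n} \<Longrightarrow> (rsum lam + avec a) k = (rsum lam' + avec a') k"
  shows "lam = lam'" "a = a'"
proof -
  have mu: "mu lam a k \<beta> = mu lam' a' k \<beta>" if "k \<in> {1..n}" for k \<beta>
    using that
  proof (induction k rule: less_induct)
    case (less k)
    have "edge \<beta> k i * mu lam a i \<beta> = edge \<beta> k i * mu lam' a' i \<beta>" if "i < k" for i
      using less.IH[OF that] by (cases "i \<in> {1..n}") (auto simp: edge_def)
    then show ?case
      using triangular[OF a(1), of lam k \<beta>] triangular[OF a(2), of lam' k \<beta>] eq[OF less.prems]
      by simp
  qed
  have "lam i \<alpha> = lam' i \<alpha>" if "i \<in> {1..n-1}" "\<alpha> \<in> S' n s i" for i \<alpha>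
  proof -
    have "i \<in> {1..n}" using that by auto
    from mu[OF this, of \<alpha>] show ?thesis
      using that by (simp add: mu_def avec_S'_zero[OF a(1)] avec_S'_zero[OF a(2)])
  qed
  then have "lam i = lam' i" if "i \<in> {1..n-1}" for i
    using that PiE_mem[OF lam(1)[unfolded lambda_params_def] that]
      PiE_mem[OF lam(2)[unfolded lambda_params_def] that] by (intro PiE_ext) auto
  then show "lam = lam'" by (rule PiE_ext[OF lam[unfolded lambda_params_def]])
  have "a i \<beta> = a' i \<beta>" if i: "i \<in> {n - 2 * s..n}" for i \<beta>
  proof (cases "\<beta> \<in> S' n s i")
    case True
    then show ?thesis
      using avec_S'_zero[OF a(1) True] avec_S'_zero[OF a(2) True] i by (simp add: avec_def)
  next
    case False
    have "i \<in> {1..n}" using i s_bound by auto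
    from mu[OF this, of \<beta>] show ?thesis using False i by (simp add: mu_def avec_def)
  qed
  then show "a = a'"
    by (intro PiE_ext[OF a[unfolded a_params_def]]) auto
qed

section \<open>Realising vectors of V by automorphisms\<close>

lemma rho_unimod_group:
  assumes "i \<in> {1..n-1}" "\<alpha> \<in> S' n s i"
  shows "rho n i (j i \<alpha>) (lam i \<alpha>) \<alpha> \<in> unimod_group n (2 * s)"
    "lead n (2 * s) (rho n i (j i \<alpha>) (lam i \<alpha>) \<alpha>) = rvec lam i \<alpha>"
proof -
  have i: "i \<in> {1..n}" "i \<noteq> j i \<alpha>" using assms(1) avoid_D(1)[OF assms] by auto
  have \<alpha>: "\<alpha> \<subseteq> {1..n}" "card \<alpha> = 2 * s" "i \<notin> \<alpha>" using assms(2) by (auto simp: S'_iff)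
  have e: "2 \<le> 2 * s" "even (2 * s)" using s_pos by auto
  note rho = rho_properties[OF e i(1) avoid_D(2)[OF assms] i(2) \<alpha> avoid_D(3)[OF assms]]
  show "rho n i (j i \<alpha>) (lam i \<alpha>) \<alpha> \<in> unimod_group n (2 * s)" by (rule rho(1))
  show "lead n (2 * s) (rho n i (j i \<alpha>) (lam i \<alpha>) \<alpha>) = rvec lam i \<alpha>"
    unfolding rvec_def by (rule rho(2))
qed

lemma lead_phi:
  assumes a: "a \<in> a_params n s"
    and fixed: "\<forall>k\<in>{1..<n - 2 * s}. \<phi> (xgen k) = xgen k"
    and im: "\<forall>i\<in>{n - 2 * s..n}. \<phi> (xgen i) = xgen i \<star> (xmon {} + a i)"
  shows "lead n (2 * s) \<phi> = avec a"
proof (intro ext)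
  fix k \<beta>
  have e: "1 \<le> 2 * s" using s_pos by simp
  show "lead n (2 * s) \<phi> k \<beta> = avec a k \<beta>"
  proof (cases "k \<in> {1..n} \<and> card \<beta> = 2 * s")
    case True
    then have k: "k \<in> {1..n}" and \<beta>: "card \<beta> = 2 * s" by auto
    have "avec a k \<in> mono_span n (\<lambda>\<alpha>. k \<notin> \<alpha>)"
    proof (cases "k \<in> {n - 2 * s..n}")
      case True
      then have "avec a k = a k" by (simp add: avec_def)
      then show ?thesis using mono_span_mono[OF a_params_D[OF a True], of "\<lambda>\<alpha>. k \<notin> \<alpha>"] by simp
    next
      case False
      then have "avec a k = 0" by (simp only: avec_def if_False)
      then show ?thesis by (simp add: mono_span_closed)
    qed
    moreover have "\<phi> (xgen k) = xgen k \<star> (xmon {} + avec a k + 0)"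
      using fixed im k
        by (cases "k \<in> {n - 2 * s..n}") (auto simp: avec_def gmul_one[OF xgen_carrier[OF k]])
    ultimately show ?thesis
      by (intro lead_explicit[where h = 0]) (use k \<beta> e in \<open>auto simp: mono_span_closed\<close>)
  next
    case False
    have "avec a k \<beta> = 0"
    proof (cases "k \<in> {n - 2 * s..n}")
      case True
      then have "k \<in> {1..n}" using s_bound by auto
      then have "card \<beta> \<noteq> 2 * s" using False by blast
      then show ?thesis using a_params_D[OF a True] True by (auto simp: avec_def mono_span_iff)
    qed (auto simp: avec_def fun_apply)
    then show ?thesis using False by (auto simp: lead_def)
  qed
qed

lemma phi_exists:
  assumes a: "a \<in> a_params n s"
  obtains \<phi> where "\<phi> \<in> Phi' n s" "\<forall>k\<in>{1..<n - 2 * s}. \<phi> (xgen k) = xgen k"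
    "\<forall>i\<in>{n - 2 * s..n}. \<phi> (xgen i) = xgen i \<star> (xmon {} + a i)"
proof -
  have av: "avec a i \<in> mono_span n (\<lambda>\<alpha>. even (card \<alpha>) \<and> 2 * s \<le> card \<alpha> \<and> i \<notin> \<alpha>)" for i
  proof (cases "i \<in> {n - 2 * s..n}")
    case True
    then have "avec a i = a i" by (simp add: avec_def)
    then show ?thesis
      using mono_span_mono[OF a_params_D[OF a True], of
        "\<lambda>\<alpha>. even (card \<alpha>) \<and> 2 * s \<le> card \<alpha> \<and> i \<notin> \<alpha>"]
      by simp
  next
    case False
    then have "avec a i = 0" by (simp only: avec_def if_False)
    then show ?thesis by (simp add: mono_span_closed)
  qed
  obtain \<phi> where p: "\<phi> \<in> unip_group n (2 * s)"
    "\<And>i. i \<in> {1..n} \<Longrightarrow> \<phi> (xgen i) = xgen i \<star> (xmon {} + avec a i)"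
    by (rule unip_group_exists[of "2 * s" n "avec a"]) (use s_pos av in auto)
  have 1: "\<forall>k\<in>{1..<n - 2 * s}. \<phi> (xgen k) = xgen k"
  proof
    fix k assume "k \<in> {1..<n - 2 * s}"
    then have k: "k \<in> {1..n}" "k \<notin> {n - 2 * s..n}" by auto
    from k(2) have "avec a k = 0" by (simp only: avec_def if_False)
    then show "\<phi> (xgen k) = xgen k"
      using p(2)[OF k(1)] by (simp add: gmul_one[OF xgen_carrier[OF k(1)]])
  qed
  have 2: "\<forall>i\<in>{n - 2 * s..n}. \<phi> (xgen i) = xgen i \<star> (xmon {} + a i)"
  proof
    fix i assume i: "i \<in> {n - 2 * s..n}"
    then have "i \<in> {1..n}" using s_bound by auto
    then show "\<phi> (xgen i) = xgen i \<star> (xmon {} + a i)" using p(2)[of i] i by (simp add: avec_def)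
  qed
  have "{i+1..n} \<subseteq> \<alpha>" if "avec a i \<alpha> \<noteq> 0" for i \<alpha>
    using that a_params_D[OF a, of i]
      by (auto simp: avec_def mono_span_iff fun_apply split: if_splits)
  then have "\<phi> \<in> Phi' n s"
    using p(1) by (simp add: Phi'_eq[OF s_pos] lead_phi[OF a 1 2])
  then show ?thesis using 1 2 that by blast
qed

text \<open>The leading vectors of a group of unipotent automorphisms are closed under addition, so
  the sum is reached without choosing an order for a product of the \<open>rho\<close>.\<close>

lemma rsum_lead: "\<exists>g\<in>unimod_group n (2 * s). lead n (2 * s) g = rsum lam"
proof -
  interpret A: subgroup "unimod_group n (2 * s)" "BijGroup (gcar n)"
    using s_pos by (intro subgroup_unimod_group) simp
  let ?L = "lead n (2 * s) ` unimod_group n (2 * s)"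
  have U: "unimod_group n (2 * s) \<subseteq> unip_group n (2 * s)" by (auto simp: unimod_group_def)
  have plus: "v + w \<in> ?L" if vw: "v \<in> ?L" "w \<in> ?L" for v w
  proof -
    obtain x y where xy: "x \<in> unimod_group n (2 * s)" "y \<in> unimod_group n (2 * s)"
      "v = lead n (2 * s) x" "w = lead n (2 * s) y"
      using vw by auto
    then have "v + w = lead n (2 * s) (x \<otimes>\<^bsub>BijGroup (gcar n)\<^esub> y)"
      using s_pos U by (subst lead_mult) auto
    then show ?thesis using xy(1,2) by auto
  qed
  have "rvec lam i \<alpha> \<in> ?L" if "i \<in> {1..n-1}" "\<alpha> \<in> S' n s i" for i \<alpha>
    using rho_unimod_group[OF that, of lam] by (metis imageI)
  moreover have "0 \<in> ?L"
  proof -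
    have "\<one>\<^bsub>BijGroup (gcar n)\<^esub> \<in> unip_group n (2 * s + 2)"
      by (rule subgroup.one_closed[OF subgroup_unip_group]) simp
    then have "lead n (2 * s) \<one>\<^bsub>BijGroup (gcar n)\<^esub> = 0"
      using U A.one_closed s_pos by (subst lead_eq_zero_iff) auto
    then show ?thesis using A.one_closed by (metis imageI)
  qed
  ultimately have "rsum lam \<in> ?L"
    unfolding rsum_def by (intro sum_in_additive plus) auto
  then show ?thesis by auto
qed

text \<open>For fixed \<alpha> at most one component can be nonzero, so the trace relation reduces
  to this single term.\<close>

lemma unimod_group_Phi'_lead:
  assumes x: "x \<in> unimod_group n (2 * s)" and y: "y \<in> Phi' n s"
    and eq: "lead n (2 * s) x = lead n (2 * s) y"
  shows "lead n (2 * s) x = 0"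
proof (rule ccontr)
  assume "lead n (2 * s) x \<noteq> 0"
  then obtain i \<alpha> where nz: "lead n (2 * s) x i \<alpha> \<noteq> 0" by (auto simp: fun_eq_iff fun_apply)
  have "alg_endo n x"
    using x by (intro unip_group_D(3)[of x n "2 * s"]) (simp add: unimod_group_def)
  note V = Vcar_D[OF lead_Vcar[OF this]]
  have sub: "{k+1..n} \<subseteq> \<alpha>" if "lead n (2 * s) x k \<alpha> \<noteq> 0" for k
    using y that unfolding Phi'_eq[OF s_pos] eq by blast
  \<comment> \<open>With two nonzero components the larger index would lie in \<alpha> by the
    condition at the smaller one, but its own component excludes it from \<alpha>.\<close>
  have only: "lead n (2 * s) x k \<alpha> = 0" if "k \<noteq> i" for k
  proof (rule ccontr)
    assume nzk: "lead n (2 * s) x k \<alpha> \<noteq> 0"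
    have "i \<in> {k+1..n} \<or> k \<in> {i+1..n}" using V[OF nz] V[OF nzk] that by auto
    then show False using sub[OF nz] sub[OF nzk] V[OF nz] V[OF nzk] by blast
  qed
  have c: "card \<alpha> = 2 * s" and i: "i \<in> {1..n}" using V[OF nz] by auto
  have "(\<Sum>k\<in>{1..n}. lead n (2 * s) x k \<alpha>) = (\<Sum>k\<in>{1..n}. skew_deriv k (x (xgen k)) \<alpha>)"
    by (rule sum.cong) (auto simp: lead_def c)
  also have "\<dots> = 0" by (rule unimod_group_trace[OF x _ c]) (use s_pos in simp)
  finally have "(\<Sum>k\<in>{1..n}. lead n (2 * s) x k \<alpha>) = 0" .
  moreover have
    "(\<Sum>k\<in>{1..n}. lead n (2 * s) x k \<alpha>) = (\<Sum>k\<in>{1..n}. if k = i then lead n (2 * s) x i \<alpha> else 0)"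
    by (rule sum.cong) (auto simp: only)
  ultimately show False using nz i by simp
qed

text \<open>Used twice: the two images generate V, and \<open>lead\<close> is surjective.\<close>

lemma decomposition_lead:
  assumes "v \<in> Vcar n (2 * s)"
  shows "\<exists>x\<in>unimod_group n (2 * s). \<exists>y\<in>Phi' n s. v = lead n (2 * s) x + lead n (2 * s) y"
proof -
  obtain lam a where la: "a \<in> a_params n s" "v = rsum lam + avec a"
    using decomposition_exists[OF assms] by blast
  obtain \<phi> where p: "\<phi> \<in> Phi' n s" "\<forall>k\<in>{1..<n - 2 * s}. \<phi> (xgen k) = xgen k"
    "\<forall>i\<in>{n - 2 * s..n}. \<phi> (xgen i) = xgen i \<star> (xmon {} + a i)"
    using phi_exists[OF la(1)] by blast
  obtain g where "g \<in> unimod_group n (2 * s)" "lead n (2 * s) g = rsum lam" using rsum_lead by blast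
  then show ?thesis using p(1) lead_phi[OF la(1) p(2,3)] la(2) by metis
qed

section \<open>Transfer from V to the groups\<close>

lemma lead_hom:
  "lead n (2 * s) \<in> hom (BijGroup (gcar n)\<lparr>carrier := unip_group n (2 * s)\<rparr>) (Vgrp n (2 * s))"
  using s_pos by (auto simp: hom_def Vgrp_def unip_group_D lead_Vcar lead_mult)

lemma lead_kernel:
  "unip_group n (2 * s + 2) = {\<sigma> \<in> unip_group n (2 * s). lead n (2 * s) \<sigma> = \<one>\<^bsub>Vgrp n (2 * s)\<^esub>}"
  using s_pos unip_group_mono[of "2 * s" "2 * s + 2" n] lead_eq_zero_iff[of _ n "2 * s"]
  by (auto simp: Vgrp_def)

text \<open>\<open>Phi'\<close> is the preimage under the additive map \<open>lead\<close> of the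
  vectors with a prescribed support, which form a subgroup of V.\<close>

lemma subgroup_Phi':
  "subgroup (Phi' n s) (BijGroup (gcar n :: (nat set \<Rightarrow> 'k::comm_ring_1) set))" (is "subgroup _ ?G")
proof -
  interpret G: group ?G by (rule group_BijGroup)
  interpret U: subgroup "unip_group n (2 * s)" ?G using s_pos by (intro subgroup_unip_group) simp
  let ?L = "lead n (2 * s)"
  have mult: "?L (x \<otimes>\<^bsub>?G\<^esub> y) = ?L x + ?L y"
    if "x \<in> unip_group n (2 * s)" "y \<in> unip_group n (2 * s)" for x y
    using that s_pos by (intro lead_mult) auto
  have one: "?L \<one>\<^bsub>?G\<^esub> = 0"
    using mult[of "\<one>\<^bsub>?G\<^esub>" "\<one>\<^bsub>?G\<^esub>"]
      by (simp only: U.one_closed G.l_one[OF G.one_closed] add_cancel_right_right)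
  show ?thesis unfolding Phi'_eq[OF s_pos]
  proof
    fix x y :: "(nat set \<Rightarrow> 'k) \<Rightarrow> nat set \<Rightarrow> 'k"
    assume "x \<in> {\<sigma> \<in> unip_group n (2 * s). \<forall>i \<alpha>. ?L \<sigma> i \<alpha> \<noteq> 0 \<longrightarrow> {i+1..n} \<subseteq> \<alpha>}"
      "y \<in> {\<sigma> \<in> unip_group n (2 * s). \<forall>i \<alpha>. ?L \<sigma> i \<alpha> \<noteq> 0 \<longrightarrow> {i+1..n} \<subseteq> \<alpha>}"
    then have xy: "x \<in> unip_group n (2 * s)" "y \<in> unip_group n (2 * s)"
      and sub: "\<And>i \<alpha>. ?L x i \<alpha> \<noteq> 0 \<Longrightarrow> {i+1..n} \<subseteq> \<alpha>" "\<And>i \<alpha>. ?L y i \<alpha> \<noteq> 0 \<Longrightarrow> {i+1..n} \<subseteq> \<alpha>"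
      by blast+
    have "{i+1..n} \<subseteq> \<alpha>" if "?L (x \<otimes>\<^bsub>?G\<^esub> y) i \<alpha> \<noteq> 0" for i \<alpha>
    proof -
      have "?L x i \<alpha> \<noteq> 0 \<or> ?L y i \<alpha> \<noteq> 0" using that by (auto simp: mult[OF xy] fun_apply)
      then show ?thesis using sub by blast
    qed
    then show "x \<otimes>\<^bsub>?G\<^esub> y \<in> {\<sigma> \<in> unip_group n (2 * s). \<forall>i \<alpha>. ?L \<sigma> i \<alpha> \<noteq> 0 \<longrightarrow> {i+1..n} \<subseteq> \<alpha>}"
      using U.m_closed[OF xy] by blast
  next
    fix x :: "(nat set \<Rightarrow> 'k) \<Rightarrow> nat set \<Rightarrow> 'k"
    assume x: "x \<in> {\<sigma> \<in> unip_group n (2 * s). \<forall>i \<alpha>. ?L \<sigma> i \<alpha> \<noteq> 0 \<longrightarrow> {i+1..n} \<subseteq> \<alpha>}"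
    then have u: "x \<in> unip_group n (2 * s)" by simp
    have "?L (inv\<^bsub>?G\<^esub> x) + ?L x = 0"
      using mult[OF U.m_inv_closed[OF u] u] u by (simp add: one)
    then have "?L (inv\<^bsub>?G\<^esub> x) = - ?L x" by (simp add: eq_neg_iff_add_eq_0)
    then show "inv\<^bsub>?G\<^esub> x \<in> {\<sigma> \<in> unip_group n (2 * s). \<forall>i \<alpha>. ?L \<sigma> i \<alpha> \<noteq> 0 \<longrightarrow> {i+1..n} \<subseteq> \<alpha>}"
      using x U.m_inv_closed[OF u] by (simp add: fun_apply)
  qed (use U.subset one in \<open>auto simp: fun_apply\<close>)
qed

text \<open>A coset modulo \<Phi>^{2s+3} is determined by its leading vector, so the congruence
  becomes one equation in V.\<close>

lemma factorization_iff:
  fixes \<sigma> :: "(nat set \<Rightarrow> 'k::comm_ring_1) \<Rightarrow> nat set \<Rightarrow> 'k"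
  assumes \<sigma>: "\<sigma> \<in> unip_group n (2 * s)"
    and n: "unip_group n (2 * s + 2) \<lhd> BijGroup (gcar n :: (nat set \<Rightarrow> 'k) set)\<lparr>carrier := unip_group n (2 * s)\<rparr>"
    and Q: "comm_group (BijGroup (gcar n :: (nat set \<Rightarrow> 'k) set)\<lparr>carrier := unip_group n (2 * s)\<rparr> Mod unip_group n (2 * s + 2))"
  shows "factorization n s j \<sigma> \<phi> lam a \<longleftrightarrow>
    \<phi> \<in> Phi' n s \<and> lam \<in> lambda_params n s \<and> a \<in> a_params n s \<and>
    (\<forall>k\<in>{1..<n - 2 * s}. \<phi> (xgen k) = xgen k) \<and>
    (\<forall>i\<in>{n - 2 * s..n}. \<phi> (xgen i) = xgen i \<star> (xmon {} + a i)) \<and>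
    lead n (2 * s) \<sigma> = rsum lam + avec a"
proof -
  let ?G = "BijGroup (gcar n) :: ((nat set \<Rightarrow> 'k) \<Rightarrow> nat set \<Rightarrow> 'k) monoid"
  let ?H = "unip_group n (2 * s)" and ?N = "unip_group n (2 * s + 2)" and ?L = "lead n (2 * s)"
  let ?Q = "?G\<lparr>carrier := ?H\<rparr> Mod ?N"
  have P: "Phi_pow n (2 * s + 1) = (?H :: ((nat set \<Rightarrow> 'k) \<Rightarrow> nat set \<Rightarrow> 'k) set)"
    "Phi_pow n (2 * s + 3) = (?N :: ((nat set \<Rightarrow> 'k) \<Rightarrow> nat set \<Rightarrow> 'k) set)"
    using s_pos by (intro Phi_pow_eq; simp)+
  have H: "subgroup ?H ?G" using s_pos by (intro subgroup_unip_group) simp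
  have mult: "?L (x \<otimes>\<^bsub>?G\<^esub> y) = ?L x + ?L y" if "x \<in> ?H" "y \<in> ?H" for x y
    using that s_pos by (intro lead_mult) auto
  interpret G: group ?G by (rule group_BijGroup)
  have one: "?L \<one>\<^bsub>?G\<^esub> = 0"
    using mult[OF subgroup.one_closed[OF H] subgroup.one_closed[OF H]]
    by (simp only: G.l_one[OF G.one_closed] add_cancel_right_right)
  have multB: "\<forall>x\<in>?H. \<forall>y\<in>?H. ?L (x \<otimes>\<^bsub>?G\<^esub> y) = ?L x + ?L y" using mult by blast
  \<comment> \<open>Each product of cosets is represented by some g about which only the leading
    vector is recorded; this is enough for the outer product and for comparing cosets.\<close>
  have inner: "\<exists>g\<in>?H. (\<Otimes>\<^bsub>?Q\<^esub>\<alpha>\<in>S' n s i. ?N #>\<^bsub>?G\<^esub> rho n i (j i \<alpha>) (lam i \<alpha>) \<alpha>) = ?N #>\<^bsub>?G\<^esub> g \<and>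
      ?L g = (\<Sum>\<alpha>\<in>S' n s i. rvec lam i \<alpha>)" if i: "i \<in> {1..n-1}" for i
  proof (rule finprod_coset[where L = ?L, OF H n Q multB one])
    fix \<alpha> assume "\<alpha> \<in> S' n s i"
    then show "\<exists>g\<in>?H. ?N #>\<^bsub>?G\<^esub> rho n i (j i \<alpha>) (lam i \<alpha>) \<alpha> = ?N #>\<^bsub>?G\<^esub> g \<and> ?L g = rvec lam i \<alpha>"
      using rho_unimod_group[OF i, of \<alpha> lam] by (auto simp: unimod_group_def)
  qed
  have "\<exists>g\<in>?H. (\<Otimes>\<^bsub>?Q\<^esub>i\<in>{1..n-1}. \<Otimes>\<^bsub>?Q\<^esub>\<alpha>\<in>S' n s i. ?N #>\<^bsub>?G\<^esub> rho n i (j i \<alpha>) (lam i \<alpha>) \<alpha>)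
      = ?N #>\<^bsub>?G\<^esub> g \<and> ?L g = rsum lam"
    unfolding rsum_def by (rule finprod_coset[where L = ?L, OF H n Q multB one], rule inner)
  then obtain g where g: "g \<in> ?H" "?L g = rsum lam"
    "(\<Otimes>\<^bsub>?Q\<^esub>i\<in>{1..n-1}. \<Otimes>\<^bsub>?Q\<^esub>\<alpha>\<in>S' n s i. ?N #>\<^bsub>?G\<^esub> rho n i (j i \<alpha>) (lam i \<alpha>) \<alpha>) = ?N #>\<^bsub>?G\<^esub> g"
    by blast
  have "?N #>\<^bsub>?G\<^esub> \<sigma> = (?N #>\<^bsub>?G\<^esub> \<phi>) \<otimes>\<^bsub>?Q\<^esub>
      (\<Otimes>\<^bsub>?Q\<^esub>i\<in>{1..n-1}. \<Otimes>\<^bsub>?Q\<^esub>\<alpha>\<in>S' n s i. ?N #>\<^bsub>?G\<^esub> rho n i (j i \<alpha>) (lam i \<alpha>) \<alpha>) \<longleftrightarrow>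
      ?L \<sigma> = rsum lam + avec a"
    if p: "\<phi> \<in> Phi' n s" "a \<in> a_params n s" "\<forall>k\<in>{1..<n - 2 * s}. \<phi> (xgen k) = xgen k"
      "\<forall>i\<in>{n - 2 * s..n}. \<phi> (xgen i) = xgen i \<star> (xmon {} + a i)"
  proof -
    have u: "\<phi> \<in> ?H" using p(1) by (simp add: Phi'_eq[OF s_pos])
    have "?N #>\<^bsub>?G\<^esub> \<sigma> = ?N #>\<^bsub>?G\<^esub> (\<phi> \<otimes>\<^bsub>?G\<^esub> g) \<longleftrightarrow> ?L \<sigma> = ?L (\<phi> \<otimes>\<^bsub>?G\<^esub> g)"
      by (rule coset_eq_iff[OF group_BijGroup H comm_group.axioms(2)[OF comm_group_Vgrp] lead_hom lead_kernel \<sigma>])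
        (rule subgroup.m_closed[OF H u g(1)])
    then show ?thesis
      unfolding g(3) coset_mult[OF n u g(1)] mult[OF u g(1)] g(2) lead_phi[OF p(2,3,4)]
      by (simp add: add.commute)
  qed
  then show ?thesis
    unfolding factorization_def Let_def P Grassmann_ops by blast
qed

end

theorem theorem5p4:
  fixes n s :: nat
    and j :: "nat \<Rightarrow> nat set \<Rightarrow> nat"
    and G :: "((nat set \<Rightarrow> 'k::comm_ring_1) \<Rightarrow> nat set \<Rightarrow> 'k) monoid"
  defines "G \<equiv> BijGroup (carrier (Grassmann n))"
  assumes "n \<ge> 4"
    and "1 \<le> s" and "s \<le> (n - 1) div 2"
    and "avoidance_functions n s j"
  shows
    "(Phi_pow n (2 * s + 1) = Phi' n s <#>\<^bsub>G\<^esub> Sigma'_pow n (2 * s + 1) \<and>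
      Phi_pow n (2 * s + 1) = Sigma'_pow n (2 * s + 1) <#>\<^bsub>G\<^esub> Phi' n s)
     \<and>
     (Phi_pow n (2 * s + 3) \<lhd> G\<lparr>carrier := Phi_pow n (2 * s + 1)\<rparr> \<and>
      Sigma'_pow n (2 * s + 3) \<lhd> G\<lparr>carrier := Sigma'_pow n (2 * s + 1)\<rparr> \<and>
      Phi_pow n (2 * s + 3) \<lhd> G\<lparr>carrier := Phi' n s\<rparr> \<and>
      comm_group (G\<lparr>carrier := Phi_pow n (2 * s + 1)\<rparr> Mod Phi_pow n (2 * s + 3)) \<and>
      comm_group (G\<lparr>carrier := Sigma'_pow n (2 * s + 1)\<rparr> Mod Sigma'_pow n (2 * s + 3)) \<and>
      comm_group (G\<lparr>carrier := Phi' n s\<rparr> Mod Phi_pow n (2 * s + 3)) \<and>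
      (G\<lparr>carrier := Phi_pow n (2 * s + 1)\<rparr> Mod Phi_pow n (2 * s + 3)) \<cong>
      (G\<lparr>carrier := Sigma'_pow n (2 * s + 1)\<rparr> Mod Sigma'_pow n (2 * s + 3)) \<times>\<times>
      (G\<lparr>carrier := Phi' n s\<rparr> Mod Phi_pow n (2 * s + 3)))
     \<and>
     (\<forall>\<sigma>\<in>(Phi_pow n (2 * s + 1) :: ((nat set \<Rightarrow> 'k) \<Rightarrow> nat set \<Rightarrow> 'k) set).
       (\<exists>b. leading_terms n s \<sigma> b) \<and>
       (\<forall>b. leading_terms n s \<sigma> b \<longrightarrow>
         (\<exists>\<phi>' lam a.
            factorization n s j \<sigma> \<phi>' lam a \<and> V_decomposition n s j b lam a \<and>
            (\<forall>\<phi>'' lam' a'. factorization n s j \<sigma> \<phi>'' lam' a' \<longrightarrow>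
               \<phi>'' = \<phi>' \<and> lam' = lam \<and> a' = a) \<and>
            (\<forall>lam' a'. V_decomposition n s j b lam' a' \<longrightarrow> lam' = lam \<and> a' = a))))"
proof -
  interpret avoidance n s j
    by standard (use assms(2-5) in auto)
  have P: "Phi_pow n (2 * s + 1) = (unip_group n (2 * s) :: ((nat set \<Rightarrow> 'k) \<Rightarrow> nat set \<Rightarrow> 'k) set)"
    "Phi_pow n (2 * s + 3) = (unip_group n (2 * s + 2) :: ((nat set \<Rightarrow> 'k) \<Rightarrow> nat set \<Rightarrow> 'k) set)"
    using s_pos by (intro Phi_pow_eq; simp)+
  have S1: "Sigma'_pow n (2 * s + 1) = (unimod_group n (2 * s) :: ((nat set \<Rightarrow> 'k) \<Rightarrow> nat set \<Rightarrow> 'k) set)"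
    using s_pos by (intro Sigma'_pow_eq) simp_all
  have "Sigma'_pow n (2 * s + 3) = (unimod_group n (2 * s + 2) :: ((nat set \<Rightarrow> 'k) \<Rightarrow> nat set \<Rightarrow> 'k) set)"
    by (intro Sigma'_pow_eq) simp_all
  \<comment> \<open>The form A \<inter> N in which \<open>quotient_decomposition\<close> expects the
    kernel on \<Sigma>'^{2s+1}.\<close>
  then have S2: "Sigma'_pow n (2 * s + 3) =
      unimod_group n (2 * s) \<inter> (unip_group n (2 * s + 2) :: ((nat set \<Rightarrow> 'k) \<Rightarrow> nat set \<Rightarrow> 'k) set)"
    using unip_group_mono[of "2 * s" "2 * s + 2" n] by (auto simp: unimod_group_def)
  have e: "1 \<le> 2 * s" using s_pos by simp
  have SU: "unimod_group n (2 * s) \<subseteq> unip_group n (2 * s)" and PU: "Phi' n s \<subseteq> unip_group n (2 * s)"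
    by (auto simp: unimod_group_def Phi'_eq[OF s_pos])
  \<comment> \<open>Zero leading terms satisfy the support condition trivially.\<close>
  have NB: "unip_group n (2 * s + 2) \<subseteq> (Phi' n s :: ((nat set \<Rightarrow> 'k) \<Rightarrow> nat set \<Rightarrow> 'k) set)"
    unfolding lead_kernel Phi'_eq[OF s_pos] by (auto simp: Vgrp_def fun_apply)
  have surj: "lead n (2 * s) ` unip_group n (2 * s) = carrier (Vgrp n (2 * s) :: (nat \<Rightarrow> nat set \<Rightarrow> 'k) monoid)"
  proof
    show "lead n (2 * s) ` unip_group n (2 * s) \<subseteq> carrier (Vgrp n (2 * s) :: (nat \<Rightarrow> nat set \<Rightarrow> 'k) monoid)"
      by (auto simp: Vgrp_def unip_group_D lead_Vcar)
    show "carrier (Vgrp n (2 * s) :: (nat \<Rightarrow> nat set \<Rightarrow> 'k) monoid) \<subseteq> lead n (2 * s) ` unip_group n (2 * s)"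
    proof
      fix v :: "nat \<Rightarrow> nat set \<Rightarrow> 'k" assume "v \<in> carrier (Vgrp n (2 * s))"
      then obtain x y where xy: "x \<in> unip_group n (2 * s)" "y \<in> unip_group n (2 * s)"
        "v = lead n (2 * s) x + lead n (2 * s) y"
        using decomposition_lead[of v] SU PU by (auto simp: Vgrp_def)
      then show "v \<in> lead n (2 * s) ` unip_group n (2 * s)"
        using lead_mult[OF xy(1,2) e] subgroup.m_closed[OF subgroup_unip_group[OF e] xy(1,2)]
          by (metis imageI)
    qed
  qed
  have gen: "\<forall>v\<in>carrier (Vgrp n (2 * s) :: (nat \<Rightarrow> nat set \<Rightarrow> 'k) monoid).
      \<exists>x\<in>unimod_group n (2 * s). \<exists>y\<in>Phi' n s. v = lead n (2 * s) x \<otimes>\<^bsub>Vgrp n (2 * s)\<^esub> lead n (2 * s) y"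
    by (intro ballI) (simp add: Vgrp_def decomposition_lead)
  have one_V: "\<one>\<^bsub>Vgrp n (2 * s)\<^esub> = (0 :: nat \<Rightarrow> nat set \<Rightarrow> 'k)" by (simp add: Vgrp_def)
  have int: "\<forall>x\<in>unimod_group n (2 * s). \<forall>y\<in>Phi' n s. lead n (2 * s) x = lead n (2 * s) y \<longrightarrow>
      lead n (2 * s) x = \<one>\<^bsub>Vgrp n (2 * s) :: (nat \<Rightarrow> nat set \<Rightarrow> 'k) monoid\<^esub>"
    unfolding one_V using unimod_group_Phi'_lead by blast
  \<comment> \<open>Here H is \<Phi>^{2s+1}, A is \<Sigma>'^{2s+1}, B is \<Phi>'^{2s+1} and N is
    \<Phi>^{2s+3}.\<close>
  note q = quotient_decomposition[OF group_BijGroup subgroup_unip_group[OF e] subgroup_unimod_group[OF e] subgroup_Phi'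
      SU PU comm_group_Vgrp lead_hom surj lead_kernel NB gen int]
  have part3: "(\<exists>b. leading_terms n s \<sigma> b) \<and>
       (\<forall>b. leading_terms n s \<sigma> b \<longrightarrow>
         (\<exists>\<phi>' lam a.
            factorization n s j \<sigma> \<phi>' lam a \<and> V_decomposition n s j b lam a \<and>
            (\<forall>\<phi>'' lam' a'. factorization n s j \<sigma> \<phi>'' lam' a' \<longrightarrow>
               \<phi>'' = \<phi>' \<and> lam' = lam \<and> a' = a) \<and>
            (\<forall>lam' a'. V_decomposition n s j b lam' a' \<longrightarrow> lam' = lam \<and> a' = a)))"
    if \<sigma>: "\<sigma> \<in> unip_group n (2 * s)" for \<sigma> :: "(nat set \<Rightarrow> 'k) \<Rightarrow> nat set \<Rightarrow> 'k"
  proof (intro conjI allI impI)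
    show "\<exists>b. leading_terms n s \<sigma> b" by (simp add: leading_terms_iff[OF \<sigma> s_pos])
    fix b assume "leading_terms n s \<sigma> b"
    then have b: "b k = lead n (2 * s) \<sigma> k" if "k \<in> {1..n}" for k
      using that by (simp add: leading_terms_iff[OF \<sigma> s_pos])
    obtain lam a where la: "lam \<in> lambda_params n s" "a \<in> a_params n s"
      "lead n (2 * s) \<sigma> = rsum lam + avec a"
      using decomposition_exists[OF lead_Vcar[OF unip_group_D(3)[OF \<sigma>]]] by blast
    obtain \<phi> where p: "\<phi> \<in> Phi' n s" "\<forall>k\<in>{1..<n - 2 * s}. \<phi> (xgen k) = xgen k"
      "\<forall>i\<in>{n - 2 * s..n}. \<phi> (xgen i) = xgen i \<star> (xmon {} + a i)"
      using phi_exists[OF la(2)] by blast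
    note f = factorization_iff[OF \<sigma> q(3) q(6)]
    \<comment> \<open>Agreement is asked on {1..n} only, which is what
      \<open>V_decomposition\<close> supplies; a factorization supplies more, so both uniqueness
      claims follow from this.\<close>
    have uniq: "lam' = lam \<and> a' = a"
      if "lam' \<in> lambda_params n s" "a' \<in> a_params n s"
        "\<And>k. k \<in> {1..n} \<Longrightarrow> lead n (2 * s) \<sigma> k = (rsum lam' + avec a') k" for lam' a'
    proof -
      have "(rsum lam' + avec a') k = (rsum lam + avec a) k" if "k \<in> {1..n}" for k
        using \<open>\<And>k. k \<in> {1..n} \<Longrightarrow> lead n (2 * s) \<sigma> k = (rsum lam' + avec a') k\<close>[OF that] la(3)
        by simp
      then show ?thesis using decomposition_unique[OF that(1) la(1) that(2) la(2)] by blast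
    qed
    show "\<exists>\<phi>' lam a. factorization n s j \<sigma> \<phi>' lam a \<and> V_decomposition n s j b lam a \<and>
        (\<forall>\<phi>'' lam' a'. factorization n s j \<sigma> \<phi>'' lam' a' \<longrightarrow> \<phi>'' = \<phi>' \<and> lam' = lam \<and> a' = a) \<and>
        (\<forall>lam' a'. V_decomposition n s j b lam' a' \<longrightarrow> lam' = lam \<and> a' = a)"
    proof (intro exI conjI allI impI)
      show "factorization n s j \<sigma> \<phi> lam a" using f la p by blast
      show "V_decomposition n s j b lam a" using la b by (simp add: V_decomposition_iff)
    next
      fix lam' a' assume "V_decomposition n s j b lam' a'"
      then have "lam' \<in> lambda_params n s" "a' \<in> a_params n s"
        "\<And>k. k \<in> {1..n} \<Longrightarrow> lead n (2 * s) \<sigma> k = (rsum lam' + avec a') k"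
        using b by (auto simp: V_decomposition_iff)
      from uniq[OF this] show "lam' = lam" "a' = a" by auto
    next
      fix \<phi>' lam' a' assume "factorization n s j \<sigma> \<phi>' lam' a'"
      then have p': "\<phi>' \<in> Phi' n s" "\<forall>k\<in>{1..<n - 2 * s}. \<phi>' (xgen k) = xgen k"
        "\<forall>i\<in>{n - 2 * s..n}. \<phi>' (xgen i) = xgen i \<star> (xmon {} + a' i)"
        and la': "lam' \<in> lambda_params n s" "a' \<in> a_params n s"
          "lead n (2 * s) \<sigma> = rsum lam' + avec a'"
        using f by blast+
      have eq: "lam' = lam \<and> a' = a" by (rule uniq[OF la'(1,2)]) (simp only: la'(3))
      then show "lam' = lam" "a' = a" by auto
      show "\<phi>' = \<phi>"
      \<comment> \<open>Once a' = a, both automorphisms have the same prescribed values on all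
        generators.\<close>
      proof (rule Grassmann_aut_eqI)
        show "\<phi>' \<in> Grassmann_aut n" "\<phi> \<in> Grassmann_aut n" using p p' PU unip_group_D(4) by blast+
        fix i assume "i \<in> {1..n}"
        then show "\<phi>' (xgen i) = \<phi> (xgen i)"
          using p p' eq by (cases "i \<in> {n - 2 * s..n}") auto
      qed
    qed
  qed
  show ?thesis
    unfolding G_def P S1 S2
    by (intro conjI q ballI part3) auto
qed
end
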